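(* Let $v\in\mathcal N_0$. The mapping $\rho_0^v:L^\infty\to L^\infty(\mathcal F_0)$ defined by $$\rho_0^v(X)=\operatorname{ess\,inf}\{m\in L^\infty(\mathcal F_0):\ X-mv\in\mathcal A_0\}$$ is a $v$-denominated, conditional, relevant, coherent risk measure (with respect to $\mathcal F_0$) which satisfies the Fatou property. Moreover: (i) $\mathcal A_0=\{X\in L^\infty:\ \rho_0^v(X)\le0\ \text{a.s.}\}$; (ii) for all $X\in L^\infty$, $$\rho_0^v(X)=\operatorname{ess\,sup}\left\{\frac{\mathbb E_{\mathbb Q}(X\mid\mathcal F_0)}{\mathbb E_{\mathbb Q}(v\mid\mathcal F_0)}:\ \mathbb Q\in\mathcal Q\right\}.$$
   Context: Let $(\Omega,\mathcal F,\mathbb P)$ be a probability space and $\mathcal F_0\subset\mathcal F$ a sub-$\sigma$-algebra (not necessarily trivial). $L^\infty=L^\infty(\mathcal F)$ is taken with respect to $\mathbb P$; $L^\infty_+$ denotes its non-negative elements. Fix a relevant coherent risk measure with the Fatou property $\rho:L^\infty\to\mathbb R$, used as a pricing functional, i.e.: $X\le Y$ implies $\rho(X)\le\rho(Y)$; $\rho(X+Y)\le\rho(X)+\rho(Y)$; $\rho(X+c)=\rho(X)+c$ for $c\in\mathbb R$; $\rho(aX)=a\rho(X)$ for real $a\ge0$; $\rho(X)\le\liminf_n\rho(X_n)$ whenever $(X_n)$ is uniformly bounded by $1$ and converges to $X$ in probability; $\rho(1_F)>0$ whenever $\mathbb P(F)>0$. Its acceptance set is $\mathcal A=\{X\in L^\infty:\rho(X)\le0\}$,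 and its set of test probabilities is $\mathcal Q=\{\mathbb Q\ll\mathbb P:\ \mathbb E(\tfrac{d\mathbb Q}{d\mathbb P}X)\le0\ \text{for all }X\in\mathcal A\}$, so that $\rho(X)=\sup_{\mathbb Q\in\mathcal Q}\mathbb E_{\mathbb Q}(X)$; $\mathcal Q$ contains a measure equivalent to $\mathbb P$. Define $\rho_0(X)=\operatorname{ess\,sup}\{\mathbb E_{\mathbb Q}(X\mid\mathcal F_0):\mathbb Q\in\mathcal Q\}$ and $\mathcal A_0=\{X\in L^\infty:\ \mathbb E_{\mathbb Q}(X\mid\mathcal F_0)\le0\text{ for all }\mathbb Q\in\mathcal Q\}=\{X:\rho_0(X)\le0\text{ a.s.}\}$. Convention: $\mathbb E_{\mathbb Q}(\cdot\mid\mathcal F_0)$ is determined only $\mathbb Q$-a.s.; inequalities for it are understood $\mathbb Q$-a.s., and in an essential supremum over $\mathcal Q$ the measure $\mathbb Q$ contributes only on $\{\mathbb E(\tfrac{d\mathbb Q}{d\mathbb P}\mid\mathcal F_0)>0\}$ (value $-\infty$ elsewhere). The set of numéraires at time zero is $\mathcal N_0=\{v\in L^\infty_+:\ L^\infty=\mathcal A_0+L^\infty(\mathcal F_0)\,v\}$. A mapping $\tau:L^\infty(\mathcal F)\to L^\infty(\mathcal F_0)$ is a $v$-denominated, conditional, relevant, coherent risk measure with the Fatou property (with respect to $\mathcal F_0$) if, a.s.: (monotonicity) $X\le Y$ implies $\tau(X)\le\tau(Y)$; (subadditivity) $\tau(X+Y)\le\tau(X)+\tau(Y)$; ($\mathcal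 F_0$-translation invariance with respect to $v$) $\tau(X+yv)=\tau(X)+y$ for $y\in L^\infty(\mathcal F_0)$; ($\mathcal F_0$-positive homogeneity) $\tau(aX)=a\tau(X)$ for $a\in L^\infty_+(\mathcal F_0)$; (Fatou) $\tau(X)\le\liminf_n\tau(X_n)$ for every sequence $(X_n)$ uniformly bounded by $1$ converging to $X$ in probability; (relevance) for each $F\in\mathcal F$ with $\mathbb P[F\mid\mathcal F_0]>0$ a.s., $\tau(1_F)>0$ a.s.
   Formalization: The Fatou property with X_n → X in probability and an a.s. liminf fails for general F_0 (typewriter sequence, F_0=F, identity); it is replaced by: liminf inequality in probability under convergence in probability, and a.s. liminf inequality under a.s. convergence. *)

theory Defs
  imports "HOL-Probability.Probability"
begin

text \<open>
  Throughout, \<open>M\<close> is the probability space and \<open>F\<^sub>0\<close> a sub-\<open>\<sigma>\<close>-algebra, given (as in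
  \<open>HOL-Probability.Conditional_Expectation\<close>) by a measure of which only the measurable
  sets matter. Elements of \<open>L\<^sup>\<infinity>\<close> are represented by functions, and maps on \<open>L\<^sup>\<infinity>\<close> by
  maps on functions; monotonicity with respect to almost sure inequality makes the latter
  compatible with almost sure equality.
\<close>

definition Linf :: "'a measure \<Rightarrow> 'a measure \<Rightarrow> ('a \<Rightarrow> real) set" where
  "Linf M F = {X \<in> borel_measurable F. \<exists>c. AE x in M. \<bar>X x\<bar> \<le> c}"

definition tendsto_in_prob :: "'a measure \<Rightarrow> (nat \<Rightarrow> 'a \<Rightarrow> real) \<Rightarrow> ('a \<Rightarrow> real) \<Rightarrow> bool" where
  "tendsto_in_prob M Xn X \<longleftrightarrow>
     (\<forall>e>0. (\<lambda>n. measure M {x \<in> space M. \<bar>Xn n x - X x\<bar> > e}) \<longlonglongrightarrow> 0)"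

text \<open>\<open>Y \<le> liminf Yn\<close>, the lower limit being taken with respect to convergence in
  probability.\<close>

definition le_liminf_in_prob :: "'a measure \<Rightarrow> ('a \<Rightarrow> real) \<Rightarrow> (nat \<Rightarrow> 'a \<Rightarrow> real) \<Rightarrow> bool" where
  "le_liminf_in_prob M Y Yn \<longleftrightarrow>
     (\<forall>e>0. (\<lambda>n. measure M {x \<in> space M. Yn n x < Y x - e}) \<longlonglongrightarrow> 0)"

definition relevant_coherent_Fatou :: "'a measure \<Rightarrow> (('a \<Rightarrow> real) \<Rightarrow> real) \<Rightarrow> bool" where
  "relevant_coherent_Fatou M \<rho> \<longleftrightarrow>
     (\<forall>X \<in> Linf M M. \<forall>Y \<in> Linf M M. (AE x in M. X x \<le> Y x) \<longrightarrow> \<rho> X \<le> \<rho> Y) \<and>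
     (\<forall>X \<in> Linf M M. \<forall>Y \<in> Linf M M. \<rho> (\<lambda>x. X x + Y x) \<le> \<rho> X + \<rho> Y) \<and>
     (\<forall>X \<in> Linf M M. \<forall>c. \<rho> (\<lambda>x. X x + c) = \<rho> X + c) \<and>
     (\<forall>X \<in> Linf M M. \<forall>a\<ge>0. \<rho> (\<lambda>x. a * X x) = a * \<rho> X) \<and>
     (\<forall>Xn. \<forall>X \<in> Linf M M.
        (\<forall>n. Xn n \<in> Linf M M \<and> (AE x in M. \<bar>Xn n x\<bar> \<le> 1)) \<longrightarrow> tendsto_in_prob M Xn X \<longrightarrow>
        ereal (\<rho> X) \<le> liminf (\<lambda>n. ereal (\<rho> (Xn n)))) \<and>
     (\<forall>F \<in> sets M. measure M F > 0 \<longrightarrow> \<rho> (indicat_real F) > 0)"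

definition acceptance_set :: "'a measure \<Rightarrow> (('a \<Rightarrow> real) \<Rightarrow> real) \<Rightarrow> ('a \<Rightarrow> real) set" where
  "acceptance_set M \<rho> = {X \<in> Linf M M. \<rho> X \<le> 0}"

definition RN_density :: "'a measure \<Rightarrow> 'a measure \<Rightarrow> 'a \<Rightarrow> real" where
  "RN_density M Q x = enn2real (RN_deriv M Q x)"

definition test_probs :: "'a measure \<Rightarrow> (('a \<Rightarrow> real) \<Rightarrow> real) \<Rightarrow> 'a measure set" where
  "test_probs M \<rho> =
     {Q. prob_space Q \<and> sets Q = sets M \<and> absolutely_continuous M Q \<and>
         (\<forall>X \<in> acceptance_set M \<rho>. (LINT x|M. RN_density M Q x * X x) \<le> 0)}"

definition acceptance_set0 ::
  "'a measure \<Rightarrow> 'a measure \<Rightarrow> (('a \<Rightarrow> real) \<Rightarrow> real) \<Rightarrow> ('a \<Rightarrow> real) set" where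
  "acceptance_set0 M F\<^sub>0 \<rho> =
     {X \<in> Linf M M. \<forall>Q \<in> test_probs M \<rho>. AE x in Q. real_cond_exp Q F\<^sub>0 X x \<le> 0}"

definition numeraires ::
  "'a measure \<Rightarrow> 'a measure \<Rightarrow> (('a \<Rightarrow> real) \<Rightarrow> real) \<Rightarrow> ('a \<Rightarrow> real) set" where
  "numeraires M F\<^sub>0 \<rho> =
     {v \<in> Linf M M. (AE x in M. 0 \<le> v x) \<and>
        Linf M M = {\<lambda>x. Y x + m x * v x | Y m. Y \<in> acceptance_set0 M F\<^sub>0 \<rho> \<and> m \<in> Linf M F\<^sub>0}}"

text \<open>The essential supremum and infimum of a (possibly uncountable) family of random
  variables are determined only up to almost sure equality, so they are given as relations.\<close>

definition is_ess_sup :: "'a measure \<Rightarrow> ('a \<Rightarrow> ereal) set \<Rightarrow> ('a \<Rightarrow> ereal) \<Rightarrow> bool" where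
  "is_ess_sup M S g \<longleftrightarrow>
     g \<in> borel_measurable M \<and> (\<forall>f \<in> S. AE x in M. f x \<le> g x) \<and>
     (\<forall>h \<in> borel_measurable M. (\<forall>f \<in> S. AE x in M. f x \<le> h x) \<longrightarrow> (AE x in M. g x \<le> h x))"

definition is_ess_inf :: "'a measure \<Rightarrow> ('a \<Rightarrow> ereal) set \<Rightarrow> ('a \<Rightarrow> ereal) \<Rightarrow> bool" where
  "is_ess_inf M S g \<longleftrightarrow>
     g \<in> borel_measurable M \<and> (\<forall>f \<in> S. AE x in M. g x \<le> f x) \<and>
     (\<forall>h \<in> borel_measurable M. (\<forall>f \<in> S. AE x in M. h x \<le> f x) \<longrightarrow> (AE x in M. h x \<le> g x))"

definition is_rho0 ::
  "'a measure \<Rightarrow> 'a measure \<Rightarrow> (('a \<Rightarrow> real) \<Rightarrow> real) \<Rightarrow> ('a \<Rightarrow> real) \<Rightarrow>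
   (('a \<Rightarrow> real) \<Rightarrow> ('a \<Rightarrow> real)) \<Rightarrow> bool" where
  "is_rho0 M F\<^sub>0 \<rho> v \<tau> \<longleftrightarrow>
     (\<forall>X \<in> Linf M M.
        \<tau> X \<in> Linf M F\<^sub>0 \<and>
        is_ess_inf M
          {\<lambda>x. ereal (m x) | m. m \<in> Linf M F\<^sub>0 \<and> (\<lambda>x. X x - m x * v x) \<in> acceptance_set0 M F\<^sub>0 \<rho>}
          (\<lambda>x. ereal (\<tau> X x)))"

text \<open>\<open>E\<^sub>Q(X | F\<^sub>0)\<close> is determined \<open>M\<close>-almost surely only where \<open>E(dQ/dM | F\<^sub>0) > 0\<close>; elsewhere
  \<open>Q\<close> does not contribute to an essential supremum.\<close>

definition cond_ratio ::
  "'a measure \<Rightarrow> 'a measure \<Rightarrow> ('a \<Rightarrow> real) \<Rightarrow> 'a measure \<Rightarrow> ('a \<Rightarrow> real) \<Rightarrow> 'a \<Rightarrow> ereal" where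
  "cond_ratio M F\<^sub>0 v Q X x =
     (if real_cond_exp M F\<^sub>0 (RN_density M Q) x > 0
      then ereal (real_cond_exp Q F\<^sub>0 X x / real_cond_exp Q F\<^sub>0 v x)
      else - \<infinity>)"

text \<open>
  Fatou property of a conditional functional. With \<open>Xn\<close> converging only in probability and the
  lower limit taken pointwise, the property already fails for the identity (the case where
  \<open>F\<^sub>0\<close> is the whole \<open>\<sigma>\<close>-algebra): take for \<open>Xn\<close> minus the indicators of intervals of length
  tending to zero that sweep repeatedly over the unit interval. The lower limit thus has to be
  taken in the same mode as the convergence of \<open>Xn\<close>; both modes, in probability and almost
  sure, are required below. For a trivial \<open>F\<^sub>0\<close> this is the usual Fatou property.
\<close>

definition conditional_Fatou ::
  "'a measure \<Rightarrow> (('a \<Rightarrow> real) \<Rightarrow> ('a \<Rightarrow> real)) \<Rightarrow> bool" where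
  "conditional_Fatou M \<tau> \<longleftrightarrow>
     (\<forall>Xn. \<forall>X \<in> Linf M M.
        (\<forall>n. Xn n \<in> Linf M M \<and> (AE x in M. \<bar>Xn n x\<bar> \<le> 1)) \<longrightarrow>
        (tendsto_in_prob M Xn X \<longrightarrow> le_liminf_in_prob M (\<tau> X) (\<lambda>n. \<tau> (Xn n))) \<and>
        ((AE x in M. (\<lambda>n. Xn n x) \<longlonglongrightarrow> X x) \<longrightarrow>
           (AE x in M. ereal (\<tau> X x) \<le> liminf (\<lambda>n. ereal (\<tau> (Xn n) x)))))"

definition conditional_relevant_coherent_Fatou ::
  "'a measure \<Rightarrow> 'a measure \<Rightarrow> ('a \<Rightarrow> real) \<Rightarrow> (('a \<Rightarrow> real) \<Rightarrow> ('a \<Rightarrow> real)) \<Rightarrow> bool" where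
  "conditional_relevant_coherent_Fatou M F\<^sub>0 v \<tau> \<longleftrightarrow>
     (\<forall>X \<in> Linf M M. \<tau> X \<in> Linf M F\<^sub>0) \<and>
     (\<forall>X \<in> Linf M M. \<forall>Y \<in> Linf M M.
        (AE x in M. X x \<le> Y x) \<longrightarrow> (AE x in M. \<tau> X x \<le> \<tau> Y x)) \<and>
     (\<forall>X \<in> Linf M M. \<forall>Y \<in> Linf M M. AE x in M. \<tau> (\<lambda>x. X x + Y x) x \<le> \<tau> X x + \<tau> Y x) \<and>
     (\<forall>X \<in> Linf M M. \<forall>y \<in> Linf M F\<^sub>0. AE x in M. \<tau> (\<lambda>x. X x + y x * v x) x = \<tau> X x + y x) \<and>
     (\<forall>X \<in> Linf M M. \<forall>a \<in> Linf M F\<^sub>0. (AE x in M. 0 \<le> a x) \<longrightarrow>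
        (AE x in M. \<tau> (\<lambda>x. a x * X x) x = a x * \<tau> X x)) \<and>
     conditional_Fatou M \<tau> \<and>
     (\<forall>F \<in> sets M. (AE x in M. real_cond_exp M F\<^sub>0 (indicat_real F) x > 0) \<longrightarrow>
        (AE x in M. \<tau> (indicat_real F) x > 0))"

end

theory Submission
  imports Defs
begin

text \<open>
  The set \<open>A\<^sub>0\<close> is a convex cone, stable under multiplication by nonnegative bounded \<open>F\<^sub>0\<close>-measurable
  functions and closed under bounded almost sure convergence, and it contains no nonzero nonnegative
  element. Hence the hedges of \<open>X\<close>, the \<open>m \<in> L\<^sup>\<infinity>(F\<^sub>0)\<close> with \<open>X - m v \<in> A\<^sub>0\<close>, are closed under minima and
  under bounded almost sure limits, and minimising the expectation yields a least one. All
  properties of the risk measure follow from this minimality. For (ii), \<open>m\<close> is a hedge if and only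
  if it dominates all conditional ratios.

  That \<open>A\<^sub>0\<close> contains no nonzero nonnegative element requires that every event of positive probability
  is charged by some test probability. This is a separation of the acceptance set from an indicator
  by a countably additive functional. The Krein--Smulian argument produces radii \<open>r\<^sub>n \<rightarrow> \<infinity>\<close> and
  \<open>\<epsilon>\<^sub>n > 0\<close> such that \<open>W = {Z. \<forall>n. E (\<bar>Z\<bar> - r\<^sub>n)\<^sup>+ \<le> \<epsilon>\<^sub>n}\<close>, translated to the indicator, misses the
  acceptance set; the Hahn--Banach theorem then separates the two convex sets, and a functional that
  is bounded on \<open>W\<close> is continuous along bounded almost surely convergent sequences.
\<close>

section \<open>The Hahn--Banach theorem on spaces of functions\<close>

text \<open>The test probabilities are given by a polar condition that exhibits no member. Were
  there none, \<open>A\<^sub>0\<close> would be the whole of L^infinity and no hedge could be least.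
  The obstacle to finding one is that the Fatou property controls the acceptance set only along
  bounded sequences, that is, inside each ball separately, while a countably additive separation
  asks for one neighbourhood of the indicator that works for all balls at once. Each constraint of
  \<open>W\<close> bounds the L^1-distance from a ball, so it is continuous under bounded almost
  sure convergence, and a sequence bounded by c can only violate the constraints of the finitely
  many radii below c. Separation takes place on sets of functions, since L^infinity consists of
  representatives here; invariance under almost sure equality comes from the acceptance set, which
  contains every almost surely nonpositive bounded function. The numeraire enters mainly through two
  hedges: one of the constant 1, which keeps \<open>v\<close> from being worthless on any event, and
  one of - X, which bounds the hedges of X from below.\<close>

definition function_space :: "('a \<Rightarrow> real) set \<Rightarrow> bool" where
  "function_space V \<longleftrightarrow> (\<lambda>x. 0) \<in> V \<and> (\<forall>X \<in> V. \<forall>Y \<in> V. (\<lambda>x. X x + Y x) \<in> V) \<and>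
     (\<forall>X \<in> V. \<forall>a. (\<lambda>x. a * X x) \<in> V)"

definition sublinear_on :: "('a \<Rightarrow> real) set \<Rightarrow> (('a \<Rightarrow> real) \<Rightarrow> real) \<Rightarrow> bool" where
  "sublinear_on V p \<longleftrightarrow> (\<forall>X \<in> V. \<forall>Y \<in> V. p (\<lambda>x. X x + Y x) \<le> p X + p Y) \<and>
     (\<forall>X \<in> V. \<forall>a\<ge>0. p (\<lambda>x. a * X x) = a * p X)"

definition linear_functional_on :: "('a \<Rightarrow> real) set \<Rightarrow> (('a \<Rightarrow> real) \<Rightarrow> real) \<Rightarrow> bool" where
  "linear_functional_on V f \<longleftrightarrow> (\<forall>X \<in> V. \<forall>Y \<in> V. f (\<lambda>x. X x + Y x) = f X + f Y) \<and>
     (\<forall>X \<in> V. \<forall>a. f (\<lambda>x. a * X x) = a * f X)"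

lemma function_space_0: "function_space V \<Longrightarrow> (\<lambda>x. 0) \<in> V"
  and function_space_add: "function_space V \<Longrightarrow> X \<in> V \<Longrightarrow> Y \<in> V \<Longrightarrow> (\<lambda>x. X x + Y x) \<in> V"
  and function_space_mult: "function_space V \<Longrightarrow> X \<in> V \<Longrightarrow> (\<lambda>x. a * X x) \<in> V"
  by (auto simp: function_space_def)

lemma function_space_uminus: "function_space V \<Longrightarrow> X \<in> V \<Longrightarrow> (\<lambda>x. - X x) \<in> V"
  using function_space_mult[of V X "-1"] by simp

lemma sublinear_on_add:
  "sublinear_on V p \<Longrightarrow> X \<in> V \<Longrightarrow> Y \<in> V \<Longrightarrow> p (\<lambda>x. X x + Y x) \<le> p X + p Y"
  and sublinear_on_mult:
  "sublinear_on V p \<Longrightarrow> X \<in> V \<Longrightarrow> 0 \<le> a \<Longrightarrow> p (\<lambda>x. a * X x) = a * p X"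
  by (auto simp: sublinear_on_def)

lemma sublinear_on_0: "function_space V \<Longrightarrow> sublinear_on V p \<Longrightarrow> p (\<lambda>x. 0) = 0"
  using sublinear_on_mult[of V p "\<lambda>x. 0" 0] function_space_0 by force

lemma sublinear_on_uminus_ge:
  assumes "function_space V" "sublinear_on V p" "X \<in> V"
  shows "- p (\<lambda>x. - X x) \<le> p X"
  using sublinear_on_add[OF assms(2,3) function_space_uminus[OF assms(1,3)]]
    sublinear_on_0[OF assms(1,2)] by simp

text \<open>One inequality of positive homogeneity suffices: applied with factor \<open>1/a\<close>
  to \<open>\<lambda>x. a * X x\<close> it gives the other. The case \<open>a = 0\<close> is the
  normalisation at zero.\<close>

lemma sublinear_onI:
  assumes V: "function_space V"
    and add: "\<And>X Y. X \<in> V \<Longrightarrow> Y \<in> V \<Longrightarrow> p (\<lambda>x. X x + Y x) \<le> p X + p Y"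
    and mult: "\<And>X a. X \<in> V \<Longrightarrow> 0 < a \<Longrightarrow> p (\<lambda>x. a * X x) \<le> a * p X"
    and zero: "p (\<lambda>x. 0) = 0"
  shows "sublinear_on V p"
  unfolding sublinear_on_def
proof (intro conjI ballI allI impI)
  fix X a assume X: "X \<in> V" and a: "(0::real) \<le> a"
  show "p (\<lambda>x. a * X x) = a * p X"
  proof (cases "a = 0")
    case False
    with a have a: "0 < a" by simp
    have "p (\<lambda>x. (1/a) * (a * X x)) \<le> (1/a) * p (\<lambda>x. a * X x)"
      using a V X by (intro mult) (auto intro: function_space_mult)
    with a have "a * p X \<le> p (\<lambda>x. a * X x)" by (simp add: field_simps)
    with mult[OF X a] show ?thesis by simp
  qed (simp add: zero)
qed (rule add)

lemma sublinear_on_cong: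
  assumes "function_space V" "sublinear_on V p" "\<And>X. X \<in> V \<Longrightarrow> q X = p X"
  shows "sublinear_on V q"
  using assms by (auto simp: sublinear_on_def function_space_def)

text \<open>Take for q(X) the infimum over t \<ge> 0 of p(X + tY) - t p(Y), which lowers
  \<open>p\<close> along the ray of \<open>Y\<close>. Subadditivity bounds it below by - p(-X), t =
  0 puts it below \<open>p\<close>, and t = 1 at - Y gives the last claim, which forces
  \<open>q\<close> to be odd at \<open>Y\<close>.\<close>

lemma sublinear_on_reduce:
  assumes V: "function_space V" and p: "sublinear_on V p" and Y: "Y \<in> V"
  obtains q where "sublinear_on V q" "\<And>X. X \<in> V \<Longrightarrow> q X \<le> p X" "q (\<lambda>x. - Y x) \<le> - p Y"
proof -
  define g where "g X t = p (\<lambda>x. X x + t * Y x) - t * p Y" for X t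
  define q where "q X = (INF t\<in>{0..}. g X t)" for X
  have lower: "- p (\<lambda>x. - X x) \<le> g X t" if X: "X \<in> V" and t: "0 \<le> t" for X t
  proof -
    have "p (\<lambda>x. (X x + t * Y x) + - X x) \<le> p (\<lambda>x. X x + t * Y x) + p (\<lambda>x. - X x)"
      using V X Y
      by (intro sublinear_on_add[OF p] function_space_add function_space_mult function_space_uminus)
    then show ?thesis using sublinear_on_mult[OF p Y t] by (simp add: g_def)
  qed
  have bdd: "bdd_below (g X ` {0..})" if "X \<in> V" for X
    using lower[OF that] by (intro bdd_belowI[of _ "- p (\<lambda>x. - X x)"]) auto
  have q_le: "q X \<le> g X t" if "X \<in> V" "0 \<le> t" for X t
    unfolding q_def using that by (intro cINF_lower bdd) auto
  have q_ge: "c \<le> q X" if "\<And>t. 0 \<le> t \<Longrightarrow> c \<le> g X t" for c X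
    unfolding q_def using that by (intro cINF_greatest) auto
  have "sublinear_on V q"
  proof (rule sublinear_onI[OF V])
    fix X Z assume X: "X \<in> V" and Z: "Z \<in> V"
    have *: "q (\<lambda>x. X x + Z x) \<le> g X t + g Z s" if t: "0 \<le> t" and s: "0 \<le> s" for t s
    proof -
      have "q (\<lambda>x. X x + Z x) \<le> g (\<lambda>x. X x + Z x) (t + s)"
        using X Z V t s by (intro q_le function_space_add) auto
      also have "\<dots> = p (\<lambda>x. (X x + t * Y x) + (Z x + s * Y x)) - (t + s) * p Y"
        by (simp add: g_def algebra_simps)
      also have "\<dots> \<le> p (\<lambda>x. X x + t * Y x) + p (\<lambda>x. Z x + s * Y x) - (t + s) * p Y"
        using X Y Z V by (intro diff_right_mono sublinear_on_add[OF p] function_space_add function_space_mult)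
      also have "\<dots> = g X t + g Z s"
        by (simp add: g_def algebra_simps)
      finally show ?thesis .
    qed
    have "q (\<lambda>x. X x + Z x) - g X t \<le> q Z" if "0 \<le> t" for t
      using * that by (intro q_ge) (auto simp: algebra_simps)
    then have "q (\<lambda>x. X x + Z x) - q Z \<le> q X"
      by (intro q_ge) (auto simp: algebra_simps)
    then show "q (\<lambda>x. X x + Z x) \<le> q X + q Z" by simp
  next
    fix X a assume X: "X \<in> V" and a: "(0::real) < a"
    have "q (\<lambda>x. a * X x) / a \<le> q X"
    proof (rule q_ge)
      fix t :: real assume t: "0 \<le> t"
      have "q (\<lambda>x. a * X x) \<le> g (\<lambda>x. a * X x) (a * t)"
        using X V a t by (intro q_le function_space_mult) auto
      also have "\<dots> = p (\<lambda>x. a * (X x + t * Y x)) - a * t * p Y"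
        by (simp add: g_def algebra_simps)
      also have "\<dots> = a * g X t"
        using sublinear_on_mult[OF p, of "\<lambda>x. X x + t * Y x" a]
          function_space_add[OF V X function_space_mult[OF V Y]] a
        by (simp add: g_def right_diff_distrib)
      finally show "q (\<lambda>x. a * X x) / a \<le> g X t" using a by (simp add: field_simps)
    qed
    then show "q (\<lambda>x. a * X x) \<le> a * q X" using a by (simp add: field_simps)
  next
    have "q (\<lambda>x. 0) \<le> g (\<lambda>x. 0) 0" by (intro q_le function_space_0 V) auto
    moreover have "0 \<le> q (\<lambda>x. 0)"
      by (intro q_ge) (use lower[OF function_space_0[OF V]] sublinear_on_0[OF V p] in auto)
    ultimately show "q (\<lambda>x. 0) = 0" using sublinear_on_0[OF V p] by (simp add: g_def)
  qed
  moreover have "q X \<le> p X" if "X \<in> V" for X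
    using q_le[OF that, of 0] by (simp add: g_def)
  moreover have "q (\<lambda>x. - Y x) \<le> - p Y"
    using q_le[OF function_space_uminus[OF V Y], of 1] sublinear_on_0[OF V p] by (simp add: g_def)
  ultimately show ?thesis by (rule that)
qed

text \<open>Zorn's lemma gives a minimal sublinear functional below \<open>p\<close>, and minimality against the
  reductions of the previous lemma forces it to be odd, hence additive.\<close>

lemma sublinear_on_dominates_linear:
  assumes V: "function_space V" and p: "sublinear_on V p"
  obtains f where "linear_functional_on V f" "\<And>X. X \<in> V \<Longrightarrow> f X \<le> p X"
proof -
  \<comment> \<open>Functionals live on all functions; the default value 0 outside \<open>V\<close>
    makes the pointwise order antisymmetric on \<open>A\<close>.\<close>
  define A where "A = {q. sublinear_on V q \<and> (\<forall>X\<in>V. q X \<le> p X) \<and> (\<forall>X. X \<notin> V \<longrightarrow> q X = 0)}"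
  \<comment> \<open>The order is reversed, so that a maximal element in the sense of Zorn is a
    minimal functional.\<close>
  define P :: "(('a \<Rightarrow> real) \<Rightarrow> real) \<Rightarrow> (('a \<Rightarrow> real) \<Rightarrow> real) \<Rightarrow> bool"
    where "P a b \<longleftrightarrow> (\<forall>X. b X \<le> a X)" for a b
  have restr: "(\<lambda>X. if X \<in> V then q X else 0) \<in> A"
    if "sublinear_on V q" "\<And>X. X \<in> V \<Longrightarrow> q X \<le> p X" for q
    using that sublinear_on_cong[OF V that(1), of "\<lambda>X. if X \<in> V then q X else 0"]
    by (auto simp: A_def)
  have po: "partial_order_on A (relation_of P A)"
    by (rule partial_order_on_relation_ofI) (auto simp: P_def fun_eq_iff intro: order_trans antisym)
  have "\<exists>u\<in>A. \<forall>a\<in>C. P a u" if C: "C \<in> Chains (relation_of P A)" for C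
  proof (cases "C = {}")
    case True
    then show ?thesis using restr[OF p] by auto
  next
    case False
    have CA: "C \<subseteq> A" using Chains_relation_of[OF C] .
    have total: "P a b \<or> P b a" if "a \<in> C" "b \<in> C" for a b
      using C that by (auto simp: Chains_def relation_of_def)
    define q where "q X = (INF a\<in>C. a X)" for X
    have lower: "- p (\<lambda>x. - X x) \<le> a X" if "X \<in> V" "a \<in> C" for X a
    proof -
      have "a (\<lambda>x. - X x) \<le> p (\<lambda>x. - X x)"
        using that CA V by (auto simp: A_def function_space_uminus)
      moreover have "- a (\<lambda>x. - X x) \<le> a X"
        using that CA V by (intro sublinear_on_uminus_ge[of V]) (auto simp: A_def)
      ultimately show ?thesis by simp
    qed
    have bdd: "bdd_below ((\<lambda>a. a X) ` C)" if "X \<in> V" for X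
      using lower[OF that] by (intro bdd_belowI[of _ "- p (\<lambda>x. - X x)"]) auto
    have q_le: "q X \<le> a X" if "X \<in> V" "a \<in> C" for X a
      unfolding q_def using that by (intro cINF_lower bdd) auto
    have q_ge: "c \<le> q X" if "\<And>a. a \<in> C \<Longrightarrow> c \<le> a X" for c X
      unfolding q_def using that False by (intro cINF_greatest) auto
    have sub: "sublinear_on V q"
    proof (rule sublinear_onI[OF V])
      fix X Z assume X: "X \<in> V" and Z: "Z \<in> V"
      have *: "q (\<lambda>x. X x + Z x) \<le> a X + b Z" if ab: "a \<in> C" "b \<in> C" for a b
      proof -
        \<comment> \<open>By totality of the chain, the smaller of \<open>a\<close> and
          \<open>b\<close> can be used at both arguments; this is why the infimum stays
          subadditive.\<close>
        obtain c where c: "c \<in> C" "c X \<le> a X" "c Z \<le> b Z"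
          using total[OF ab] ab unfolding P_def by blast
        have "q (\<lambda>x. X x + Z x) \<le> c (\<lambda>x. X x + Z x)"
          using X Z V c by (intro q_le function_space_add)
        also have "\<dots> \<le> c X + c Z"
          using c CA X Z by (intro sublinear_on_add[of V]) (auto simp: A_def)
        finally show ?thesis using c by simp
      qed
      have "q (\<lambda>x. X x + Z x) - a X \<le> q Z" if a: "a \<in> C" for a
      proof (rule q_ge)
        fix b assume "b \<in> C"
        from *[OF a this] show "q (\<lambda>x. X x + Z x) - a X \<le> b Z" by simp
      qed
      then have "q (\<lambda>x. X x + Z x) - q Z \<le> q X"
        by (intro q_ge) (auto simp: algebra_simps)
      then show "q (\<lambda>x. X x + Z x) \<le> q X + q Z" by simp
    next
      fix X a assume X: "X \<in> V" and a: "(0::real) < a"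
      have "q (\<lambda>x. a * X x) / a \<le> q X"
      proof (rule q_ge)
        fix b assume b: "b \<in> C"
        have "q (\<lambda>x. a * X x) \<le> b (\<lambda>x. a * X x)"
          using X V b by (intro q_le function_space_mult)
        also have "\<dots> = a * b X"
          using b CA X a by (intro sublinear_on_mult[of V]) (auto simp: A_def)
        finally show "q (\<lambda>x. a * X x) / a \<le> b X" using a by (simp add: field_simps)
      qed
      then show "q (\<lambda>x. a * X x) \<le> a * q X" using a by (simp add: field_simps)
    next
      have "a (\<lambda>x. 0) = 0" if "a \<in> C" for a
        using that CA by (intro sublinear_on_0[OF V]) (auto simp: A_def)
      then have "(\<lambda>a. a (\<lambda>x. 0)) ` C = {0}" using False by force
      then show "q (\<lambda>x. 0) = 0" by (simp add: q_def)
    qed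
    have le_p: "q X \<le> p X" if "X \<in> V" for X
    proof -
      obtain a where a: "a \<in> C" using False by auto
      then have "a X \<le> p X" using CA that by (auto simp: A_def)
      with q_le[OF that a] show ?thesis by simp
    qed
    have "P a (\<lambda>X. if X \<in> V then q X else 0)" if "a \<in> C" for a
      using that CA q_le by (fastforce simp: P_def A_def)
    then show ?thesis using restr[OF sub le_p] by blast
  qed
  from predicate_Zorn[OF po this]
  obtain m where m: "m \<in> A" and min: "\<And>a. a \<in> A \<Longrightarrow> P m a \<Longrightarrow> a = m" by blast
  have sub: "sublinear_on V m" and mp: "\<And>X. X \<in> V \<Longrightarrow> m X \<le> p X" and m0: "\<And>X. X \<notin> V \<Longrightarrow> m X = 0"
    using m by (auto simp: A_def)
  have odd: "m (\<lambda>x. - Y x) = - m Y" if Y: "Y \<in> V" for Y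
  proof -
    obtain q where q: "sublinear_on V q" "\<And>X. X \<in> V \<Longrightarrow> q X \<le> m X" "q (\<lambda>x. - Y x) \<le> - m Y"
      using sublinear_on_reduce[OF V sub Y] by blast
    have "(\<lambda>X. if X \<in> V then q X else 0) = m"
      using q mp m0 by (intro min restr) (auto simp: P_def intro: order_trans)
    then have "m (\<lambda>x. - Y x) = q (\<lambda>x. - Y x)"
      using function_space_uminus[OF V Y] by (auto dest: fun_cong[where x="\<lambda>x. - Y x"])
    with q(3) sublinear_on_uminus_ge[OF V sub Y] show ?thesis by simp
  qed
  have "linear_functional_on V m"
    unfolding linear_functional_on_def
  proof (intro conjI ballI allI)
    fix X Y assume X: "X \<in> V" and Y: "Y \<in> V"
    have "m (\<lambda>x. (X x + Y x) + - Y x) \<le> m (\<lambda>x. X x + Y x) + m (\<lambda>x. - Y x)"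
      using X Y V by (intro sublinear_on_add[OF sub] function_space_add function_space_uminus)
    with odd[OF Y] sublinear_on_add[OF sub X Y]
    show "m (\<lambda>x. X x + Y x) = m X + m Y" by simp
  next
    fix X and a :: real assume X: "X \<in> V"
    show "m (\<lambda>x. a * X x) = a * m X"
    proof (cases "0 \<le> a")
      case False
      have "m (\<lambda>x. - ((- a) * X x)) = - m (\<lambda>x. (- a) * X x)"
        using X V by (intro odd function_space_mult)
      with sublinear_on_mult[OF sub X, of "- a"] False show ?thesis by simp
    qed (rule sublinear_on_mult[OF sub X])
  qed
  from that[OF this mp] show ?thesis .
qed

text \<open>Lowering \<open>p\<close> at \<open>B\<close> before linearising fixes the value there:
  f(-B) \<le> q(-B) \<le> - p(B) forces f(B) \<ge> p(B).\<close>

lemma Hahn_Banach_at: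
  assumes V: "function_space V" and p: "sublinear_on V p" and B: "B \<in> V"
  obtains f where "linear_functional_on V f" "\<And>X. X \<in> V \<Longrightarrow> f X \<le> p X" "f B = p B"
proof -
  obtain q where q: "sublinear_on V q" "\<And>X. X \<in> V \<Longrightarrow> q X \<le> p X" "q (\<lambda>x. - B x) \<le> - p B"
    using sublinear_on_reduce[OF V p B] by blast
  obtain f where f: "linear_functional_on V f" "\<And>X. X \<in> V \<Longrightarrow> f X \<le> q X"
    using sublinear_on_dominates_linear[OF V q(1)] by blast
  have "f (\<lambda>x. (-1) * B x) = (-1) * f B"
    using f(1) B unfolding linear_functional_on_def by blast
  with f(2)[OF function_space_uminus[OF V B]] q(3) have "p B \<le> f B" by simp
  with f(2)[OF B] q(2)[OF B] have "f B = p B" by simp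
  moreover have "f X \<le> p X" if "X \<in> V" for X
    using f(2)[OF that] q(2)[OF that] by simp
  ultimately show ?thesis using f(1) that by blast
qed

section \<open>Essentially bounded functions\<close>

lemma (in finite_measure) integrable_bounded_AE:
  assumes "X \<in> borel_measurable M" "AE x in M. \<bar>X x\<bar> \<le> (c::real)"
  shows "integrable M X"
  using assms by (intro integrable_const_bound[of _ c]) auto

text \<open>The infima \<open>s k\<close> of the squared L^2-norm grow to a limit \<open>l\<close>
  as the sets shrink. An element of a late set with norm close to \<open>l\<close> and its successor
  have their midpoint in the same set, where the norm cannot fall much below \<open>l\<close>; hence
  the two are close. The rate is chosen fast enough for almost sure convergence.\<close>

lemma (in prob_space) bounded_convex_seq_AE_limit:
  fixes S :: "nat \<Rightarrow> ('a \<Rightarrow> real) set"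
  assumes dec: "\<And>k. S (Suc k) \<subseteq> S k" and ne: "\<And>k. S k \<noteq> {}"
    and meas: "\<And>k X. X \<in> S k \<Longrightarrow> X \<in> borel_measurable M"
    and bdd: "\<And>k X. X \<in> S k \<Longrightarrow> AE x in M. \<bar>X x\<bar> \<le> r"
    and mid: "\<And>k X Y. X \<in> S k \<Longrightarrow> Y \<in> S k \<Longrightarrow> (\<lambda>x. (X x + Y x) / 2) \<in> S k"
  obtains X L where "\<And>k. X k \<in> S k" "L \<in> borel_measurable M" "AE x in M. (\<lambda>k. X k x) \<longlonglongrightarrow> L x"
proof -
  have S_mono: "S k \<subseteq> S j" if "j \<le> k" for j k
    using that dec by (rule lift_Suc_antimono_le[rotated])
  define q where "q X = (LINT x|M. (X x)\<^sup>2)" for X :: "'a \<Rightarrow> real"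
  have sq: "AE x in M. \<bar>(X x)\<^sup>2\<bar> \<le> r\<^sup>2" if "X \<in> S k" for X k
    using bdd[OF that]
  proof eventually_elim
    case (elim x)
    then show ?case using power_mono[of "\<bar>X x\<bar>" r 2] by simp
  qed
  have int: "integrable M (\<lambda>x. (X x)\<^sup>2)" if "X \<in> S k" for X k
    using meas[OF that] by (intro integrable_bounded_AE[OF _ sq[OF that]]) auto
  have q_ub: "q X \<le> r\<^sup>2" if "X \<in> S k" for X k
  proof -
    have "q X \<le> (LINT x|M. r\<^sup>2)"
      unfolding q_def using sq[OF that] int[OF that] by (intro integral_mono_AE) auto
    then show ?thesis by (simp add: prob_space)
  qed
  define s where "s k = Inf (q ` S k)" for k
  have bb: "bdd_below (q ` S k)" for k
    by (intro bdd_belowI[of _ 0]) (auto simp: q_def)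
  have s_le: "s k \<le> q X" if "X \<in> S k" for X k
    unfolding s_def using bb that by (intro cInf_lower) auto
  have "incseq s"
    unfolding s_def using bb ne by (intro monoI cInf_superset_mono image_mono S_mono) auto
  moreover have "s k \<le> r\<^sup>2" for k
    using ne[of k] s_le q_ub by (meson ex_in_conv order_trans)
  ultimately obtain l where l: "s \<longlonglongrightarrow> l" "\<And>k. s k \<le> l"
    using incseq_convergent by metis
  \<comment> \<open>An error of order \<open>(1/4)^k\<close> in the squared norms leaves
    L^1-differences of order \<open>(1/2)^k\<close>, which are summable.\<close>
  have "\<exists>n\<ge>k. l - (1/4)^k \<le> s n" for k :: nat
  proof -
    have "\<forall>\<^sub>F n in sequentially. l - (1/4)^k < s n"
      using l(1) by (intro order_tendstoD) auto
    then obtain N where "\<And>n. n \<ge> N \<Longrightarrow> l - (1/4)^k < s n"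
      by (auto simp: eventually_sequentially)
    then show ?thesis by (intro exI[of _ "max N k"]) (simp add: less_imp_le)
  qed
  then obtain n0 where n0: "\<And>k. k \<le> n0 k" "\<And>k. l - (1/4)^k \<le> s (n0 k)" by metis
  \<comment> \<open>The running maximum makes the indices monotone, so that the successor
    \<open>X (Suc k)\<close> also lies in \<open>S (n k)\<close>.\<close>
  define n where "n k = Max (n0 ` {..k})" for k
  have n_ge: "n0 k \<le> n k" for k unfolding n_def by (intro Max_ge) auto
  have n_Suc: "n k \<le> n (Suc k)" for k unfolding n_def by (intro Max_mono) auto
  have s_n: "l - (1/4)^k \<le> s (n k)" for k
    using n0(2)[of k] monoD[OF \<open>incseq s\<close> n_ge] by (rule order_trans)
  have "\<exists>X\<in>S (n k). q X \<le> l + (1/4)^k" for k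
  proof -
    have "Inf (q ` S (n k)) < l + (1/4)^k" using l(2)[of "n k"] zero_less_power[of "1/4::real" k] unfolding s_def by linarith
    then have "\<exists>y\<in>q ` S (n k). y < l + (1/4)^k"
      by (intro cInf_lessD) (simp_all add: ne)
    then show ?thesis by (auto intro: less_imp_le)
  qed
  then obtain X where X: "\<And>k. X k \<in> S (n k)" "\<And>k. q (X k) \<le> l + (1/4)^k" by metis
  define D where "D k x = X (Suc k) x - X k x" for k x
  have [measurable]: "X k \<in> borel_measurable M" for k using X(1) meas by blast
  have [measurable]: "D k \<in> borel_measurable M" for k unfolding D_def by measurable
  \<comment> \<open>The parallelogram identity makes almost minimal elements Cauchy in \<open>L\<^sup>2\<close>.\<close>
  have D2: "integrable M (\<lambda>x. (D k x)\<^sup>2)" "(LINT x|M. (D k x)\<^sup>2) \<le> 8 * (1/4)^k" for k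
  proof -
    have X': "X (Suc k) \<in> S (n k)" using X(1) S_mono[OF n_Suc] by blast
    let ?m = "\<lambda>x. (X k x + X (Suc k) x) / 2"
    have m: "?m \<in> S (n k)" by (rule mid[OF X(1) X'])
    have eq: "(D k x)\<^sup>2 = 2 * (X (Suc k) x)\<^sup>2 + 2 * (X k x)\<^sup>2 - 4 * (?m x)\<^sup>2" for x
      by (simp add: D_def power2_eq_square field_simps)
    note ints = int[OF X(1)[of k]] int[OF X'] int[OF m]
    show "integrable M (\<lambda>x. (D k x)\<^sup>2)" unfolding eq using ints by simp
    have aux: "2 * u + 2 * w - 4 * m \<le> 2 * (l + a) + 2 * (l + b) - 4 * (l - b)"
      if "w \<le> l + b" "u \<le> l + a" "t \<le> m" "l - b \<le> t" for u w m t a b :: real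
      using that by argo
    have "(LINT x|M. (D k x)\<^sup>2) = 2 * q (X (Suc k)) + 2 * q (X k) - 4 * q ?m"
      unfolding eq q_def using ints by simp
    also have "\<dots> \<le> 2 * (l + (1/4)^Suc k) + 2 * (l + (1/4)^k) - 4 * (l - (1/4)^k)"
      by (rule aux[OF X(2) X(2) s_le[OF m] s_n])
    also have "\<dots> \<le> 8 * (1/4)^k" by simp
    finally show "(LINT x|M. (D k x)\<^sup>2) \<le> 8 * (1/4)^k" .
  qed
  have D1: "(\<integral>\<^sup>+x. ennreal \<bar>D k x\<bar> \<partial>M) \<le> ennreal (9 * (1/2)^k)" for k
  proof -
    \<comment> \<open>A pointwise substitute for the Cauchy-Schwarz inequality: either |d| is at
      most \<open>(1/2)^k\<close>, or it is dominated by \<open>2^k * d\<^sup>2\<close>. Integrated,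
      this gives the factor 9 = 1 + 8.\<close>
    have le: "\<bar>d\<bar> \<le> (1/2)^k + 2^k * d\<^sup>2" for d :: real
    proof (cases "\<bar>d\<bar> \<le> (1/2)^k")
      case False
      then have "1 \<le> 2^k * \<bar>d\<bar>" by (simp add: field_simps)
      then have "\<bar>d\<bar> * 1 \<le> \<bar>d\<bar> * (2^k * \<bar>d\<bar>)" by (intro mult_left_mono) auto
      moreover have "\<bar>d\<bar> * (2^k * \<bar>d\<bar>) = 2^k * d\<^sup>2" by (simp add: power2_eq_square)
      moreover have "0 \<le> (1/2::real)^k" by simp
      ultimately show ?thesis by linarith
    qed (simp add: add_increasing2)
    have "(\<integral>\<^sup>+x. ennreal \<bar>D k x\<bar> \<partial>M) \<le> (\<integral>\<^sup>+x. ennreal ((1/2)^k + 2^k * (D k x)\<^sup>2) \<partial>M)"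
      by (intro nn_integral_mono ennreal_leI le)
    also have "\<dots> = ennreal (LINT x|M. (1/2)^k + 2^k * (D k x)\<^sup>2)"
      using D2(1) by (intro nn_integral_eq_integral) auto
    also have "(LINT x|M. (1/2)^k + 2^k * (D k x)\<^sup>2) = (1/2)^k + 2^k * (LINT x|M. (D k x)\<^sup>2)"
      using D2(1) by (simp add: prob_space)
    also have "\<dots> \<le> (1/2)^k + 2^k * (8 * (1/4)^k)"
      using D2(2)[of k] by simp
    also have "(2::real)^k * (8 * (1/4)^k) = 8 * (1/2)^k"
      by (simp flip: power_mult_distrib)
    finally show ?thesis by (simp add: ennreal_leI)
  qed
  have "(\<integral>\<^sup>+x. (\<Sum>k. ennreal \<bar>D k x\<bar>) \<partial>M) = (\<Sum>k. \<integral>\<^sup>+x. ennreal \<bar>D k x\<bar> \<partial>M)"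
    by (intro nn_integral_suminf) auto
  also have "\<dots> \<le> (\<Sum>k. ennreal (9 * (1/2)^k))"
    by (intro suminf_le D1) auto
  also have "\<dots> = ennreal (\<Sum>k. 9 * (1/2)^k)"
    by (intro suminf_ennreal2) (auto intro!: summable_mult summable_geometric)
  also have "\<dots> < \<infinity>" by simp
  finally have "AE x in M. (\<Sum>k. ennreal \<bar>D k x\<bar>) \<noteq> \<infinity>"
    by (intro nn_integral_PInf_AE) auto
  then have conv: "AE x in M. convergent (\<lambda>k. X k x)"
  proof eventually_elim
    case (elim x)
    then have "summable (\<lambda>k. \<bar>D k x\<bar>)"
      by (intro summable_suminf_not_top) auto
    then have "summable (\<lambda>k. D k x)" by (rule summable_rabs_cancel)
    then have "convergent (\<lambda>k. \<Sum>i<k. D i x)" by (simp add: summable_iff_convergent)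
    then have "convergent (\<lambda>k. X k x - X 0 x)"
      by (simp add: D_def sum_lessThan_telescope[of "\<lambda>k. X k x"])
    then have "convergent (\<lambda>k. (X k x - X 0 x) + X 0 x)"
      by (intro convergent_add convergent_const)
    then show ?case by simp
  qed
  show ?thesis
  proof (rule that)
    show "X k \<in> S k" for k using X(1) S_mono[of k "n k"] n0(1) n_ge order_trans by blast
    show "(\<lambda>x. lim (\<lambda>k. X k x)) \<in> borel_measurable M" by measurable
    show "AE x in M. (\<lambda>k. X k x) \<longlonglongrightarrow> lim (\<lambda>k. X k x)"
      using conv by (simp add: convergent_LIMSEQ_iff)
  qed
qed

section \<open>Closure properties and modes of convergence of essentially bounded functions\<close>

lemma LinfI: "X \<in> borel_measurable F \<Longrightarrow> AE x in M. \<bar>X x\<bar> \<le> c \<Longrightarrow> X \<in> Linf M F"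
  by (auto simp: Linf_def)

lemma Linf_measurable: "X \<in> Linf M F \<Longrightarrow> X \<in> borel_measurable F"
  by (simp add: Linf_def)

lemma Linf_bound:
  assumes "X \<in> Linf M F"
  obtains c where "0 < c" "AE x in M. \<bar>X x\<bar> \<le> c"
proof -
  from assms obtain c where c: "AE x in M. \<bar>X x\<bar> \<le> c" by (auto simp: Linf_def)
  have "AE x in M. \<bar>X x\<bar> \<le> max c 1" using c by eventually_elim simp
  with that[of "max c 1"] show ?thesis by simp
qed

lemma Linf_const [simp]: "(\<lambda>x. c) \<in> Linf M F"
  by (rule LinfI[where c="\<bar>c\<bar>"]) auto

lemma Linf_add [intro]:
  assumes "X \<in> Linf M F" "Y \<in> Linf M F"
  shows "(\<lambda>x. X x + Y x) \<in> Linf M F"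
proof -
  obtain c d where "AE x in M. \<bar>X x\<bar> \<le> c" "AE x in M. \<bar>Y x\<bar> \<le> d"
    using assms by (metis Linf_bound)
  then have "AE x in M. \<bar>X x + Y x\<bar> \<le> c + d" by eventually_elim simp
  then show ?thesis 
    by (rule LinfI[rotated]) (intro borel_measurable_add Linf_measurable[OF assms(1)] Linf_measurable[OF assms(2)])
qed

lemma Linf_mult [intro]:
  assumes "X \<in> Linf M F" "Y \<in> Linf M F"
  shows "(\<lambda>x. X x * Y x) \<in> Linf M F"
proof -
  obtain c d where cd: "0 < c" "AE x in M. \<bar>X x\<bar> \<le> c" "0 < d" "AE x in M. \<bar>Y x\<bar> \<le> d"
    using assms by (metis Linf_bound)
  from cd(2,4) have "AE x in M. \<bar>X x * Y x\<bar> \<le> c * d"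
  proof eventually_elim
    case (elim x)
    then show ?case using cd(1) by (simp add: abs_mult mult_mono)
  qed
  then show ?thesis 
    by (rule LinfI[rotated]) (intro borel_measurable_times Linf_measurable[OF assms(1)] Linf_measurable[OF assms(2)])
qed

lemma Linf_uminus [intro]: "X \<in> Linf M F \<Longrightarrow> (\<lambda>x. - X x) \<in> Linf M F"
  using Linf_mult[OF Linf_const, of X M F "-1"] by simp

lemma Linf_diff [intro]: "X \<in> Linf M F \<Longrightarrow> Y \<in> Linf M F \<Longrightarrow> (\<lambda>x. X x - Y x) \<in> Linf M F"
  using Linf_add[OF _ Linf_uminus, of X M F Y] by simp

lemma Linf_cmult [intro]: "X \<in> Linf M F \<Longrightarrow> (\<lambda>x. c * X x) \<in> Linf M F"
  by (intro Linf_mult Linf_const)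

lemma Linf_cdiv [intro]: "X \<in> Linf M F \<Longrightarrow> (\<lambda>x. X x / c) \<in> Linf M F"
  using Linf_cmult[of X M F "1/c"] by simp

lemma Linf_indicator [intro]: "A \<in> sets F \<Longrightarrow> indicat_real A \<in> Linf M F"
  by (rule LinfI[where c=1]) (auto simp: indicator_def)

lemma Linf_min [intro]:
  assumes "X \<in> Linf M F" "Y \<in> Linf M F"
  shows "(\<lambda>x. min (X x) (Y x)) \<in> Linf M F"
proof -
  obtain c d where "AE x in M. \<bar>X x\<bar> \<le> c" "AE x in M. \<bar>Y x\<bar> \<le> d"
    using assms by (metis Linf_bound)
  then have "AE x in M. \<bar>min (X x) (Y x)\<bar> \<le> max c d" by eventually_elim auto
  then show ?thesis 
    by (rule LinfI[rotated]) (intro borel_measurable_min Linf_measurable[OF assms(1)] Linf_measurable[OF assms(2)])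
qed

lemma Linf_subalgebra: "subalgebra M F \<Longrightarrow> X \<in> Linf M F \<Longrightarrow> X \<in> Linf M M"
  by (auto simp: Linf_def intro: measurable_from_subalg)

lemma function_space_Linf: "function_space (Linf M F)"
  by (auto simp: function_space_def)

lemma (in finite_measure) integrable_Linf: "X \<in> Linf M M \<Longrightarrow> integrable M X"
  by (auto simp: Linf_def intro: integrable_bounded_AE)

lemma AE_abs_limit_le:
  assumes "\<And>k::nat. AE x in M. \<bar>X k x\<bar> \<le> (c::real)" "AE x in M. (\<lambda>k. X k x) \<longlonglongrightarrow> L x"
  shows "AE x in M. \<bar>L x\<bar> \<le> c"
proof -
  from assms(1) have "AE x in M. \<forall>k. \<bar>X k x\<bar> \<le> c" by (simp add: AE_all_countable)
  with assms(2) show ?thesis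
    by eventually_elim (auto intro!: LIMSEQ_le_const2 tendsto_rabs)
qed

lemma (in finite_measure) integral_tendsto_bounded:
  fixes X :: "nat \<Rightarrow> 'a \<Rightarrow> real"
  assumes "\<And>k. X k \<in> borel_measurable M" "L \<in> borel_measurable M"
    and "\<And>k. AE x in M. \<bar>X k x\<bar> \<le> c" "AE x in M. (\<lambda>k. X k x) \<longlonglongrightarrow> L x"
  shows "(\<lambda>k. LINT x|M. X k x) \<longlonglongrightarrow> (LINT x|M. L x)"
  using assms by (intro integral_dominated_convergence[where w="\<lambda>_. c"]) auto

text \<open>Dominated convergence for the indicators of \<open>S k\<close>. It serves the passage
  from almost sure convergence to convergence in probability, and later the Fatou property in
  probability.\<close>

lemma (in finite_measure) AE_eventually_notin_measure:
  assumes S: "\<And>k. S k \<in> sets M" and ev: "AE x in M. \<forall>\<^sub>F k in sequentially. x \<notin> S k"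
  shows "(\<lambda>k. measure M (S k)) \<longlonglongrightarrow> 0"
proof -
  have "(\<lambda>k. LINT x|M. indicat_real (S k) x) \<longlonglongrightarrow> (LINT x|M. 0)"
  proof (rule integral_tendsto_bounded[where c=1])
    show "AE x in M. (\<lambda>k. indicat_real (S k) x) \<longlonglongrightarrow> 0"
      using ev
    proof eventually_elim
      case (elim x)
      then have "\<forall>\<^sub>F k in sequentially. indicat_real (S k) x = 0"
        by eventually_elim simp
      then show ?case by (rule tendsto_eventually)
    qed
  qed (use S in \<open>auto simp: indicator_def\<close>)
  then show ?thesis using S by (simp add: sets.Int_space_eq2)
qed

lemma (in finite_measure) AE_tendsto_imp_in_prob:
  assumes [measurable]: "\<And>k. X k \<in> borel_measurable M" "L \<in> borel_measurable M"
    and lim: "AE x in M. (\<lambda>k. X k x) \<longlonglongrightarrow> L x"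
  shows "tendsto_in_prob M X L"
  unfolding tendsto_in_prob_def
proof (intro allI impI)
  fix e :: real assume e: "0 < e"
  show "(\<lambda>k. measure M {x \<in> space M. e < \<bar>X k x - L x\<bar>}) \<longlonglongrightarrow> 0"
  proof (rule AE_eventually_notin_measure)
    show "AE x in M. \<forall>\<^sub>F k in sequentially. x \<notin> {x \<in> space M. e < \<bar>X k x - L x\<bar>}"
      using lim
    proof eventually_elim
      case (elim x)
      then have "\<forall>\<^sub>F k in sequentially. dist (X k x) (L x) < e" using e by (rule tendstoD)
      then show ?case by eventually_elim (auto simp: dist_real_def)
    qed
  qed measurable
qed

lemma Linf_if:
  assumes "G \<in> sets F" "X \<in> Linf M F" "Y \<in> Linf M F"
  shows "(\<lambda>x. if x \<in> G then X x else Y x) \<in> Linf M F"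
proof -
  obtain c d where "AE x in M. \<bar>X x\<bar> \<le> c" "AE x in M. \<bar>Y x\<bar> \<le> d"
    using assms(2,3) by (metis Linf_bound)
  then have "AE x in M. \<bar>if x \<in> G then X x else Y x\<bar> \<le> max c d" by eventually_elim auto
  then show ?thesis
    using measurable_If_set[OF Linf_measurable[OF assms(2)] Linf_measurable[OF assms(3)], of G] assms(1)
    by (intro LinfI) (auto simp: sets.Int_space_eq2)
qed

text \<open>A member minimising the expectation is least: its minimum with any other member is again
  a member, cannot have smaller expectation, and so agrees with it almost surely. Running minima
  turn a minimising sequence into a decreasing one, whose limit exists by the lower bound
  \<open>c\<close>. The abstract form is applied both to hedges and to the functions below an upper
  bound of the ratios.\<close>

lemma (in prob_space) Linf_least:
  assumes sub: "subalgebra M F" and S: "S \<subseteq> Linf M F" "S \<noteq> {}"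
    and lower: "\<And>m. m \<in> S \<Longrightarrow> AE x in M. c \<le> m x"
    and min: "\<And>m m'. m \<in> S \<Longrightarrow> m' \<in> S \<Longrightarrow> (\<lambda>x. min (m x) (m' x)) \<in> S"
    and closed: "\<And>u w b. \<lbrakk>\<And>k::nat. u k \<in> S; \<And>k. AE x in M. \<bar>u k x\<bar> \<le> b; w \<in> borel_measurable F;
        AE x in M. (\<lambda>k. u k x) \<longlonglongrightarrow> w x\<rbrakk> \<Longrightarrow> w \<in> S"
  obtains w where "w \<in> S" "\<And>m. m \<in> S \<Longrightarrow> AE x in M. w x \<le> m x"
proof -
  define I where "I m = (LINT x|M. m x)" for m :: "'a \<Rightarrow> real"
  have SM: "m \<in> Linf M M" if "m \<in> S" for m using that S(1) sub Linf_subalgebra by blast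
  have int: "integrable M m" if "m \<in> S" for m using SM[OF that] by (rule integrable_Linf)
  have "c \<le> I m" if "m \<in> S" for m
  proof -
    have "(LINT x|M. c) \<le> I m"
      unfolding I_def using lower[OF that] int[OF that] by (intro integral_mono_AE) auto
    then show ?thesis by (simp add: prob_space)
  qed
  then have bdd: "bdd_below (I ` S)" by (intro bdd_belowI[of _ c]) auto
  define i where "i = Inf (I ` S)"
  have i_le: "i \<le> I m" if "m \<in> S" for m
    unfolding i_def using bdd that by (intro cInf_lower) auto
  have "\<exists>m\<in>S. I m < i + 1 / real (Suc k)" for k
  proof -
    have "\<exists>y\<in>I ` S. y < i + 1 / real (Suc k)"
      using S(2) by (intro cInf_lessD) (auto simp: i_def)
    then show ?thesis by auto
  qed
  then obtain m where m: "\<And>k. m k \<in> S" "\<And>k. I (m k) < i + 1 / real (Suc k)" by metis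
  define u where "u = rec_nat (m 0) (\<lambda>k f x. min (f x) (m (Suc k) x))"
  have u_0: "u 0 = m 0" and u_Suc: "u (Suc k) = (\<lambda>x. min (u k x) (m (Suc k) x))" for k
    by (simp_all add: u_def)
  have uS: "u k \<in> S" for k
    by (induction k) (auto simp: u_0 u_Suc m intro: min)
  have u_le: "u k x \<le> m k x" for k x
    by (cases k) (auto simp: u_0 u_Suc)
  have dec: "decseq (\<lambda>k. u k x)" for x
    by (intro decseq_SucI) (simp add: u_Suc)
  have Iu: "I (u k) < i + 1 / real (Suc k)" for k
  proof -
    have "I (u k) \<le> I (m k)"
      unfolding I_def by (intro integral_mono int uS m u_le)
    with m(2)[of k] show ?thesis by simp
  qed
  obtain b where b: "AE x in M. \<bar>u 0 x\<bar> \<le> b" using uS[of 0] S(1) by (auto simp: Linf_def)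
  have "AE x in M. \<forall>k. c \<le> u k x" using lower[OF uS] by (simp add: AE_all_countable)
  with b have lim_bd: "AE x in M. (\<forall>k. \<bar>u k x\<bar> \<le> max b \<bar>c\<bar>) \<and> (\<lambda>k. u k x) \<longlonglongrightarrow> lim (\<lambda>k. u k x)"
  proof eventually_elim
    case (elim x)
    have "u k x \<le> u 0 x" for k using dec[of x] by (auto simp: decseq_def)
    with elim have "\<bar>u k x\<bar> \<le> max b \<bar>c\<bar>" for k by (smt (verit))
    moreover have "convergent (\<lambda>k. u k x)"
      using elim decseq_convergent[OF dec[of x], of c] unfolding convergent_def by metis
    ultimately show ?case by (simp add: convergent_LIMSEQ_iff)
  qed
  define w where "w x = lim (\<lambda>k. u k x)" for x
  have uF: "u k \<in> borel_measurable F" for k using uS S(1) by (auto dest: Linf_measurable)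
  have wF: "w \<in> borel_measurable F" unfolding w_def using uF by (intro borel_measurable_lim_metric)
  have ub: "AE x in M. \<bar>u k x\<bar> \<le> max b \<bar>c\<bar>" for k using lim_bd by eventually_elim auto
  have uw: "AE x in M. (\<lambda>k. u k x) \<longlonglongrightarrow> w x" using lim_bd by eventually_elim (auto simp: w_def)
  have wS: "w \<in> S" by (rule closed[OF uS ub wF uw])
  have "(\<lambda>k. I (u k)) \<longlonglongrightarrow> I w"
    unfolding I_def by (rule integral_tendsto_bounded[OF _ _ ub uw]) (use SM uS wS in \<open>auto dest: Linf_measurable\<close>)
  moreover have "(\<lambda>k. i + 1 / real (Suc k)) \<longlonglongrightarrow> i + 0"
    using LIMSEQ_inverse_real_of_nat by (intro tendsto_add tendsto_const) (simp add: inverse_eq_divide)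
  ultimately have "I w \<le> i + 0"
    by (rule LIMSEQ_le) (intro exI[of _ 0] allI impI less_imp_le Iu)
  then have Iw: "I w \<le> i" by simp
  have "AE x in M. w x \<le> n x" if n: "n \<in> S" for n
  proof -
    let ?m = "\<lambda>x. min (w x) (n x)"
    have mS: "?m \<in> S" by (rule min[OF wS n])
    have "(LINT x|M. w x - ?m x) \<le> 0"
      using int[OF wS] int[OF mS] Iw i_le[OF mS] by (simp add: I_def)
    moreover have "0 \<le> (LINT x|M. w x - ?m x)" by (intro integral_nonneg_AE) auto
    ultimately have "(LINT x|M. w x - ?m x) = 0" by simp
    then have "AE x in M. w x - ?m x = 0"
      using int[OF wS] int[OF mS] by (subst (asm) integral_nonneg_eq_0_iff_AE) auto
    then show ?thesis by eventually_elim (auto simp: min_def split: if_splits)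
  qed
  with wS show ?thesis by (rule that)
qed

text \<open>Along \<open>s\<close> the probability of a deviation larger than \<open>(1/2)^k\<close>
  is below \<open>(1/2)^k\<close>, and the Borel-Cantelli lemma applies. In the recursion
  \<open>Suc m\<close> makes \<open>s\<close> strictly increasing and \<open>N (Suc k)\<close>
  secures the estimate.\<close>

lemma (in prob_space) tendsto_in_prob_AE_subseq:
  assumes [measurable]: "\<And>k. X k \<in> borel_measurable M" "L \<in> borel_measurable M"
    and lim: "tendsto_in_prob M X L"
  obtains s where "strict_mono s" "AE x in M. (\<lambda>k. X (s k) x) \<longlonglongrightarrow> L x"
proof -
  define P where "P k n \<longleftrightarrow> measure M {x \<in> space M. (1/2)^k < \<bar>X n x - L x\<bar>} < (1/2)^k" for k n
  have "\<exists>N. \<forall>n\<ge>N. P k n" for k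
  proof -
    have "\<forall>\<^sub>F n in sequentially. P k n"
      unfolding P_def using lim by (intro order_tendstoD(2)[where y=0]) (auto simp: tendsto_in_prob_def)
    then show ?thesis by (simp add: eventually_sequentially)
  qed
  then obtain N where N: "\<And>k n. N k \<le> n \<Longrightarrow> P k n" by metis
  define s where "s = rec_nat (N 0) (\<lambda>k m. max (Suc m) (N (Suc k)))"
  have s_Suc: "s (Suc k) = max (Suc (s k)) (N (Suc k))" for k by (simp add: s_def)
  have mono: "strict_mono s" by (intro strict_monoI_Suc) (simp add: s_Suc)
  have "N k \<le> s k" for k by (cases k) (auto simp: s_def)
  then have P: "P k (s k)" for k by (rule N)
  let ?A = "\<lambda>k. {x \<in> space M. (1/2)^k < \<bar>X (s k) x - L x\<bar>}"
  have "summable (\<lambda>k. measure M (?A k))"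
    by (rule summable_comparison_test'[of "\<lambda>k. (1/2)^k" 0])
      (use P in \<open>auto simp: P_def intro: less_imp_le summable_geometric\<close>)
  then have "AE x in M. \<forall>\<^sub>F k in sequentially. x \<in> space M - ?A k"
    by (intro borel_cantelli_AE1) (auto simp: emeasure_eq_measure)
  then have "AE x in M. (\<lambda>k. X (s k) x) \<longlonglongrightarrow> L x"
  proof eventually_elim
    case (elim x)
    then have "\<forall>\<^sub>F k in sequentially. norm (X (s k) x - L x) \<le> (1/2)^k"
      by eventually_elim auto
    moreover have "(\<lambda>k. (1/2::real)^k) \<longlonglongrightarrow> 0" by (intro LIMSEQ_power_zero) simp
    ultimately have "(\<lambda>k. X (s k) x - L x) \<longlonglongrightarrow> 0" by (rule Lim_null_comparison)
    then show ?case by (simp add: LIM_zero_iff)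
  qed
  with mono show ?thesis by (rule that)
qed

section \<open>A Krein--Smulian theorem\<close>

text \<open>The \<open>L\<^sup>1\<close>-distance of \<open>X\<close> from the ball of radius \<open>s\<close> of \<open>L\<^sup>\<infinity>\<close>.\<close>

definition excess :: "'a measure \<Rightarrow> real \<Rightarrow> ('a \<Rightarrow> real) \<Rightarrow> real" where
  "excess M s X = (LINT x|M. max 0 (\<bar>X x\<bar> - s))"

context prob_space
begin

lemma integrable_excess: "X \<in> Linf M M \<Longrightarrow> integrable M (\<lambda>x. max 0 (\<bar>X x\<bar> - s))"
  by (intro Bochner_Integration.integrable_max Bochner_Integration.integrable_diff
      Bochner_Integration.integrable_abs integrable_Linf) auto

lemma excess_convex:
  assumes X: "X \<in> Linf M M" and Y: "Y \<in> Linf M M" and ab: "0 \<le> a" "0 \<le> b" "a + b = 1"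
  shows "excess M s (\<lambda>x. a * X x + b * Y x) \<le> a * excess M s X + b * excess M s Y"
proof -
  have le: "max 0 (\<bar>a * u + b * w\<bar> - s) \<le> a * max 0 (\<bar>u\<bar> - s) + b * max 0 (\<bar>w\<bar> - s)" for u w
  proof -
    have "\<bar>a * u + b * w\<bar> \<le> a * \<bar>u\<bar> + b * \<bar>w\<bar>"
      using ab by (metis abs_mult abs_of_nonneg abs_triangle_ineq)
    moreover have "s = a * s + b * s" using ab by (metis distrib_right mult_1)
    ultimately have "\<bar>a * u + b * w\<bar> - s \<le> a * (\<bar>u\<bar> - s) + b * (\<bar>w\<bar> - s)"
      by (simp add: right_diff_distrib)
    also have "\<dots> \<le> a * max 0 (\<bar>u\<bar> - s) + b * max 0 (\<bar>w\<bar> - s)"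
      using ab by (intro add_mono mult_left_mono) auto
    finally show ?thesis using ab by simp
  qed
  have "excess M s (\<lambda>x. a * X x + b * Y x)
      \<le> (LINT x|M. a * max 0 (\<bar>X x\<bar> - s) + b * max 0 (\<bar>Y x\<bar> - s))"
    unfolding excess_def using X Y
    by (intro integral_mono le integrable_excess Bochner_Integration.integrable_add
        integrable_mult_right) auto
  also have "\<dots> = a * excess M s X + b * excess M s Y"
    using X Y by (simp add: excess_def integrable_excess)
  finally show ?thesis .
qed

lemma excess_tendsto:
  assumes "\<And>k. X k \<in> borel_measurable M" "L \<in> borel_measurable M"
    and "\<And>k. AE x in M. \<bar>X k x\<bar> \<le> c" "AE x in M. (\<lambda>k. X k x) \<longlonglongrightarrow> L x"
  shows "(\<lambda>k. excess M s (X k)) \<longlonglongrightarrow> excess M s L"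
  unfolding excess_def
proof (rule integral_tendsto_bounded)
  show "AE x in M. \<bar>max 0 (\<bar>X k x\<bar> - s)\<bar> \<le> max 0 (c - s)" for k
    using assms(3)[of k] by eventually_elim auto
  show "AE x in M. (\<lambda>k. max 0 (\<bar>X k x\<bar> - s)) \<longlonglongrightarrow> max 0 (\<bar>L x\<bar> - s)"
    using assms(4) by eventually_elim (auto intro!: tendsto_intros)
qed (use assms in auto)

lemma excess_nonneg: "0 \<le> excess M s X"
  unfolding excess_def by (intro integral_nonneg_AE) auto

lemma excess_eq_0_iff: "X \<in> Linf M M \<Longrightarrow> excess M s X = 0 \<longleftrightarrow> (AE x in M. \<bar>X x\<bar> \<le> s)"
  unfolding excess_def
  by (subst integral_nonneg_eq_0_iff_AE[OF integrable_excess]) (auto simp: max_def elim!: eventually_mono)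

text \<open>The inductive step of the Krein--Smulian argument. Weak compactness is replaced by norm minimisation
  in \<open>L\<^sup>2\<close> over a decreasing sequence of bounded convex sets.\<close>

lemma excess_bounded_away:
  fixes D :: "('a \<Rightarrow> real) set"
  assumes Linf: "D \<subseteq> Linf M M"
    and mid: "\<And>X Y. X \<in> D \<Longrightarrow> Y \<in> D \<Longrightarrow> (\<lambda>x. (X x + Y x) / 2) \<in> D"
    and closed: "\<And>X L c. \<lbrakk>\<And>k::nat. X k \<in> D; \<And>k. AE x in M. \<bar>X k x\<bar> \<le> c; L \<in> borel_measurable M;
        AE x in M. (\<lambda>k. X k x) \<longlonglongrightarrow> L x\<rbrakk> \<Longrightarrow> L \<in> D"
    and disj: "\<And>X. X \<in> D \<Longrightarrow> \<not> (AE x in M. \<bar>X x\<bar> \<le> s)"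
  shows "\<exists>e>0. \<forall>X\<in>D. (AE x in M. \<bar>X x\<bar> \<le> t) \<longrightarrow> e < excess M s X"
proof (rule ccontr)
  assume "\<not> ?thesis"
  then have *: "\<exists>X\<in>D. (AE x in M. \<bar>X x\<bar> \<le> t) \<and> excess M s X \<le> e" if "0 < e" for e
    using that by (meson linorder_not_less)
  \<comment> \<open>\<open>S k\<close> collects the elements of \<open>D\<close> in the larger ball
    that refute \<open>e = 1 / real (Suc k)\<close>. An almost sure limit of such elements stays in
    \<open>D\<close> and has excess 0, so it lies in the ball of radius \<open>s\<close>, which
    \<open>D\<close> avoids.\<close>
  define S where "S k = {X \<in> D. (AE x in M. \<bar>X x\<bar> \<le> t) \<and> excess M s X \<le> 1 / real (Suc k)}" for k
  obtain X L where X: "\<And>k. X k \<in> S k" and L: "L \<in> borel_measurable M"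
    "AE x in M. (\<lambda>k. X k x) \<longlonglongrightarrow> L x"
  proof (rule bounded_convex_seq_AE_limit[of S])
    fix k
    have "1 / real (Suc (Suc k)) \<le> 1 / real (Suc k)" by (intro divide_left_mono) auto
    then show "S (Suc k) \<subseteq> S k" unfolding S_def by auto
    show "S k \<noteq> {}" using *[of "1 / real (Suc k)"] by (auto simp: S_def)
    show "X \<in> borel_measurable M" "AE x in M. \<bar>X x\<bar> \<le> t" if "X \<in> S k" for X
      using that Linf by (auto simp: S_def Linf_measurable)
    show "(\<lambda>x. (X x + Y x) / 2) \<in> S k" if "X \<in> S k" "Y \<in> S k" for X Y
    proof -
      have t: "AE x in M. \<bar>X x\<bar> \<le> t" "AE x in M. \<bar>Y x\<bar> \<le> t" using that by (auto simp: S_def)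
      then have "AE x in M. \<bar>(X x + Y x) / 2\<bar> \<le> t" by eventually_elim simp
      moreover have "excess M s (\<lambda>x. 1/2 * X x + 1/2 * Y x) \<le> 1/2 * excess M s X + 1/2 * excess M s Y"
        using that Linf by (intro excess_convex) (auto simp: S_def)
      moreover have "excess M s X \<le> 1 / real (Suc k)" "excess M s Y \<le> 1 / real (Suc k)"
        using that by (auto simp: S_def)
      ultimately show ?thesis
        using that mid by (simp add: S_def add_divide_distrib)
    qed
  qed blast
  have XD: "X k \<in> D" "AE x in M. \<bar>X k x\<bar> \<le> t" "excess M s (X k) \<le> 1 / real (Suc k)" for k
    using X[of k] by (auto simp: S_def)
  have LD: "L \<in> D" by (rule closed[OF XD(1,2) L])
  have "(\<lambda>k. excess M s (X k)) \<longlonglongrightarrow> excess M s L"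
    using XD(1) Linf by (intro excess_tendsto[OF _ L(1) XD(2) L(2)]) (auto intro: Linf_measurable)
  moreover have "(\<lambda>k. 1 / real (Suc k)) \<longlonglongrightarrow> 0"
    using LIMSEQ_inverse_real_of_nat by (simp add: inverse_eq_divide)
  ultimately have "excess M s L \<le> 0"
    using XD(3) by (auto intro: LIMSEQ_le)
  then have "excess M s L = 0" using excess_nonneg[of s L] by simp
  with excess_eq_0_iff[of L s] LD Linf have "AE x in M. \<bar>L x\<bar> \<le> s" by blast
  with disj[OF LD] show False by simp
qed

text \<open>Starting from \<open>E\<close>, elements of excess larger than \<open>e n\<close> over
  the radius \<open>rr n\<close> are discarded at stage n, with \<open>e n\<close> so small that
  what remains avoids the ball of radius \<open>rr (Suc n)\<close>. An element surviving every stage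
  would avoid all balls, although it is bounded.\<close>

lemma Krein_Smulian_excess:
  fixes E :: "('a \<Rightarrow> real) set"
  assumes Linf: "E \<subseteq> Linf M M"
    and mid: "\<And>X Y. X \<in> E \<Longrightarrow> Y \<in> E \<Longrightarrow> (\<lambda>x. (X x + Y x) / 2) \<in> E"
    and closed: "\<And>X L c. \<lbrakk>\<And>k::nat. X k \<in> E; \<And>k. AE x in M. \<bar>X k x\<bar> \<le> c; L \<in> borel_measurable M;
        AE x in M. (\<lambda>k. X k x) \<longlonglongrightarrow> L x\<rbrakk> \<Longrightarrow> L \<in> E"
    and r: "0 < r" and disj: "\<And>X. X \<in> E \<Longrightarrow> \<not> (AE x in M. \<bar>X x\<bar> \<le> r)"
  obtains e where "\<And>n. 0 < e n" "\<And>X. X \<in> E \<Longrightarrow> \<exists>n. e n < excess M (r * real (Suc n)) X"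
proof -
  define rr where "rr n = r * real (Suc n)" for n
  \<comment> \<open>The invariant of the construction. The clause for \<open>n = 0\<close> records
    the initial set, which dependent choice would otherwise leave open.\<close>
  define P where "P n D \<longleftrightarrow> D \<subseteq> E \<and> (n = 0 \<longrightarrow> D = E) \<and>
      (\<forall>X\<in>D. \<forall>Y\<in>D. (\<lambda>x. (X x + Y x) / 2) \<in> D) \<and>
      (\<forall>X L c. (\<forall>k. X k \<in> D) \<longrightarrow> (\<forall>k. AE x in M. \<bar>X k x\<bar> \<le> c) \<longrightarrow> L \<in> borel_measurable M \<longrightarrow>
        (AE x in M. (\<lambda>k. X k x) \<longlonglongrightarrow> L x) \<longrightarrow> L \<in> D) \<and>
      (\<forall>X\<in>D. \<not> (AE x in M. \<bar>X x\<bar> \<le> rr n))" for n :: nat and D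
  define Q where "Q n D D' \<longleftrightarrow> (\<exists>e>0. D' = {X \<in> D. excess M (rr n) X \<le> e})" for n :: nat and D D'
  have P_mono: "P n D \<Longrightarrow> D \<subseteq> E"
    and P_mid: "P n D \<Longrightarrow> X \<in> D \<Longrightarrow> Y \<in> D \<Longrightarrow> (\<lambda>x. (X x + Y x) / 2) \<in> D"
    and P_closed: "P n D \<Longrightarrow> (\<And>k. Z k \<in> D) \<Longrightarrow> (\<And>k. AE x in M. \<bar>Z k x\<bar> \<le> c) \<Longrightarrow>
       L \<in> borel_measurable M \<Longrightarrow> AE x in M. (\<lambda>k. Z k x) \<longlonglongrightarrow> L x \<Longrightarrow> L \<in> D"
    and P_disj: "P n D \<Longrightarrow> X \<in> D \<Longrightarrow> \<not> (AE x in M. \<bar>X x\<bar> \<le> rr n)"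
    for n D X Y Z L c
    unfolding P_def by blast+
  have "P 0 E"
    unfolding P_def
  proof (intro conjI ballI allI impI)
    fix X L c
    assume "\<forall>k. X k \<in> E" "\<forall>k. AE x in M. \<bar>X k x\<bar> \<le> c" "L \<in> borel_measurable M"
      "AE x in M. (\<lambda>k. X k x) \<longlonglongrightarrow> L x"
    then show "L \<in> E" by - (rule closed[of X c L], auto)
  qed (use mid disj in \<open>auto simp: rr_def\<close>)
  have "\<exists>D'. P (Suc n) D' \<and> Q n D D'" if PD: "P n D" for n D
  proof -
    have DL: "D \<subseteq> Linf M M" using P_mono[OF PD] Linf by blast
    obtain e where e: "e > 0"
      "\<And>X. X \<in> D \<Longrightarrow> AE x in M. \<bar>X x\<bar> \<le> rr (Suc n) \<Longrightarrow> e < excess M (rr n) X"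
    proof -
      have "\<exists>e>0. \<forall>X\<in>D. (AE x in M. \<bar>X x\<bar> \<le> rr (Suc n)) \<longrightarrow> e < excess M (rr n) X"
      proof (rule excess_bounded_away[OF DL])
        show "L \<in> D" if "\<And>k::nat. X k \<in> D" "\<And>k. AE x in M. \<bar>X k x\<bar> \<le> c"
          "L \<in> borel_measurable M" "AE x in M. (\<lambda>k. X k x) \<longlonglongrightarrow> L x" for X L c
          by (rule P_closed[OF PD that])
      qed (fact P_mid[OF PD] P_disj[OF PD])+
      with that show thesis by blast
    qed
    define D' where "D' = {X \<in> D. excess M (rr n) X \<le> e}"
    have "P (Suc n) D'"
      unfolding P_def
    proof (intro conjI ballI allI impI)
      show "D' \<subseteq> E" using P_mono[OF PD] by (auto simp: D'_def)
    next
      fix X Y assume XY: "X \<in> D'" "Y \<in> D'"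
      have "excess M (rr n) (\<lambda>x. 1/2 * X x + 1/2 * Y x)
          \<le> 1/2 * excess M (rr n) X + 1/2 * excess M (rr n) Y"
        using XY DL by (intro excess_convex) (auto simp: D'_def)
      then show "(\<lambda>x. (X x + Y x) / 2) \<in> D'"
        using XY P_mid[OF PD] by (simp add: D'_def add_divide_distrib)
    next
      fix X L c assume X: "\<forall>k. X k \<in> D'" and b: "\<forall>k. AE x in M. \<bar>X k x\<bar> \<le> c"
        and L: "L \<in> borel_measurable M" "AE x in M. (\<lambda>k. X k x) \<longlonglongrightarrow> L x"
      have "L \<in> D" by (rule P_closed[OF PD, of X c]) (use X b L in \<open>auto simp: D'_def\<close>)
      moreover have "(\<lambda>k. excess M (rr n) (X k)) \<longlonglongrightarrow> excess M (rr n) L"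
        using X b L DL by (intro excess_tendsto[of X L c]) (auto simp: D'_def intro: Linf_measurable)
      then have "excess M (rr n) L \<le> e"
        by (rule LIMSEQ_le_const2) (use X in \<open>auto simp: D'_def\<close>)
      ultimately show "L \<in> D'" by (simp add: D'_def)
    next
      fix X assume "X \<in> D'"
      then show "\<not> (AE x in M. \<bar>X x\<bar> \<le> rr (Suc n))" using e(2)[of X] by (auto simp: D'_def)
    qed simp
    moreover have "Q n D D'" using e(1) by (auto simp: Q_def D'_def)
    ultimately show ?thesis by blast
  qed
  with \<open>P 0 E\<close> obtain f where f: "\<And>n. P n (f n)" "\<And>n. Q n (f n) (f (Suc n))"
    using dependent_nat_choice[of P Q] by blast
  from f(2) obtain e where e: "\<And>n. 0 < e n" "\<And>n. f (Suc n) = {X \<in> f n. excess M (rr n) X \<le> e n}"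
    unfolding Q_def by metis
  have f0: "f 0 = E" using f(1)[of 0] by (simp add: P_def)
  have "\<exists>n. e n < excess M (r * real (Suc n)) X" if X: "X \<in> E" for X
  proof (rule ccontr)
    assume "\<not> ?thesis"
    then have "excess M (rr n) X \<le> e n" for n by (auto simp: rr_def not_less)
    then have Xf: "X \<in> f n" for n
      by (induction n) (use X f0 e(2) in auto)
    obtain c where c: "AE x in M. \<bar>X x\<bar> \<le> c" using X Linf by (auto simp: Linf_def)
    obtain n where "c / r < real n" using reals_Archimedean2 by blast
    then have "c \<le> rr n" using r by (simp add: rr_def field_simps add_increasing2)
    with c have "AE x in M. \<bar>X x\<bar> \<le> rr n" by (auto elim!: eventually_mono)
    with P_disj[OF f(1) Xf] show False by blast
  qed
  with e(1) show ?thesis by (rule that)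
qed

end

section \<open>Test probabilities of a coherent risk measure\<close>

lemma (in prob_space) integral_RN_density:
  assumes "prob_space Q" "absolutely_continuous M Q" "sets Q = sets M" "X \<in> borel_measurable M"
  shows "(LINT x|M. RN_density M Q x * X x) = (LINT x|Q. X x)"
proof -
  interpret Q: prob_space Q by fact
  show ?thesis
    unfolding RN_density_def using assms
    by (intro RN_deriv_integral[symmetric] Q.sigma_finite_measure_axioms)
qed

locale coherent_risk = prob_space M for M :: "'a measure" +
  fixes \<rho> :: "('a \<Rightarrow> real) \<Rightarrow> real"
  assumes rho: "relevant_coherent_Fatou M \<rho>"
begin

abbreviation "A \<equiv> acceptance_set M \<rho>"

lemma rho_mono: "X \<in> Linf M M \<Longrightarrow> Y \<in> Linf M M \<Longrightarrow> AE x in M. X x \<le> Y x \<Longrightarrow> \<rho> X \<le> \<rho> Y"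
  and rho_add: "X \<in> Linf M M \<Longrightarrow> Y \<in> Linf M M \<Longrightarrow> \<rho> (\<lambda>x. X x + Y x) \<le> \<rho> X + \<rho> Y"
  and rho_cash: "X \<in> Linf M M \<Longrightarrow> \<rho> (\<lambda>x. X x + c) = \<rho> X + c"
  and rho_scale: "X \<in> Linf M M \<Longrightarrow> 0 \<le> a \<Longrightarrow> \<rho> (\<lambda>x. a * X x) = a * \<rho> X"
  and rho_Fatou: "X \<in> Linf M M \<Longrightarrow> (\<And>n. Xn n \<in> Linf M M) \<Longrightarrow> (\<And>n. AE x in M. \<bar>Xn n x\<bar> \<le> 1) \<Longrightarrow>
    tendsto_in_prob M Xn X \<Longrightarrow> ereal (\<rho> X) \<le> liminf (\<lambda>n. ereal (\<rho> (Xn n)))"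
  and rho_relevant: "F \<in> sets M \<Longrightarrow> 0 < measure M F \<Longrightarrow> 0 < \<rho> (indicat_real F)"
  using rho by (auto simp: relevant_coherent_Fatou_def)

lemma rho_0: "\<rho> (\<lambda>x. 0) = 0"
  using rho_scale[of "\<lambda>x. 0" 0] by simp

lemma A_Linf: "X \<in> A \<Longrightarrow> X \<in> Linf M M"
  by (simp add: acceptance_set_def)

lemma A_add: "X \<in> A \<Longrightarrow> Y \<in> A \<Longrightarrow> (\<lambda>x. X x + Y x) \<in> A"
  using rho_add[of X Y] by (auto simp: acceptance_set_def)

lemma A_scale: "X \<in> A \<Longrightarrow> 0 \<le> a \<Longrightarrow> (\<lambda>x. a * X x) \<in> A"
  using rho_scale[of X a] by (auto simp: acceptance_set_def mult_nonneg_nonpos)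

lemma A_nonpos: "X \<in> Linf M M \<Longrightarrow> AE x in M. X x \<le> 0 \<Longrightarrow> X \<in> A"
  using rho_mono[of X "\<lambda>x. 0"] rho_0 by (simp add: acceptance_set_def)

text \<open>The Fatou property speaks of sequences bounded by 1; dividing by \<open>d\<close>,
  positive and at least \<open>c\<close>, reduces to this case.\<close>

lemma A_closed:
  assumes X: "\<And>k. X k \<in> A" and b: "\<And>k. AE x in M. \<bar>X k x\<bar> \<le> c"
    and L: "L \<in> borel_measurable M" "AE x in M. (\<lambda>k. X k x) \<longlonglongrightarrow> L x"
  shows "L \<in> A"
proof -
  define d where "d = max c 1"
  have d: "0 < d" "c \<le> d" by (auto simp: d_def)
  have LL: "L \<in> Linf M M" using AE_abs_limit_le[OF b L(2)] L(1) by (rule LinfI[rotated])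
  have "ereal (\<rho> (\<lambda>x. 1/d * L x)) \<le> liminf (\<lambda>k. ereal (\<rho> (\<lambda>x. 1/d * X k x)))"
  proof (rule rho_Fatou)
    show "AE x in M. \<bar>1/d * X k x\<bar> \<le> 1" for k
      using b[of k] by eventually_elim (use d in \<open>auto simp: abs_mult field_simps\<close>)
    show "tendsto_in_prob M (\<lambda>k x. 1/d * X k x) (\<lambda>x. 1/d * L x)"
    proof (rule AE_tendsto_imp_in_prob)
      show "AE x in M. (\<lambda>k. 1/d * X k x) \<longlonglongrightarrow> 1/d * L x"
        using L(2) by eventually_elim (intro tendsto_intros)
      show "(\<lambda>x. 1/d * X k x) \<in> borel_measurable M" for k
        using Linf_measurable[OF Linf_cmult[OF A_Linf[OF X]]] .
    qed (use L(1) in simp)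
  qed (use LL A_Linf[OF X] in auto)
  also have "\<dots> \<le> 0"
    using A_scale[OF X, of "1/d"] d
    by (intro Liminf_le) (auto simp: acceptance_set_def zero_ereal_def)
  finally have "1/d * \<rho> L \<le> 0" using rho_scale[OF LL, of "1/d"] d by (simp add: zero_ereal_def)
  with d LL show ?thesis by (simp add: acceptance_set_def divide_le_0_iff)
qed

lemma acceptance_separating_functional:
  assumes B: "B \<in> Linf M M" "0 < \<rho> B"
  obtains f where "linear_functional_on (Linf M M) f" "\<And>X. X \<in> A \<Longrightarrow> f X \<le> 0" "1 \<le> f B"
    "\<And>X c. \<lbrakk>\<And>k::nat. X k \<in> Linf M M; \<And>k. AE x in M. \<bar>X k x\<bar> \<le> c;
        AE x in M. (\<lambda>k. X k x) \<longlonglongrightarrow> 0\<rbrakk> \<Longrightarrow> (\<lambda>k. f (X k)) \<longlonglongrightarrow> 0"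
proof -
  \<comment> \<open>Translating by \<open>B\<close> moves the point to be separated to the origin,
    where the balls are centred.\<close>
  define E where "E = {Z. (\<lambda>x. Z x + B x) \<in> A}"
  \<comment> \<open>If |Z| \<le> r for some Z in \<open>E\<close>, then B \<le> (Z + B) + r with Z +
    B acceptable, hence \<open>\<rho> B \<le> r\<close>. Half of \<open>\<rho> B\<close> excludes
    this.\<close>
  define r where "r = \<rho> B / 2"
  have r: "0 < r" using B by (simp add: r_def)
  have E_Linf: "E \<subseteq> Linf M M"
  proof
    fix Z assume "Z \<in> E"
    then have "(\<lambda>x. (Z x + B x) - B x) \<in> Linf M M"
      using B(1) A_Linf by (intro Linf_diff) (auto simp: E_def)
    then show "Z \<in> Linf M M" by simp
  qed
  obtain cB where cB: "AE x in M. \<bar>B x\<bar> \<le> cB" using B by (auto simp: Linf_def)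
  obtain e where e: "\<And>n. 0 < e n" "\<And>Z. Z \<in> E \<Longrightarrow> \<exists>n. e n < excess M (r * real (Suc n)) Z"
  proof (rule Krein_Smulian_excess[OF E_Linf _ _ r])
    fix X Y assume "X \<in> E" "Y \<in> E"
    then have "(\<lambda>x. 1/2 * ((X x + B x) + (Y x + B x))) \<in> A"
      using A_add[of "\<lambda>x. X x + B x" "\<lambda>x. Y x + B x"] by (intro A_scale) (simp_all add: E_def)
    moreover have "(\<lambda>x. 1/2 * ((X x + B x) + (Y x + B x))) = (\<lambda>x. (X x + Y x) / 2 + B x)"
      by (simp add: fun_eq_iff field_simps)
    ultimately show "(\<lambda>x. (X x + Y x) / 2) \<in> E" by (simp add: E_def)
  next
    fix X L c assume X: "\<And>k::nat. X k \<in> E" and b: "\<And>k. AE x in M. \<bar>X k x\<bar> \<le> c"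
      and L: "L \<in> borel_measurable M" "AE x in M. (\<lambda>k. X k x) \<longlonglongrightarrow> L x"
    have "(\<lambda>x. L x + B x) \<in> A"
    proof (rule A_closed)
      show "(\<lambda>x. X k x + B x) \<in> A" for k using X by (simp add: E_def)
      show "AE x in M. \<bar>X k x + B x\<bar> \<le> c + cB" for k
        using b[of k] cB by eventually_elim auto
      show "(\<lambda>x. L x + B x) \<in> borel_measurable M"
        using L(1) Linf_measurable[OF B(1)] by (rule borel_measurable_add)
      show "AE x in M. (\<lambda>k. X k x + B x) \<longlonglongrightarrow> L x + B x"
        using L(2) by eventually_elim (intro tendsto_intros)
    qed
    then show "L \<in> E" by (simp add: E_def)
  next
    fix Z assume Z: "Z \<in> E"
    show "\<not> (AE x in M. \<bar>Z x\<bar> \<le> r)"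
    proof
      assume "AE x in M. \<bar>Z x\<bar> \<le> r"
      then have "AE x in M. B x \<le> (Z x + B x) + r" by eventually_elim auto
      moreover have ZB: "(\<lambda>x. Z x + B x) \<in> A" using Z by (simp add: E_def)
      ultimately have "\<rho> B \<le> \<rho> (\<lambda>x. (Z x + B x) + r)"
        using B(1) A_Linf[OF ZB] by (intro rho_mono) auto
      also have "\<dots> = \<rho> (\<lambda>x. Z x + B x) + r" using A_Linf[OF ZB] by (rule rho_cash)
      also have "\<dots> \<le> r" using ZB by (simp add: acceptance_set_def)
      finally show False using r by (simp add: r_def)
    qed
  qed blast
  define W where "W = {Z \<in> Linf M M. \<forall>n. excess M (r * real (Suc n)) Z \<le> e n}"
  have exc0: "excess M s (\<lambda>x. 0) = 0" if "0 \<le> s" for s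
    using that by (simp add: excess_def)
  have excU: "excess M s (\<lambda>x. - Z x) = excess M s Z" for s Z
    by (simp add: excess_def)
  have W_Linf: "Z \<in> W \<Longrightarrow> Z \<in> Linf M M" for Z by (simp add: W_def)
  have W_convex: "(\<lambda>x. a * Y x + b * Z x) \<in> W"
    if "Y \<in> W" "Z \<in> W" "0 \<le> a" "0 \<le> b" "a + b = 1" for Y Z a b
  proof -
    have "excess M (r * real (Suc n)) (\<lambda>x. a * Y x + b * Z x) \<le> e n" for n
    proof -
      have "excess M (r * real (Suc n)) (\<lambda>x. a * Y x + b * Z x)
          \<le> a * excess M (r * real (Suc n)) Y + b * excess M (r * real (Suc n)) Z"
        using that by (intro excess_convex) (auto simp: W_def)
      also have "\<dots> \<le> a * e n + b * e n"
        using that by (intro add_mono mult_left_mono) (auto simp: W_def)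
      also have "\<dots> = e n" using that by (metis distrib_right mult_1)
      finally show ?thesis .
    qed
    with that show ?thesis by (auto simp: W_def)
  qed
  \<comment> \<open>\<open>r\<close> is the smallest of the radii, so the ball of radius
    \<open>r\<close> lies in \<open>W\<close>. This makes \<open>W\<close> absorbing and its gauge
    finite.\<close>
  have W_small: "Z \<in> W" if "Z \<in> Linf M M" "AE x in M. \<bar>Z x\<bar> \<le> r" for Z
  proof -
    have "excess M (r * real (Suc n)) Z = 0" for n
    proof -
      have "AE x in M. \<bar>Z x\<bar> \<le> r * real (Suc n)"
        using that(2)
      proof eventually_elim
        case (elim x)
        moreover have "r \<le> r * real (Suc n)" using r by (simp add: mult_le_cancel_left1)
        ultimately show ?case by simp
      qed
      then show ?thesis using excess_eq_0_iff[OF that(1)] by simp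
    qed
    with that(1) e(1) show ?thesis by (auto simp: W_def less_imp_le)
  qed
  have W_0: "(\<lambda>x. 0) \<in> W" using r by (intro W_small) auto
  have A_0: "(\<lambda>x. 0) \<in> A" by (rule A_nonpos) auto
  \<comment> \<open>\<open>p\<close> is the gauge of \<open>A + W\<close>. A linear functional below \<open>p\<close> is nonpositive on the cone \<open>A\<close> and at most
    \<open>1\<close> on \<open>W\<close>, which absorbs every bounded sequence tending to \<open>0\<close>; this gives the continuity.\<close>
  define T where "T X = {t. 0 < t \<and> (\<exists>Y\<in>A. (\<lambda>x. (X x - Y x) / t) \<in> W)}" for X
  have T_I: "t \<in> T X" if "0 < t" "Y \<in> A" "(\<lambda>x. (X x - Y x) / t) \<in> W" for t X Y
    using that by (auto simp only: T_def)
  define p where "p X = Inf (T X)" for X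
  have T_pos: "t \<in> T X \<Longrightarrow> 0 < t" for t X by (simp add: T_def)
  have T_bdd: "bdd_below (T X)" for X by (intro bdd_belowI[of _ 0]) (auto dest: T_pos)
  have p_le: "t \<in> T X \<Longrightarrow> p X \<le> t" for t X
    unfolding p_def using T_bdd by (intro cInf_lower) auto
  have T_ne: "T X \<noteq> {}" if X: "X \<in> Linf M M" for X
  proof -
    obtain c where c: "0 < c" "AE x in M. \<bar>X x\<bar> \<le> c" using X by (rule Linf_bound)
    have "(\<lambda>x. (X x - 0) / (c/r)) \<in> W"
    proof (rule W_small)
      show "AE x in M. \<bar>(X x - 0) / (c / r)\<bar> \<le> r"
        using c(2) by eventually_elim (use c(1) r in \<open>simp add: abs_mult field_simps\<close>)
    qed (use X in \<open>auto intro!: Linf_cdiv\<close>)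
    from T_I[OF _ A_0 this] c(1) r have "c/r \<in> T X" by simp
    then show ?thesis by auto
  qed
  have p_ge: "c \<le> p X" if "X \<in> Linf M M" "\<And>t. t \<in> T X \<Longrightarrow> c \<le> t" for c X
    unfolding p_def using that T_ne by (intro cInf_greatest) auto
  have T_add: "s + t \<in> T (\<lambda>x. X x + Z x)" if st: "s \<in> T X" "t \<in> T Z" for X Z s t
  proof -
    obtain Y Y' where Y: "Y \<in> A" "(\<lambda>x. (X x - Y x) / s) \<in> W"
      and Y': "Y' \<in> A" "(\<lambda>x. (Z x - Y' x) / t) \<in> W" and pos: "0 < s" "0 < t"
      using st by (auto simp: T_def)
    have "(\<lambda>x. s/(s+t) * ((X x - Y x) / s) + t/(s+t) * ((Z x - Y' x) / t)) \<in> W"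
      using pos by (intro W_convex Y Y') (auto simp flip: add_divide_distrib)
    moreover have eq: "s/(s+t) * (a / s) = a / (s+t)" "t/(s+t) * (a / t) = a / (s+t)" for a
      using pos by simp_all
    have "s/(s+t) * ((X x - Y x) / s) + t/(s+t) * ((Z x - Y' x) / t)
        = (X x + Z x - (Y x + Y' x)) / (s + t)" for x
      by (simp only: eq) (simp add: add_divide_distrib diff_divide_distrib)
    ultimately have "(\<lambda>x. (X x + Z x - (Y x + Y' x)) / (s + t)) \<in> W" by simp
    with A_add[OF Y(1) Y'(1)] pos show ?thesis by (intro T_I) simp_all
  qed
  have T_scale: "a * t \<in> T (\<lambda>x. a * X x)" if tX: "t \<in> T X" and a: "0 < a" for a t X
  proof -
    obtain Y where Y: "Y \<in> A" "(\<lambda>x. (X x - Y x) / t) \<in> W" and pos: "0 < t"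
      using tX by (auto simp: T_def)
    have "(a * X x - a * Y x) / (a * t) = (X x - Y x) / t" for x
      using a pos by (simp add: field_simps)
    with Y(2) have "(\<lambda>x. (a * X x - a * Y x) / (a * t)) \<in> W" by simp
    with A_scale[OF Y(1), of a] a pos show ?thesis by (intro T_I) simp_all
  qed
  have T_A: "t \<in> T Y" if "Y \<in> A" "0 < t" for t Y
    using that W_0 by (intro T_I[of t Y Y]) simp_all
  have p_A: "p Y \<le> 0" if "Y \<in> A" for Y
    by (rule field_le_epsilon) (use p_le[OF T_A[OF that]] in auto)
  have p_nonneg: "0 \<le> p X" if "X \<in> Linf M M" for X
    using that T_pos by (intro p_ge) (auto intro: less_imp_le)
  have sub: "sublinear_on (Linf M M) p"
  proof (rule sublinear_onI[OF function_space_Linf])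
    fix X Z assume X: "X \<in> Linf M M" and Z: "Z \<in> Linf M M"
    have "p (\<lambda>x. X x + Z x) - s \<le> p Z" if s: "s \<in> T X" for s
    proof (rule p_ge[OF Z])
      fix t assume "t \<in> T Z"
      from p_le[OF T_add[OF s this]] show "p (\<lambda>x. X x + Z x) - s \<le> t" by simp
    qed
    then have "p (\<lambda>x. X x + Z x) - p Z \<le> p X"
      by (intro p_ge X) (auto simp: algebra_simps)
    then show "p (\<lambda>x. X x + Z x) \<le> p X + p Z" by simp
  next
    fix X a assume X: "X \<in> Linf M M" and a: "(0::real) < a"
    have "p (\<lambda>x. a * X x) / a \<le> p X"
    proof (rule p_ge[OF X])
      fix t assume "t \<in> T X"
      from p_le[OF T_scale[OF this a]] show "p (\<lambda>x. a * X x) / a \<le> t" using a by (simp add: field_simps)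
    qed
    then show "p (\<lambda>x. a * X x) \<le> a * p X" using a by (simp add: field_simps)
  next
    show "p (\<lambda>x. 0) = 0" using p_A[OF A_0] p_nonneg[of "\<lambda>x. 0"] by simp
  qed
  \<comment> \<open>For t < 1, convexity of \<open>W\<close> and 0 in \<open>W\<close> turn (B -
    Y)/t in \<open>W\<close> into B - Y in \<open>W\<close>. By symmetry of the excess this
    contradicts the choice of \<open>e\<close>, because Y - B lies in \<open>E\<close>.\<close>
  have pB: "1 \<le> p B"
  proof (rule p_ge[OF B(1)], rule ccontr)
    fix t assume t: "t \<in> T B" "\<not> 1 \<le> t"
    obtain Y where Y: "Y \<in> A" "(\<lambda>x. (B x - Y x) / t) \<in> W" and pos: "0 < t"
      using t by (auto simp: T_def)
    have "(\<lambda>x. t * ((B x - Y x) / t) + (1 - t) * 0) \<in> W"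
      using t pos by (intro W_convex Y W_0) auto
    then have BY: "(\<lambda>x. B x - Y x) \<in> W" using pos by simp
    have "(\<lambda>x. Y x - B x) \<in> E" using Y by (simp add: E_def)
    from e(2)[OF this] obtain n where "e n < excess M (r * real (Suc n)) (\<lambda>x. Y x - B x)" by auto
    moreover have "excess M (r * real (Suc n)) (\<lambda>x. B x - Y x) \<le> e n"
      using BY unfolding W_def by blast
    ultimately show False using excU[of "r * real (Suc n)" "\<lambda>x. B x - Y x"] by simp
  qed
  obtain f where f: "linear_functional_on (Linf M M) f" "\<And>X. X \<in> Linf M M \<Longrightarrow> f X \<le> p X" "f B = p B"
    using Hahn_Banach_at[OF function_space_Linf sub B(1)] by blast
  have f_W: "f X \<le> t" if "(\<lambda>x. X x / t) \<in> W" "0 < t" "X \<in> Linf M M" for X t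
  proof -
    have "t \<in> T X" using that A_0 by (intro T_I[of t "\<lambda>x. 0"]) simp_all
    from p_le[OF this] f(2)[OF that(3)] show ?thesis by simp
  qed
  have f_lim: "(\<lambda>k. f (X k)) \<longlonglongrightarrow> 0" if X: "\<And>k::nat. X k \<in> Linf M M" and b: "\<And>k. AE x in M. \<bar>X k x\<bar> \<le> c"
    and lim: "AE x in M. (\<lambda>k. X k x) \<longlonglongrightarrow> 0" for X c
  proof (rule LIMSEQ_I)
    have ev: "\<forall>\<^sub>F k in sequentially. (\<lambda>x. X k x / d) \<in> W" if d: "0 < d" for d
    proof -
      \<comment> \<open>From index \<open>N\<close> on the radii exceed \<open>c / d\<close>, so
        those constraints hold trivially for the scaled sequence; only finitely many remain, and
        each holds eventually.\<close>
      obtain N where N: "c / d / r < real N" using reals_Archimedean2 by blast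
      have b': "AE x in M. \<bar>X k x / d\<bar> \<le> c / d" for k
        using b[of k] by eventually_elim (use d in \<open>auto simp: field_simps\<close>)
      have Xd: "(\<lambda>x. X k x / d) \<in> Linf M M" for k using X by auto
      have "\<forall>\<^sub>F k in sequentially. \<forall>n\<in>{..<N}. excess M (r * real (Suc n)) (\<lambda>x. X k x / d) < e n"
      proof (intro eventually_ball_finite ballI)
        fix n
        have "(\<lambda>k. excess M (r * real (Suc n)) (\<lambda>x. X k x / d)) \<longlonglongrightarrow> excess M (r * real (Suc n)) (\<lambda>x. 0)"
        proof (rule excess_tendsto[OF _ _ b'])
          show "AE x in M. (\<lambda>k. X k x / d) \<longlonglongrightarrow> 0"
            using lim by eventually_elim (auto intro: tendsto_divide_zero)
        qed (use Xd in \<open>auto dest: Linf_measurable\<close>)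
        also have "excess M (r * real (Suc n)) (\<lambda>x. 0) = 0" using r by (intro exc0) simp
        finally show "\<forall>\<^sub>F k in sequentially. excess M (r * real (Suc n)) (\<lambda>x. X k x / d) < e n"
          using e(1)[of n] by (rule order_tendstoD)
      qed simp
      then show ?thesis
      proof eventually_elim
        case (elim k)
        have "excess M (r * real (Suc n)) (\<lambda>x. X k x / d) \<le> e n" for n
        proof (cases "n < N")
          case False
          then have "c / d / r < real (Suc n)" using N by simp
          then have "c / d / r * r \<le> real (Suc n) * r" using r by (intro mult_right_mono) auto
          then have cd: "c / d \<le> r * real (Suc n)" using r by (simp add: mult.commute)
          have "AE x in M. \<bar>X k x / d\<bar> \<le> r * real (Suc n)"
            using b'[of k] by eventually_elim (use cd in simp)
          then have "excess M (r * real (Suc n)) (\<lambda>x. X k x / d) = 0" using excess_eq_0_iff[OF Xd] by simp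
          then show ?thesis using e(1)[of n] by simp
        qed (use elim in \<open>auto intro: less_imp_le\<close>)
        with Xd show ?case by (simp add: W_def)
      qed
    qed
    fix d :: real assume "0 < d"
    then have d: "0 < d / 2" by simp
    from ev[OF d] have "\<forall>\<^sub>F k in sequentially. \<bar>f (X k)\<bar> < d"
    proof eventually_elim
      case (elim k)
      \<comment> \<open>\<open>W\<close> is symmetric, which bounds \<open>f\<close> at - X as well
        and hence its absolute value at X.\<close>
      have "(\<lambda>x. - (X k x / (d/2))) \<in> W"
        using elim by (auto simp: W_def excU)
      then have "f (\<lambda>x. - X k x) \<le> d / 2"
        using X d by (intro f_W) auto
      moreover have "f (\<lambda>x. (-1) * X k x) = (-1) * f (X k)"
        using f(1) X unfolding linear_functional_on_def by blast
      moreover have "f (X k) \<le> d / 2"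
        using elim X d by (intro f_W) auto
      ultimately show ?case using \<open>0 < d\<close> by simp
    qed
    then show "\<exists>no. \<forall>n\<ge>no. norm (f (X n) - 0) < d"
      by (simp add: eventually_sequentially)
  qed
  show ?thesis
  proof (rule that[OF f(1)])
    show "f X \<le> 0" if "X \<in> A" for X
      using f(2)[OF A_Linf[OF that]] p_A[OF that] by simp
    show "1 \<le> f B" using pB f(3) by simp
  qed (rule f_lim)
qed

text \<open>This is the only consequence of the dual representation of \<open>\<rho>\<close> that is needed; an equivalent
  test probability is not.\<close>

lemma test_prob_charging:
  assumes F: "F \<in> sets M" "0 < measure M F"
  obtains Q where "Q \<in> test_probs M \<rho>" "0 < measure Q F"
proof -
  let ?B = "indicat_real F"
  obtain f where lin: "linear_functional_on (Linf M M) f" and fA: "\<And>X. X \<in> A \<Longrightarrow> f X \<le> 0"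
    and fB: "1 \<le> f ?B"
    and f_lim: "\<And>X c. \<lbrakk>\<And>k::nat. X k \<in> Linf M M; \<And>k. AE x in M. \<bar>X k x\<bar> \<le> c;
        AE x in M. (\<lambda>k. X k x) \<longlonglongrightarrow> 0\<rbrakk> \<Longrightarrow> (\<lambda>k. f (X k)) \<longlonglongrightarrow> 0"
    using acceptance_separating_functional[OF Linf_indicator[OF F(1)] rho_relevant[OF F]] by blast
  have f_add: "f (\<lambda>x. X x + Y x) = f X + f Y" if "X \<in> Linf M M" "Y \<in> Linf M M" for X Y
    using lin that unfolding linear_functional_on_def by blast
  have f_scale: "f (\<lambda>x. a * X x) = a * f X" if "X \<in> Linf M M" for X a
    using lin that unfolding linear_functional_on_def by blast
  have f_diff: "f (\<lambda>x. X x - Y x) = f X - f Y" if "X \<in> Linf M M" "Y \<in> Linf M M" for X Y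
    using f_add[OF that(1) Linf_uminus[OF that(2)]] f_scale[OF that(2), of "-1"] by simp
  have f_mono: "f X \<le> f Y" if "X \<in> Linf M M" "Y \<in> Linf M M" "AE x in M. X x \<le> Y x" for X Y
  proof -
    have "(\<lambda>x. X x - Y x) \<in> A" using that by (intro A_nonpos) auto
    from fA[OF this] f_diff[OF that(1,2)] show ?thesis by simp
  qed
  \<comment> \<open>A linear functional on representatives could distinguish versions of the same
    random variable; monotonicity with respect to almost sure inequality rules this out.\<close>
  have f_cong: "f X = f Y" if "X \<in> Linf M M" "Y \<in> Linf M M" "AE x in M. X x = Y x" for X Y
    using that by (intro antisym f_mono) auto
  have f_0: "f (\<lambda>x. 0) = 0" using f_scale[of "\<lambda>x. 0" 0] by simp
  have "f ?B \<le> f (\<lambda>x. 1)"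
    using F by (intro f_mono) (auto simp: indicator_def)
  with fB have f1: "0 < f (\<lambda>x. 1)" by simp
  define g where "g X = f X / f (\<lambda>x. 1)" for X
  have g_add: "g (\<lambda>x. X x + Y x) = g X + g Y" if "X \<in> Linf M M" "Y \<in> Linf M M" for X Y
    using f_add[OF that] by (simp add: g_def add_divide_distrib)
  have g_diff: "g (\<lambda>x. X x - Y x) = g X - g Y" if "X \<in> Linf M M" "Y \<in> Linf M M" for X Y
    using f_diff[OF that] by (simp add: g_def diff_divide_distrib)
  have g_scale: "g (\<lambda>x. a * X x) = a * g X" if "X \<in> Linf M M" for X a
    using f_scale[OF that] by (simp add: g_def)
  have g_cong: "g X = g Y" if "X \<in> Linf M M" "Y \<in> Linf M M" "AE x in M. X x = Y x" for X Y
    using f_cong[OF that] by (simp add: g_def)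
  have g_1: "g (\<lambda>x. 1) = 1" using f1 by (simp add: g_def)
  have g_const: "g (\<lambda>x. c) = c" for c using g_scale[of "\<lambda>x. 1" c] g_1 by simp
  have g_nonneg: "0 \<le> g X" if "X \<in> Linf M M" "AE x in M. 0 \<le> X x" for X
    using f_mono[of "\<lambda>x. 0" X] that f_0 f1 by (simp add: g_def)
  have g_A: "g X \<le> 0" if "X \<in> A" for X
    using fA[OF that] f1 by (simp add: g_def divide_le_0_iff)
  have g_lim: "(\<lambda>k. g (X k)) \<longlonglongrightarrow> 0" if "\<And>k::nat. X k \<in> Linf M M" "\<And>k. AE x in M. \<bar>X k x\<bar> \<le> c"
    "AE x in M. (\<lambda>k. X k x) \<longlonglongrightarrow> 0" for X c
    unfolding g_def using f_lim[OF that] by (rule tendsto_divide_zero)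
  define \<nu> where "\<nu> S = ennreal (g (indicat_real S))" for S
  define Q where "Q = measure_of (space M) (sets M) \<nu>"
  have pos: "positive (sets M) \<nu>"
  proof -
    have "indicat_real {} = (\<lambda>x::'a. 0)" by (simp add: fun_eq_iff)
    then show ?thesis using g_const[of 0] by (simp add: positive_def \<nu>_def)
  qed
  have ca: "countably_additive (sets M) \<nu>"
  \<comment> \<open>Given finite additivity, continuity at the empty set is enough, and that is
    \<open>g_lim\<close> for indicators, all bounded by 1.\<close>
  proof (rule sets.empty_continuous_imp_countably_additive[OF pos])
    show "additive (sets M) \<nu>"
      unfolding additive_def
    proof (intro ballI impI)
      fix S T assume S: "S \<in> sets M" and T: "T \<in> sets M" and disj: "S \<inter> T = {}"
      have "indicat_real (S \<union> T) = (\<lambda>x. indicat_real S x + indicat_real T x)"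
        using disj by (auto simp: indicator_def fun_eq_iff)
      then have "g (indicat_real (S \<union> T)) = g (indicat_real S) + g (indicat_real T)"
        using g_add S T by (simp add: Linf_indicator)
      then show "\<nu> (S \<union> T) = \<nu> S + \<nu> T"
        using S T by (simp add: \<nu>_def ennreal_plus g_nonneg Linf_indicator)
    qed
  next
    fix S :: "nat \<Rightarrow> 'a set" assume S: "range S \<subseteq> sets M" "decseq S" "(\<Inter>i. S i) = {}"
    have "(\<lambda>k. indicat_real (S k) x) \<longlonglongrightarrow> 0" for x
    proof -
      obtain N where "x \<notin> S N" using S(3) by auto
      then have "x \<notin> S k" if "N \<le> k" for k using S(2) that by (auto simp: decseq_def)
      then have "\<forall>\<^sub>F k in sequentially. indicat_real (S k) x = 0"
        by (auto simp: eventually_sequentially intro!: exI[of _ N])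
      then show ?thesis by (rule tendsto_eventually)
    qed
    then have "(\<lambda>k. g (indicat_real (S k))) \<longlonglongrightarrow> 0"
      using S(1) by (intro g_lim[of _ 1]) (auto simp: indicator_def)
    then show "(\<lambda>k. \<nu> (S k)) \<longlonglongrightarrow> 0"
      unfolding \<nu>_def by (auto dest: tendsto_ennrealI)
  qed (simp add: \<nu>_def)
  have sets_Q: "sets Q = sets M" by (simp add: Q_def)
  have space_Q: "space Q = space M" by (simp add: Q_def)
  have em_Q: "emeasure Q S = \<nu> S" if "S \<in> sets M" for S
    unfolding Q_def using that by (intro emeasure_measure_of_sigma pos ca) (rule sets.sigma_algebra_axioms)
  have m_Q: "measure Q S = g (indicat_real S)" if "S \<in> sets M" for S
    using that by (simp add: measure_def em_Q \<nu>_def g_nonneg Linf_indicator)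
  have "g (indicat_real (space M)) = g (\<lambda>x. 1)"
    by (intro g_cong) (auto intro!: AE_I2)
  then have prob_Q: "prob_space Q"
    by (intro prob_spaceI) (simp add: space_Q em_Q \<nu>_def g_1)
  interpret Q: prob_space Q by (rule prob_Q)
  have ac: "absolutely_continuous M Q"
    unfolding absolutely_continuous_def
  proof
    fix S assume S: "S \<in> null_sets M"
    then have "g (indicat_real S) = g (\<lambda>x. 0)"
      by (intro g_cong) (auto intro: Linf_indicator AE_not_in[THEN eventually_mono])
    with S show "S \<in> null_sets Q" by (auto simp: null_sets_def sets_Q em_Q \<nu>_def g_const)
  qed
  have AE_Q: "AE x in Q. P x" if "AE x in M. P x" for P
    using ac that by (metis absolutely_continuous_AE sets_Q)
  \<comment> \<open>Boundedness is kept as a premise inside the induction, because \<open>g\<close>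
    is controlled only on bounded functions. Nonnegativity lets the summands and the increasing
    approximants inherit the bound.\<close>
  have "(\<exists>c. \<forall>x\<in>space M. u x \<le> c) \<longrightarrow> (LINT x|Q. u x) = g u"
    if "u \<in> borel_measurable M" "\<And>x. 0 \<le> u x" for u
    using that
  proof (induction rule: borel_measurable_induct_real)
    case (set S)
    then show ?case by (simp add: m_Q sets_Q space_Q sets.Int_space_eq2)
  next
    case (mult u c)
    show ?case
    proof (cases "c = 0")
      case True
      then show ?thesis by (simp add: g_const)
    next
      case False
      show ?thesis
      proof
        assume "\<exists>b. \<forall>x\<in>space M. c * u x \<le> b"
        then obtain b where b: "\<And>x. x \<in> space M \<Longrightarrow> c * u x \<le> b" by blast
        have b': "u x \<le> b / c" if "x \<in> space M" for x
          using b[OF that] False mult.hyps(1) by (simp add: field_simps)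
        have "AE x in M. \<bar>u x\<bar> \<le> b / c" using mult.hyps(3) b' by (intro AE_I2) auto
        then have "u \<in> Linf M M" by (rule LinfI[OF mult.hyps(2)])
        moreover have "(LINT x|Q. u x) = g u" using mult.IH b' by blast
        ultimately show "(LINT x|Q. c * u x) = g (\<lambda>x. c * u x)" by (simp add: g_scale)
      qed
    qed
  next
    case (add u v)
    show ?case
    proof
      assume "\<exists>c. \<forall>x\<in>space M. v x + u x \<le> c"
      then obtain c where c: "\<And>x. x \<in> space M \<Longrightarrow> v x + u x \<le> c" by blast
      have cu: "u x \<le> c" and cv: "v x \<le> c" if "x \<in> space M" for x
        using c[OF that] add.hyps(2)[of x] add.hyps(4)[of x] by linarith+
      have "AE x in M. \<bar>u x\<bar> \<le> c" "AE x in M. \<bar>v x\<bar> \<le> c"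
        using cu cv add.hyps(2,4) by (auto intro!: AE_I2)
      then have Lu: "u \<in> Linf M M" and Lv: "v \<in> Linf M M"
        using LinfI[OF add.hyps(1)] LinfI[OF add.hyps(3)] by auto
      have "integrable Q u" "integrable Q v"
        using Lu Lv AE_Q[OF \<open>AE x in M. \<bar>u x\<bar> \<le> c\<close>] AE_Q[OF \<open>AE x in M. \<bar>v x\<bar> \<le> c\<close>] add.hyps(1,3)
        by (auto intro!: Q.integrable_bounded_AE simp: measurable_cong_sets[OF sets_Q refl])
      moreover have "(LINT x|Q. u x) = g u" "(LINT x|Q. v x) = g v"
        using add.IH cu cv by blast+
      ultimately show "(LINT x|Q. v x + u x) = g (\<lambda>x. v x + u x)"
        by (simp add: g_add[OF Lv Lu])
    qed
  next
    case (seq U)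
    show ?case
    proof
      assume "\<exists>c. \<forall>x\<in>space M. u x \<le> c"
      then obtain c where c: "\<And>x. x \<in> space M \<Longrightarrow> u x \<le> c" by blast
      have Ule: "U i x \<le> u x" if "x \<in> space M" for i x
        using seq.hyps(3) seq.hyps(4)[OF that] by (intro incseq_le) (auto simp: incseq_def le_fun_def)
      have Uc: "\<bar>U i x\<bar> \<le> c" if "x \<in> space M" for i x
        using Ule[OF that, of i] c[OF that] seq.hyps(2)[of i x] by simp
      have LU: "U i \<in> Linf M M" for i
        using Uc by (intro LinfI[OF seq.hyps(1), where c=c] AE_I2)
      have uc: "AE x in M. \<bar>u x\<bar> \<le> c" using c \<open>\<And>x. 0 \<le> u x\<close> by (auto intro!: AE_I2)
      then have Lu: "u \<in> Linf M M" using \<open>u \<in> borel_measurable M\<close> by (intro LinfI)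
      have IH: "(LINT x|Q. U i x) = g (U i)" for i using seq.IH Uc by (metis abs_le_D1)
      have "(\<lambda>i. LINT x|Q. U i x) \<longlonglongrightarrow> (LINT x|Q. u x)"
        using Uc seq.hyps(1,4) \<open>u \<in> borel_measurable M\<close>
        by (intro Q.integral_tendsto_bounded[where c=c])
          (auto simp: space_Q measurable_cong_sets[OF sets_Q refl] intro!: AE_I2)
      moreover have "(\<lambda>i. g (\<lambda>x. U i x - u x)) \<longlonglongrightarrow> 0"
      proof (rule g_lim)
        show "AE x in M. \<bar>U i x - u x\<bar> \<le> c" for i
          using Ule c seq.hyps(2) by (intro AE_I2) (smt (verit))
        show "AE x in M. (\<lambda>k. U k x - u x) \<longlonglongrightarrow> 0"
          using seq.hyps(4) by (intro AE_I2) (simp add: LIM_zero_iff)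
      qed (use LU Lu in auto)
      then have "(\<lambda>i. g (U i)) \<longlonglongrightarrow> g u"
        using LU Lu by (simp add: g_diff LIM_zero_iff)
      ultimately show "(LINT x|Q. u x) = g u"
        unfolding IH by (rule LIMSEQ_unique)
    qed
  qed
  then have int_nonneg: "(LINT x|Q. u x) = g u"
    if "u \<in> borel_measurable M" "\<And>x. 0 \<le> u x" "\<And>x. u x \<le> c" for u c
    using that by blast
  have int: "(LINT x|Q. X x) = g X" if X: "X \<in> Linf M M" for X
  proof -
    obtain c where c: "0 < c" "AE x in M. \<bar>X x\<bar> \<le> c" using X by (rule Linf_bound)
    \<comment> \<open>The shift by \<open>c\<close> and the truncation give a version of X + c that
      is nonnegative and bounded everywhere, not only almost surely, as the induction
      requires.\<close>
    let ?u = "\<lambda>x. max 0 (min (X x + c) (2 * c))"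
    have [measurable]: "X \<in> borel_measurable M" using X by (rule Linf_measurable)
    have [measurable]: "X \<in> borel_measurable Q" using X by (simp add: Linf_def measurable_cong_sets[OF sets_Q refl])
    have u: "?u \<in> borel_measurable M" by measurable
    have Lu: "?u \<in> Linf M M" using c(1) by (intro LinfI[OF u, where c="2*c"] AE_I2) auto
    have eq: "AE x in M. ?u x = X x + c" using c(2) by eventually_elim auto
    have iX: "integrable Q X" using AE_Q[OF c(2)] by (intro Q.integrable_bounded_AE) auto
    have "(LINT x|Q. X x) + c = (LINT x|Q. X x + c)" using iX by (simp add: Q.prob_space)
    also have "\<dots> = (LINT x|Q. ?u x)" using AE_Q[OF eq] by (intro integral_cong_AE) auto
    also have "\<dots> = g ?u" using c(1) by (intro int_nonneg[OF u, of "2*c"]) auto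
    also have "\<dots> = g (\<lambda>x. X x + c)" using Lu X eq by (intro g_cong) auto
    also have "\<dots> = g X + c" using X by (simp add: g_add g_const)
    finally show ?thesis by simp
  qed
  show ?thesis
  proof
    have "(LINT x|M. RN_density M Q x * X x) \<le> 0" if X: "X \<in> A" for X
      using integral_RN_density[OF prob_Q ac sets_Q Linf_measurable[OF A_Linf[OF X]]]
        int[OF A_Linf[OF X]] g_A[OF X] by simp
    then show "Q \<in> test_probs M \<rho>"
      using prob_Q sets_Q ac by (simp add: test_probs_def)
    have "0 < g ?B" using fB f1 by (simp add: g_def)
    then show "0 < measure Q F" using F by (simp add: m_Q)
  qed
qed

end

section \<open>Least hedges\<close>

text \<open>The theory of hedges sees \<open>A\<^sub>0\<close> only through these properties, and
  the test probabilities stay out of it. \<open>A0_null\<close> is the trace of relevance;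
  \<open>numeraire\<close> is the nontrivial inclusion in the defining equation of a
  numeraire.\<close>

locale conditional_acceptance = prob_space M for M :: "'a measure" +
  fixes F\<^sub>0 :: "'a measure" and A\<^sub>0 :: "('a \<Rightarrow> real) set" and v :: "'a \<Rightarrow> real"
  assumes subalg: "subalgebra M F\<^sub>0"
    and A0_Linf: "X \<in> A\<^sub>0 \<Longrightarrow> X \<in> Linf M M"
    and A0_add: "X \<in> A\<^sub>0 \<Longrightarrow> Y \<in> A\<^sub>0 \<Longrightarrow> (\<lambda>x. X x + Y x) \<in> A\<^sub>0"
    and A0_mult: "X \<in> A\<^sub>0 \<Longrightarrow> a \<in> Linf M F\<^sub>0 \<Longrightarrow> AE x in M. 0 \<le> a x \<Longrightarrow> (\<lambda>x. a x * X x) \<in> A\<^sub>0"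
    and A0_nonpos: "X \<in> Linf M M \<Longrightarrow> AE x in M. X x \<le> 0 \<Longrightarrow> X \<in> A\<^sub>0"
    and A0_closed: "\<lbrakk>\<And>k::nat. U k \<in> A\<^sub>0; \<And>k. AE x in M. \<bar>U k x\<bar> \<le> c; X \<in> borel_measurable M;
        AE x in M. (\<lambda>k. U k x) \<longlonglongrightarrow> X x\<rbrakk> \<Longrightarrow> X \<in> A\<^sub>0"
    and A0_null: "S \<in> sets M \<Longrightarrow> indicat_real S \<in> A\<^sub>0 \<Longrightarrow> measure M S = 0"
    and v_Linf: "v \<in> Linf M M"
    and v_nonneg: "AE x in M. 0 \<le> v x"
    and numeraire: "X \<in> Linf M M \<Longrightarrow> \<exists>m\<in>Linf M F\<^sub>0. (\<lambda>x. X x - m x * v x) \<in> A\<^sub>0"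
begin

lemma Linf_F0: "X \<in> Linf M F\<^sub>0 \<Longrightarrow> X \<in> Linf M M"
  by (rule Linf_subalgebra[OF subalg])

lemma sets_F0: "S \<in> sets F\<^sub>0 \<Longrightarrow> S \<in> sets M"
  using subalg by (auto simp: subalgebra_def)

lemma space_F0: "space F\<^sub>0 = space M"
  using subalg by (simp add: subalgebra_def)

lemma Linf_times_v: "m \<in> Linf M F\<^sub>0 \<Longrightarrow> (\<lambda>x. m x * v x) \<in> Linf M M"
  by (intro Linf_mult Linf_F0 v_Linf)

lemma A0_mono:
  assumes "X \<in> A\<^sub>0" "Y \<in> Linf M M" "AE x in M. Y x \<le> X x"
  shows "Y \<in> A\<^sub>0"
proof -
  have "(\<lambda>x. Y x - X x) \<in> A\<^sub>0" using assms A0_Linf by (intro A0_nonpos) auto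
  from A0_add[OF assms(1) this] show ?thesis by simp
qed

lemma A0_if:
  assumes G: "G \<in> sets F\<^sub>0" and X: "X \<in> A\<^sub>0" and Y: "Y \<in> A\<^sub>0"
  shows "(\<lambda>x. if x \<in> G then X x else Y x) \<in> A\<^sub>0"
proof -
  have "(\<lambda>x. indicat_real G x * X x + (1 - indicat_real G x) * Y x) \<in> A\<^sub>0"
    using G by (intro A0_add A0_mult X Y Linf_diff Linf_indicator Linf_const) (auto simp: indicator_def)
  moreover have "(\<lambda>x. indicat_real G x * X x + (1 - indicat_real G x) * Y x)
      = (\<lambda>x. if x \<in> G then X x else Y x)"
    by (auto simp: indicator_def)
  ultimately show ?thesis by simp
qed

text \<open>The indicator of {X \<ge> 1/(k+1)} lies below (k+1) X, so it is acceptable and this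
  level set is null.\<close>

lemma A0_nonneg_null:
  assumes X: "X \<in> A\<^sub>0" "AE x in M. 0 \<le> X x"
  shows "AE x in M. X x = 0"
proof -
  have [measurable]: "X \<in> borel_measurable M" using X A0_Linf Linf_measurable by blast
  have "AE x in M. \<not> 1 / real (Suc k) \<le> X x" for k
  proof -
    let ?S = "{x \<in> space M. 1 / real (Suc k) \<le> X x}"
    have "(\<lambda>x. real (Suc k) * X x) \<in> A\<^sub>0" by (intro A0_mult X Linf_const) auto
    then have "indicat_real ?S \<in> A\<^sub>0"
    proof (rule A0_mono)
      show "AE x in M. indicat_real ?S x \<le> real (Suc k) * X x"
        using X(2) by eventually_elim (auto simp: indicator_def field_simps)
    qed (auto intro!: Linf_indicator)
    from A0_null[OF _ this] have "measure M ?S = 0" by simp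
    then have "AE x in M. x \<notin> ?S" by (intro AE_not_in) (auto simp: null_sets_def emeasure_eq_measure)
    then show ?thesis by (rule AE_mp) auto
  qed
  then have "AE x in M. \<forall>k. X x < 1 / real (Suc k)" by (simp add: AE_all_countable not_le)
  with X(2) show ?thesis
  proof eventually_elim
    case (elim x)
    have "X x \<le> 0"
    proof (rule field_le_epsilon)
      fix e :: real assume "0 < e"
      then obtain k where "1 / real (Suc k) < e" using nat_approx_posE by blast
      with elim show "X x \<le> 0 + e" by (smt (verit))
    qed
    with elim show ?case by simp
  qed
qed

definition hedges :: "('a \<Rightarrow> real) \<Rightarrow> ('a \<Rightarrow> real) set" where
  "hedges X = {m \<in> Linf M F\<^sub>0. (\<lambda>x. X x - m x * v x) \<in> A\<^sub>0}"

lemma hedges_Linf: "m \<in> hedges X \<Longrightarrow> m \<in> Linf M F\<^sub>0"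
  and hedges_A0: "m \<in> hedges X \<Longrightarrow> (\<lambda>x. X x - m x * v x) \<in> A\<^sub>0"
  by (auto simp: hedges_def)

lemma hedgesI: "m \<in> Linf M F\<^sub>0 \<Longrightarrow> (\<lambda>x. X x - m x * v x) \<in> A\<^sub>0 \<Longrightarrow> m \<in> hedges X"
  by (simp add: hedges_def)

lemma hedges_add:
  assumes "m \<in> hedges X" "n \<in> hedges Y"
  shows "(\<lambda>x. m x + n x) \<in> hedges (\<lambda>x. X x + Y x)"
proof (rule hedgesI)
  show "(\<lambda>x. X x + Y x - (m x + n x) * v x) \<in> A\<^sub>0"
    using A0_add[OF hedges_A0[OF assms(1)] hedges_A0[OF assms(2)]] by (simp add: algebra_simps)
qed (use assms hedges_Linf in blast)

lemma hedges_mult: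
  assumes "m \<in> hedges X" "a \<in> Linf M F\<^sub>0" "AE x in M. 0 \<le> a x"
  shows "(\<lambda>x. a x * m x) \<in> hedges (\<lambda>x. a x * X x)"
proof (rule hedgesI)
  show "(\<lambda>x. a x * X x - a x * m x * v x) \<in> A\<^sub>0"
    using A0_mult[OF hedges_A0[OF assms(1)] assms(2,3)] by (simp add: algebra_simps)
qed (use assms hedges_Linf in blast)

lemma hedges_mono:
  assumes m: "m \<in> hedges X" and n: "n \<in> Linf M F\<^sub>0" "AE x in M. m x \<le> n x"
    and Y: "Y \<in> Linf M M" "AE x in M. Y x \<le> X x"
  shows "n \<in> hedges Y"
proof (rule hedgesI[OF n(1)], rule A0_mono[OF hedges_A0[OF m]])
  show "AE x in M. Y x - n x * v x \<le> X x - m x * v x"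
    using n(2) Y(2) v_nonneg by eventually_elim (auto intro!: diff_mono mult_right_mono)
qed (intro Linf_diff Y Linf_times_v n)

lemma hedges_if:
  assumes "G \<in> sets F\<^sub>0" "m \<in> hedges X" "n \<in> hedges X"
  shows "(\<lambda>x. if x \<in> G then m x else n x) \<in> hedges X"
proof (rule hedgesI)
  show "(\<lambda>x. X x - (if x \<in> G then m x else n x) * v x) \<in> A\<^sub>0"
    using A0_if[OF assms(1) hedges_A0[OF assms(2)] hedges_A0[OF assms(3)]]
    by (rule back_subst[of "\<lambda>Z. Z \<in> A\<^sub>0"]) auto
qed (use assms hedges_Linf Linf_if in blast)

text \<open>The event {m \<le> n} belongs to \<open>F\<^sub>0\<close>, and hedges may be pasted
  along such events.\<close>

lemma hedges_min:
  assumes "m \<in> hedges X" "n \<in> hedges X"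
  shows "(\<lambda>x. min (m x) (n x)) \<in> hedges X"
proof -
  have [measurable]: "m \<in> borel_measurable F\<^sub>0" "n \<in> borel_measurable F\<^sub>0"
    using assms hedges_Linf Linf_measurable by blast+
  let ?G = "{x \<in> space F\<^sub>0. m x \<le> n x}"
  have "(\<lambda>x. if x \<in> ?G then m x else n x) \<in> hedges X"
    using assms by (intro hedges_if) auto
  then show ?thesis
  proof (rule hedges_mono)
    show "AE x in M. (if x \<in> ?G then m x else n x) \<le> min (m x) (n x)"
      by (intro AE_I2) (auto simp: space_F0)
    have "(\<lambda>x. (X x - m x * v x) + m x * v x) \<in> Linf M M"
      using assms by (intro Linf_add A0_Linf hedges_A0 Linf_times_v hedges_Linf)
    then show "X \<in> Linf M M" by simp
  qed (use assms hedges_Linf in auto)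
qed

text \<open>If \<open>m\<close> were negative on some event, then \<open>v\<close> would be worthless there, and the constant \<open>1\<close>
  could not be hedged.\<close>

lemma hedges_0_nonneg:
  assumes "m \<in> hedges (\<lambda>x. 0)"
  shows "AE x in M. 0 \<le> m x"
proof -
  let ?w = "\<lambda>x. max 0 (- m x)"
  have mL: "m \<in> Linf M F\<^sub>0" and mA: "(\<lambda>x. - m x * v x) \<in> A\<^sub>0"
    using hedges_Linf[OF assms] hedges_A0[OF assms] by auto
  have [measurable]: "m \<in> borel_measurable F\<^sub>0" using mL by (rule Linf_measurable)
  obtain b where b: "AE x in M. \<bar>m x\<bar> \<le> b" using mL by (auto simp: Linf_def)
  have wL: "?w \<in> Linf M F\<^sub>0"
  proof (rule LinfI)
    show "AE x in M. \<bar>?w x\<bar> \<le> b" using b by eventually_elim auto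
  qed measurable
  let ?G = "{x \<in> space F\<^sub>0. m x < 0}"
  have "(\<lambda>x. indicat_real ?G x * (- m x * v x)) \<in> A\<^sub>0"
    by (intro A0_mult mA Linf_indicator) auto
  then have wv: "(\<lambda>x. ?w x * v x) \<in> A\<^sub>0"
  proof (rule A0_mono)
    show "AE x in M. ?w x * v x \<le> indicat_real ?G x * (- m x * v x)"
      by (intro AE_I2) (auto simp: space_F0 indicator_def max_def)
  qed (intro Linf_times_v wL)
  obtain n where n: "n \<in> Linf M F\<^sub>0" "(\<lambda>x. 1 - n x * v x) \<in> A\<^sub>0"
    using numeraire[of "\<lambda>x. 1"] by auto
  obtain c where c: "0 < c" "AE x in M. \<bar>n x\<bar> \<le> c" using n(1) by (rule Linf_bound)
  \<comment> \<open>This sum equals w + (c - n) w v and so dominates w, since n \<le> c. The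
    worthless position w v thus pays for the nonnegative amount w.\<close>
  have "(\<lambda>x. ?w x * (1 - n x * v x) + c * (?w x * v x)) \<in> A\<^sub>0"
    using c(1) by (intro A0_add A0_mult n(2) wv wL) auto
  then have "?w \<in> A\<^sub>0"
  proof (rule A0_mono)
    show "AE x in M. ?w x \<le> ?w x * (1 - n x * v x) + c * (?w x * v x)"
      using c(2) v_nonneg
    proof eventually_elim
      case (elim x)
      have "0 \<le> (c - n x) * (?w x * v x)" using elim by (intro mult_nonneg_nonneg) auto
      then show ?case by (simp add: algebra_simps)
    qed
  qed (intro Linf_F0 wL)
  then have "AE x in M. ?w x = 0" by (rule A0_nonneg_null) auto
  then show ?thesis by eventually_elim (auto simp: max_def split: if_splits)
qed

text \<open>The sum of a hedge of X and a fixed hedge n of - X is a hedge of 0, hence nonnegative;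
  so every hedge of X lies above - n.\<close>

lemma hedges_lower:
  assumes X: "X \<in> Linf M M"
  obtains c where "0 < c" "\<And>m. m \<in> hedges X \<Longrightarrow> AE x in M. - c \<le> m x"
proof -
  obtain n where "n \<in> hedges (\<lambda>x. - X x)"
    using numeraire[OF Linf_uminus[OF X]] by (auto simp: hedges_def)
  moreover obtain c where "0 < c" "AE x in M. \<bar>n x\<bar> \<le> c"
    using hedges_Linf[OF calculation] by (rule Linf_bound)
  moreover have "AE x in M. - c \<le> m x" if "m \<in> hedges X" for m
  proof -
    have "AE x in M. 0 \<le> m x + n x"
      using hedges_add[OF that \<open>n \<in> hedges (\<lambda>x. - X x)\<close>] by (intro hedges_0_nonneg) simp
    with \<open>AE x in M. \<bar>n x\<bar> \<le> c\<close> show ?thesis by eventually_elim auto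
  qed
  ultimately show ?thesis using that by blast
qed

lemma hedges_closed:
  assumes X: "X \<in> Linf M M" and u: "\<And>k::nat. u k \<in> hedges X" and b: "\<And>k. AE x in M. \<bar>u k x\<bar> \<le> b"
    and w: "w \<in> borel_measurable F\<^sub>0" "AE x in M. (\<lambda>k. u k x) \<longlonglongrightarrow> w x"
  shows "w \<in> hedges X"
proof (rule hedgesI)
  show wL: "w \<in> Linf M F\<^sub>0" using w(1) AE_abs_limit_le[OF b w(2)] by (rule LinfI)
  obtain c where c: "0 < c" "AE x in M. \<bar>X x\<bar> \<le> c" using X by (rule Linf_bound)
  obtain d where d: "0 < d" "AE x in M. \<bar>v x\<bar> \<le> d" using v_Linf by (rule Linf_bound)
  show "(\<lambda>x. X x - w x * v x) \<in> A\<^sub>0"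
  proof (rule A0_closed[OF hedges_A0[OF u]])
    show "AE x in M. \<bar>X x - u k x * v x\<bar> \<le> c + b * d" for k
      using c(2) d(2) b[of k]
    proof eventually_elim
      case (elim x)
      have "\<bar>u k x\<bar> * \<bar>v x\<bar> \<le> b * d" using elim by (intro mult_mono) auto
      with elim show ?case by (simp add: abs_mult[symmetric])
    qed
    show "AE x in M. (\<lambda>k. X x - u k x * v x) \<longlonglongrightarrow> X x - w x * v x"
      using w(2) by eventually_elim (intro tendsto_intros)
    show "(\<lambda>x. X x - w x * v x) \<in> borel_measurable M"
      by (intro Linf_measurable[of _ M] Linf_diff X Linf_times_v wL)
  qed
qed

lemma hedges_least:
  assumes X: "X \<in> Linf M M"
  obtains w where "w \<in> hedges X" "\<And>m. m \<in> hedges X \<Longrightarrow> AE x in M. w x \<le> m x"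
proof -
  obtain c where c: "0 < c" "\<And>m. m \<in> hedges X \<Longrightarrow> AE x in M. - c \<le> m x"
    using hedges_lower[OF X] by blast
  show ?thesis
  proof (rule Linf_least[OF subalg, of "hedges X" "- c"])
    show "hedges X \<noteq> {}" using numeraire[OF X] by (auto simp: hedges_def)
    show "hedges X \<subseteq> Linf M F\<^sub>0" using hedges_Linf by blast
  qed (fact c(2) hedges_min hedges_closed[OF X] that)+
qed

end

section \<open>The least hedge as a conditional risk measure\<close>

locale conditional_price = conditional_acceptance +
  fixes \<tau> :: "('a \<Rightarrow> real) \<Rightarrow> 'a \<Rightarrow> real"
  assumes price_hedges: "X \<in> Linf M M \<Longrightarrow> \<tau> X \<in> hedges X"
    and price_least: "X \<in> Linf M M \<Longrightarrow> m \<in> hedges X \<Longrightarrow> AE x in M. \<tau> X x \<le> m x"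
begin

lemma price_Linf: "X \<in> Linf M M \<Longrightarrow> \<tau> X \<in> Linf M F\<^sub>0"
  using price_hedges hedges_Linf by blast

lemma price_mono:
  assumes "X \<in> Linf M M" "Y \<in> Linf M M" "AE x in M. X x \<le> Y x"
  shows "AE x in M. \<tau> X x \<le> \<tau> Y x"
  using hedges_mono[OF price_hedges[OF assms(2)] price_Linf[OF assms(2)] _ assms(1,3)] assms(1)
  by (intro price_least) auto

lemma price_subadd:
  assumes "X \<in> Linf M M" "Y \<in> Linf M M"
  shows "AE x in M. \<tau> (\<lambda>x. X x + Y x) x \<le> \<tau> X x + \<tau> Y x"
  using assms by (intro price_least hedges_add price_hedges Linf_add)

lemma price_translation:
  assumes X: "X \<in> Linf M M" and y: "y \<in> Linf M F\<^sub>0"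
  shows "AE x in M. \<tau> (\<lambda>x. X x + y x * v x) x = \<tau> X x + y x"
proof -
  have L: "(\<lambda>x. X x + y x * v x) \<in> Linf M M" using X y by (intro Linf_add Linf_times_v)
  have "(\<lambda>x. \<tau> X x + y x) \<in> hedges (\<lambda>x. X x + y x * v x)"
    using price_Linf[OF X] y hedges_A0[OF price_hedges[OF X]]
    by (intro hedgesI Linf_add) (simp_all add: algebra_simps)
  then have 1: "AE x in M. \<tau> (\<lambda>x. X x + y x * v x) x \<le> \<tau> X x + y x"
    by (rule price_least[OF L])
  have "(\<lambda>x. \<tau> (\<lambda>x. X x + y x * v x) x - y x) \<in> hedges X"
    using price_Linf[OF L] y hedges_A0[OF price_hedges[OF L]]
    by (intro hedgesI Linf_diff) (simp_all add: algebra_simps)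
  from price_least[OF X this] 1 show ?thesis by eventually_elim simp
qed

text \<open>Minimality gives one inequality. For the other one divides by \<open>a\<close>; as 1/a
  may be unbounded, this is done on the events {a \<ge> 1/(k+1)}, which exhaust {a > 0}. The event
  {a = 0} needs an argument of its own.\<close>

lemma price_homogeneous:
  assumes X: "X \<in> Linf M M" and a: "a \<in> Linf M F\<^sub>0" "AE x in M. 0 \<le> a x"
  shows "AE x in M. \<tau> (\<lambda>x. a x * X x) x = a x * \<tau> X x"
proof -
  let ?m = "\<tau> (\<lambda>x. a x * X x)"
  have aX: "(\<lambda>x. a x * X x) \<in> Linf M M" using X a Linf_F0 by blast
  have [measurable]: "a \<in> borel_measurable F\<^sub>0" "?m \<in> borel_measurable F\<^sub>0"
    using a(1) price_Linf[OF aX] Linf_measurable by blast+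
  have le: "AE x in M. ?m x \<le> a x * \<tau> X x"
    by (intro price_least aX hedges_mult price_hedges X a)
  \<comment> \<open>Where \<open>a\<close> vanishes, \<open>?m\<close> is a hedge of 0 and therefore
    nonnegative, which is the inequality still missing there.\<close>
  let ?Z = "{x \<in> space F\<^sub>0. a x = 0}"
  have "(\<lambda>x. indicat_real ?Z x * ?m x) \<in> hedges (\<lambda>x. indicat_real ?Z x * (a x * X x))"
    by (intro hedges_mult price_hedges aX Linf_indicator) auto
  also have "(\<lambda>x. indicat_real ?Z x * (a x * X x)) = (\<lambda>x. 0)"
    by (auto simp: indicator_def)
  finally have zero: "AE x in M. 0 \<le> indicat_real ?Z x * ?m x" by (rule hedges_0_nonneg)
  have "AE x in M. 1 / real (Suc k) \<le> a x \<longrightarrow> \<tau> X x \<le> ?m x / a x" for k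
  proof -
    let ?G = "{x \<in> space F\<^sub>0. 1 / real (Suc k) \<le> a x}"
    let ?b = "\<lambda>x. if x \<in> ?G then 1 / a x else 0"
    have bL: "?b \<in> Linf M F\<^sub>0"
    proof (rule LinfI)
      have "\<bar>?b x\<bar> \<le> real (Suc k)" for x
      proof (cases "x \<in> ?G")
        case True
        then have "1 / real (Suc k) \<le> a x" by simp
        moreover from this have "0 < a x" by (rule less_le_trans[rotated]) simp
        ultimately show ?thesis using True by (simp add: field_simps)
      next
        case False
        show ?thesis unfolding if_not_P[OF False] by simp
      qed
      then show "AE x in M. \<bar>?b x\<bar> \<le> real (Suc k)" by simp
    qed measurable
    have bX: "(\<lambda>x. ?b x * ?m x) \<in> hedges (\<lambda>x. ?b x * (a x * X x))"
      using a(2) by (intro hedges_mult price_hedges aX bL) (auto elim!: eventually_mono)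
    \<comment> \<open>Off \<open>?G\<close> the divided hedge carries no information, so it is
      pasted with the least hedge \<open>\<tau> X\<close> to obtain a hedge of X everywhere.\<close>
    have "(\<lambda>x. if x \<in> ?G then ?b x * (a x * X x) - ?b x * ?m x * v x else X x - \<tau> X x * v x) \<in> A\<^sub>0"
      using bX X by (intro A0_if hedges_A0 price_hedges) (auto intro: hedges_A0)
    also have "(\<lambda>x. if x \<in> ?G then ?b x * (a x * X x) - ?b x * ?m x * v x else X x - \<tau> X x * v x)
        = (\<lambda>x. X x - (if x \<in> ?G then ?b x * ?m x else \<tau> X x) * v x)"
    proof
      fix x
      show "(if x \<in> ?G then ?b x * (a x * X x) - ?b x * ?m x * v x else X x - \<tau> X x * v x)
        = X x - (if x \<in> ?G then ?b x * ?m x else \<tau> X x) * v x"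
      proof (cases "x \<in> ?G")
        case True
        then have "1 / real (Suc k) \<le> a x" by simp
        then have "0 < a x" by (rule less_le_trans[rotated]) simp
        with True show ?thesis by simp
      next
        case False
        show ?thesis by (simp only: if_not_P[OF False])
      qed
    qed
    finally have "(\<lambda>x. if x \<in> ?G then ?b x * ?m x else \<tau> X x) \<in> hedges X"
      by (intro hedgesI Linf_if Linf_mult bL price_Linf aX X) auto
    from price_least[OF X this] show ?thesis
      by (rule AE_mp) (auto simp: space_F0 intro!: AE_I2)
  qed
  then have "AE x in M. \<forall>k. 1 / real (Suc k) \<le> a x \<longrightarrow> \<tau> X x \<le> ?m x / a x"
    by (intro AE_all_countable[THEN iffD2] allI)
  with le zero a(2) AE_space show ?thesis
  proof eventually_elim
    case (elim x)
    show ?case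
    proof (cases "a x = 0")
      case True
      with elim show ?thesis by (simp add: space_F0)
    next
      case False
      with elim have pos: "0 < a x" by simp
      then obtain k where "1 / real (Suc k) < a x" using nat_approx_posE by blast
      with elim have "\<tau> X x \<le> ?m x / a x" by (auto intro: less_imp_le)
      with pos elim show ?thesis by (simp add: field_simps)
    qed
  qed
qed

text \<open>X is acceptable exactly when 0 is one of its hedges, and hedges are closed upwards with
  least element \<open>\<tau> X\<close>.\<close>

lemma A0_eq_price_nonpos: "A\<^sub>0 = {X \<in> Linf M M. AE x in M. \<tau> X x \<le> 0}"
proof (intro set_eqI iffI)
  fix X assume X: "X \<in> A\<^sub>0"
  then have "(\<lambda>x. 0) \<in> hedges X" by (intro hedgesI) auto
  with price_least[OF A0_Linf[OF X] this] show "X \<in> {X \<in> Linf M M. AE x in M. \<tau> X x \<le> 0}"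
    using A0_Linf[OF X] by simp
next
  fix X assume "X \<in> {X \<in> Linf M M. AE x in M. \<tau> X x \<le> 0}"
  then have "(\<lambda>x. 0) \<in> hedges X"
    using hedges_mono[OF price_hedges[of X] Linf_const] by auto
  then show "X \<in> A\<^sub>0" using hedges_A0[of "\<lambda>x. 0" X] by simp
qed

text \<open>On the event N where the price m of F is nonpositive, - m v is nonnegative, so the
  indicator of F \<inter> N lies below an acceptable position and F \<inter> N is null. The
  conditional probability of F then integrates to 0 over N; being positive, it forces N to be
  null.\<close>

lemma price_relevant:
  assumes F: "F \<in> sets M" "AE x in M. real_cond_exp M F\<^sub>0 (indicat_real F) x > 0"
  shows "AE x in M. 0 < \<tau> (indicat_real F) x"
proof -
  interpret fms: finite_measure_subalgebra M F\<^sub>0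
    using subalg by unfold_locales
  let ?m = "\<tau> (indicat_real F)"
  have FL: "indicat_real F \<in> Linf M M" using F(1) by (rule Linf_indicator)
  have [measurable]: "?m \<in> borel_measurable F\<^sub>0" using price_Linf[OF FL] by (rule Linf_measurable)
  let ?N = "{x \<in> space F\<^sub>0. ?m x \<le> 0}"
  have N: "?N \<in> sets F\<^sub>0" by measurable
  have "(\<lambda>x. indicat_real ?N x * (indicat_real F x - ?m x * v x)) \<in> A\<^sub>0"
    by (intro A0_mult hedges_A0 price_hedges FL Linf_indicator N) auto
  then have "indicat_real (F \<inter> ?N) \<in> A\<^sub>0"
  proof (rule A0_mono)
    show "AE x in M. indicat_real (F \<inter> ?N) x \<le> indicat_real ?N x * (indicat_real F x - ?m x * v x)"
      using v_nonneg by eventually_elim (auto simp: indicator_def mult_nonpos_nonneg)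
  qed (use F(1) sets_F0[OF N] in \<open>auto intro!: Linf_indicator\<close>)
  then have "measure M (F \<inter> ?N) = 0" using F(1) sets_F0[OF N] by (intro A0_null) auto
  moreover have "(LINT x|M. indicat_real ?N x * real_cond_exp M F\<^sub>0 (indicat_real F) x)
      = (LINT x|M. indicat_real ?N x * indicat_real F x)"
    using F(1) N by (intro fms.real_cond_exp_intg) (auto intro!: integrable_Linf Linf_mult Linf_indicator sets_F0)
  ultimately have zero: "(LINT x|M. indicat_real ?N x * real_cond_exp M F\<^sub>0 (indicat_real F) x) = 0"
    using F(1) sets_F0[OF N] by (simp add: indicator_inter_arith[symmetric] Int_commute)
  have "AE x in M. indicat_real ?N x * real_cond_exp M F\<^sub>0 (indicat_real F) x = 0"
  proof (subst integral_nonneg_eq_0_iff_AE[symmetric])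
    show "integrable M (\<lambda>x. indicat_real ?N x * real_cond_exp M F\<^sub>0 (indicat_real F) x)"
      using F(1) N by (intro fms.real_cond_exp_intg) (auto intro!: integrable_Linf Linf_mult Linf_indicator sets_F0)
    show "AE x in M. 0 \<le> indicat_real ?N x * real_cond_exp M F\<^sub>0 (indicat_real F) x"
      using F(2) by eventually_elim simp
  qed (rule zero)
  with F(2) AE_space show ?thesis
    by eventually_elim (auto simp: space_F0 indicator_def split: if_splits)
qed

lemma price_bounded:
  obtains c where "0 < c"
    "\<And>X. X \<in> Linf M M \<Longrightarrow> AE x in M. \<bar>X x\<bar> \<le> 1 \<Longrightarrow> AE x in M. \<bar>\<tau> X x\<bar> \<le> c"
proof -
  obtain c where c: "0 < c" "AE x in M. \<bar>\<tau> (\<lambda>x. 1) x\<bar> \<le> c"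
    using price_Linf[OF Linf_const] by (rule Linf_bound)
  obtain d where d: "0 < d" "AE x in M. \<bar>\<tau> (\<lambda>x. -1) x\<bar> \<le> d"
    using price_Linf[OF Linf_const] by (rule Linf_bound)
  have "AE x in M. \<bar>\<tau> X x\<bar> \<le> c + d" if X: "X \<in> Linf M M" "AE x in M. \<bar>X x\<bar> \<le> 1" for X
  proof -
    have "AE x in M. X x \<le> 1" "AE x in M. -1 \<le> X x"
      using X(2) by (auto elim!: eventually_mono)
    from price_mono[OF X(1) Linf_const this(1)] price_mono[OF Linf_const X(1) this(2)]
    have "AE x in M. \<tau> X x \<le> \<tau> (\<lambda>x. 1) x" "AE x in M. \<tau> (\<lambda>x. -1) x \<le> \<tau> X x" .
    with c(2) d(2) show ?thesis
      by eventually_elim (use c(1) d(1) in auto)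
  qed
  with c(1) d(1) that[of "c + d"] show ?thesis by auto
qed

text \<open>The tail infima \<open>J n\<close> of the prices hedge the tail infima
  \<open>I n\<close> of the positions. Both converge, and closedness of \<open>A\<^sub>0\<close>
  makes the limit of \<open>J n\<close> a hedge of X; by minimality \<open>\<tau> X\<close> lies
  below it.\<close>

lemma price_Fatou_AE:
  assumes X: "X \<in> Linf M M" and Xn: "\<And>n. Xn n \<in> Linf M M" "\<And>n. AE x in M. \<bar>Xn n x\<bar> \<le> 1"
    and lim: "AE x in M. (\<lambda>n. Xn n x) \<longlonglongrightarrow> X x"
  shows "AE x in M. ereal (\<tau> X x) \<le> liminf (\<lambda>n. ereal (\<tau> (Xn n) x))"
proof -
  obtain c where c: "0 < c" "\<And>Y. Y \<in> Linf M M \<Longrightarrow> AE x in M. \<bar>Y x\<bar> \<le> 1 \<Longrightarrow> AE x in M. \<bar>\<tau> Y x\<bar> \<le> c"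
    using price_bounded by blast
  \<comment> \<open>Truncation turns the almost sure bounds into pointwise ones, so that the infima are genuine.\<close>
  define Y where "Y n x = max (-1) (min 1 (Xn n x))" for n x
  define T where "T n x = max (- c) (min c (\<tau> (Xn n) x))" for n x
  define I where "I n x = (INF k\<in>{n..}. Y k x)" for n x
  define J where "J n x = (INF k\<in>{n..}. T k x)" for n x
  have [measurable]: "Xn n \<in> borel_measurable M" "\<tau> (Xn n) \<in> borel_measurable F\<^sub>0" for n
    using Xn(1) price_Linf Linf_measurable by blast+
  have Y_bd: "\<bar>Y n x\<bar> \<le> 1" and T_bd: "\<bar>T n x\<bar> \<le> c" for n x
    using c(1) by (auto simp: Y_def T_def)
  have Y_bb: "bdd_below ((\<lambda>k. Y k x) ` {n..})" and T_bb: "bdd_below ((\<lambda>k. T k x) ` {n..})" for n x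
    by (rule bdd_belowI[of _ "-1"], simp add: image_iff Y_def, force)
      (rule bdd_belowI[of _ "-c"], simp add: image_iff T_def, force)
  have I_le: "I n x \<le> Y k x" and J_le: "J n x \<le> T k x" if "n \<le> k" for n k x
    unfolding I_def J_def using that by (intro cINF_lower Y_bb T_bb; simp)+
  have I_ge: "b \<le> I n x" if "\<And>k. n \<le> k \<Longrightarrow> b \<le> Y k x" for b n x
    unfolding I_def by (rule cINF_greatest) (simp_all add: that)
  have J_ge: "b \<le> J n x" if "\<And>k. n \<le> k \<Longrightarrow> b \<le> T k x" for b n x
    unfolding J_def by (rule cINF_greatest) (simp_all add: that)
  have I_bd: "\<bar>I n x\<bar> \<le> 1" for n x
  proof -
    have "-1 \<le> I n x" by (rule I_ge) (simp add: Y_def)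
    with I_le[of n n x] Y_bd[of n x] show ?thesis by simp
  qed
  have J_bd: "\<bar>J n x\<bar> \<le> c" for n x
  proof -
    have "- c \<le> J n x" by (rule J_ge) (simp add: T_def)
    with J_le[of n n x] T_bd[of n x] show ?thesis by simp
  qed
  have [measurable]: "I n \<in> borel_measurable M" for n
    unfolding I_def using Y_bb by (intro borel_measurable_cINF) (auto simp: Y_def)
  have [measurable]: "J n \<in> borel_measurable F\<^sub>0" for n
    unfolding J_def using T_bb by (intro borel_measurable_cINF) (auto simp: T_def)
  have IL: "I n \<in> Linf M M" for n using I_bd by (intro LinfI[where c=1]) auto
  have JL: "J n \<in> Linf M F\<^sub>0" for n using J_bd by (intro LinfI[where c=c]) auto
  have YX: "AE x in M. \<forall>n. Y n x = Xn n x"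
  proof (subst AE_all_countable, rule allI)
    show "AE x in M. Y n x = Xn n x" for n
      using Xn(2)[of n] by eventually_elim (auto simp: Y_def)
  qed
  have TX: "AE x in M. \<forall>n. T n x = \<tau> (Xn n) x"
  proof (subst AE_all_countable, rule allI)
    show "AE x in M. T n x = \<tau> (Xn n) x" for n
      using c(2)[OF Xn, of n] by eventually_elim (auto simp: T_def)
  qed
  have "AE x in M. \<tau> (I n) x \<le> J n x" for n
  proof -
    have "AE x in M. \<forall>k\<in>{n..}. \<tau> (I n) x \<le> \<tau> (Xn k) x"
    proof (subst AE_ball_countable)
      show "\<forall>k\<in>{n..}. AE x in M. \<tau> (I n) x \<le> \<tau> (Xn k) x"
      proof
        fix k assume k: "k \<in> {n..}"
        show "AE x in M. \<tau> (I n) x \<le> \<tau> (Xn k) x"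
        proof (rule price_mono[OF IL Xn(1)])
          show "AE x in M. I n x \<le> Xn k x"
            using YX
          proof eventually_elim
            case (elim x)
            with I_le[of n k x] k show ?case by simp
          qed
        qed
      qed
    qed auto
    with TX show ?thesis by eventually_elim (auto intro!: J_ge)
  qed
  \<comment> \<open>\<open>I n\<close> lies below each later position, so its price lies below all
    later prices and hence below their infimum.\<close>
  then have "J n \<in> hedges (I n)" for n
    by (intro hedges_mono[OF price_hedges[OF IL] JL _ IL]) auto
  note IJ = hedges_A0[OF this]
  define H where "H x = lim (\<lambda>n. J n x)" for x
  have J_lim: "(\<lambda>n. J n x) \<longlonglongrightarrow> H x" for x
  proof -
    have "incseq (\<lambda>n. J n x)" by (intro incseq_SucI J_ge J_le) auto
    then have "convergent (\<lambda>n. J n x)"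
      using incseq_convergent[of "\<lambda>n. J n x" c] J_bd[of _ x] unfolding convergent_def
      by (metis abs_le_D1)
    then show ?thesis by (simp add: H_def convergent_LIMSEQ_iff)
  qed
  have HL: "H \<in> Linf M F\<^sub>0"
  proof (rule LinfI)
    show "H \<in> borel_measurable F\<^sub>0" unfolding H_def by (intro borel_measurable_lim_metric) measurable
    show "AE x in M. \<bar>H x\<bar> \<le> c" by (rule AE_abs_limit_le[where X=J]) (use J_bd J_lim in auto)
  qed
  have I_lim: "AE x in M. (\<lambda>n. I n x) \<longlonglongrightarrow> X x"
    using lim YX
  proof eventually_elim
    case (elim x)
    then have Yl: "(\<lambda>n. Y n x) \<longlonglongrightarrow> X x" by simp
    show ?case
    proof (rule LIMSEQ_I)
      fix e :: real assume e: "0 < e"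
      then obtain N where N: "\<And>n. N \<le> n \<Longrightarrow> \<bar>Y n x - X x\<bar> < e / 2"
        using LIMSEQ_D[OF Yl, of "e/2"] by auto
      have "norm (I n x - X x) < e" if "N \<le> n" for n
      proof -
        have "X x - e / 2 \<le> I n x"
        proof (rule I_ge)
          fix k assume "n \<le> k"
          with that have "N \<le> k" by simp
          from N[OF this] show "X x - e / 2 \<le> Y k x" by linarith
        qed
        with I_le[of n n x] N[OF that] e show ?thesis unfolding real_norm_def by linarith
      qed
      then show "\<exists>N. \<forall>n\<ge>N. norm (I n x - X x) < e" by blast
    qed
  qed
  obtain d where d: "0 < d" "AE x in M. \<bar>v x\<bar> \<le> d" using v_Linf by (rule Linf_bound)
  have "(\<lambda>x. X x - H x * v x) \<in> A\<^sub>0"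
  proof (rule A0_closed[OF IJ])
    show "AE x in M. \<bar>I n x - J n x * v x\<bar> \<le> 1 + c * d" for n
      using d(2)
    proof eventually_elim
      case (elim x)
      have "\<bar>J n x\<bar> * \<bar>v x\<bar> \<le> c * d" using elim J_bd c(1) by (intro mult_mono) auto
      with I_bd[of n x] show ?case by (simp add: abs_mult[symmetric])
    qed
    show "AE x in M. (\<lambda>n. I n x - J n x * v x) \<longlonglongrightarrow> X x - H x * v x"
      using I_lim by eventually_elim (intro tendsto_intros J_lim)
    show "(\<lambda>x. X x - H x * v x) \<in> borel_measurable M"
      by (intro Linf_measurable[of _ M] Linf_diff X Linf_times_v HL)
  qed
  then have "AE x in M. \<tau> X x \<le> H x" by (intro price_least X hedgesI HL)
  with TX show ?thesis
  proof eventually_elim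
    case (elim x)
    have "ereal (J n x) \<le> liminf (\<lambda>n. ereal (T n x))" for n
      by (intro Liminf_bounded) (use J_le in \<open>auto simp: eventually_sequentially\<close>)
    then have "ereal (H x) \<le> liminf (\<lambda>n. ereal (T n x))"
      using J_lim[of x] by (intro LIMSEQ_le_const2[of "\<lambda>n. ereal (J n x)"]) auto
    with elim show ?case by (auto intro: order_trans[of _ "ereal (H x)"])
  qed
qed

text \<open>If the probabilities did not tend to 0, they would stay above some d > 0 along a
  subsequence. A further subsequence of the positions converges almost surely, and the almost sure
  Fatou property contradicts this.\<close>

lemma price_Fatou_prob:
  assumes X: "X \<in> Linf M M" and Xn: "\<And>n. Xn n \<in> Linf M M" "\<And>n. AE x in M. \<bar>Xn n x\<bar> \<le> 1"
    and lim: "tendsto_in_prob M Xn X"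
  shows "le_liminf_in_prob M (\<tau> X) (\<lambda>n. \<tau> (Xn n))"
  unfolding le_liminf_in_prob_def
proof (intro allI impI)
  fix e :: real assume e: "0 < e"
  define S where "S n = {x \<in> space M. \<tau> (Xn n) x < \<tau> X x - e}" for n
  have [measurable]: "\<tau> X \<in> borel_measurable M" "\<tau> (Xn n) \<in> borel_measurable M" for n
    using X Xn(1) price_Linf Linf_F0 Linf_measurable by blast+
  have S: "S n \<in> sets M" for n unfolding S_def by measurable
  have "(\<lambda>n. measure M (S n)) \<longlonglongrightarrow> 0"
  proof (rule ccontr)
    assume "\<not> ?thesis"
    then obtain d where d: "0 < d" "\<And>N. \<exists>n\<ge>N. d \<le> measure M (S n)"
      by (auto simp: LIMSEQ_def dist_real_def not_less)
    then have "infinite {n. d \<le> measure M (S n)}"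
      by (auto simp: infinite_nat_iff_unbounded_le)
    then obtain r where r: "strict_mono (r :: nat \<Rightarrow> nat)" "\<And>n. d \<le> measure M (S (r n))"
      using infinite_enumerate[of "{n. d \<le> measure M (S n)}"] by auto
    have "tendsto_in_prob M (\<lambda>n. Xn (r n)) X"
      using lim LIMSEQ_subseq_LIMSEQ[OF _ r(1)] unfolding tendsto_in_prob_def by (auto simp: o_def)
    then obtain s where s: "strict_mono s" "AE x in M. (\<lambda>n. Xn (r (s n)) x) \<longlonglongrightarrow> X x"
      using tendsto_in_prob_AE_subseq[of "\<lambda>n. Xn (r n)" X] X Xn(1) by (auto dest: Linf_measurable)
    have "AE x in M. ereal (\<tau> X x) \<le> liminf (\<lambda>n. ereal (\<tau> (Xn (r (s n))) x))"
      by (rule price_Fatou_AE[OF X Xn s(2)])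
    then have "AE x in M. \<forall>\<^sub>F n in sequentially. x \<notin> S (r (s n))"
    proof eventually_elim
      case (elim x)
      have "ereal (\<tau> X x - e) < ereal (\<tau> X x)" using e by simp
      also note elim
      finally have "\<forall>\<^sub>F n in sequentially. ereal (\<tau> X x - e) < ereal (\<tau> (Xn (r (s n))) x)"
        by (rule less_LiminfD)
      then show ?case by eventually_elim (auto simp: S_def)
    qed
    then have "(\<lambda>n. measure M (S (r (s n)))) \<longlonglongrightarrow> 0"
      by (rule AE_eventually_notin_measure[OF S])
    then have "d \<le> 0" by (rule LIMSEQ_le_const) (use r(2) in auto)
    with d(1) show False by simp
  qed
  then show "(\<lambda>n. measure M {x \<in> space M. \<tau> (Xn n) x < \<tau> X x - e}) \<longlonglongrightarrow> 0"
    by (simp add: S_def)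
qed

theorem price_conditional_relevant_coherent_Fatou: "conditional_relevant_coherent_Fatou M F\<^sub>0 v \<tau>"
  unfolding conditional_relevant_coherent_Fatou_def conditional_Fatou_def
  by (intro conjI ballI allI impI price_Linf price_mono price_subadd price_translation
      price_homogeneous price_relevant price_Fatou_AE price_Fatou_prob; blast)

end

section \<open>Conditional expectations under the test probabilities\<close>

text \<open>The event where the conditional expectation is positive is itself an admissible test
  event. With integrals over events, closedness of \<open>A\<^sub>0\<close> becomes a matter of
  bounded convergence.\<close>

lemma (in finite_measure_subalgebra) real_cond_exp_nonpos_iff:
  assumes X: "integrable M X"
  shows "(AE x in M. real_cond_exp M F X x \<le> 0) \<longleftrightarrow>
    (\<forall>G\<in>sets F. (LINT x|M. indicat_real G x * X x) \<le> 0)"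
proof
  have FM: "G \<in> sets F \<Longrightarrow> G \<in> sets M" for G using subalg by (auto simp: subalgebra_def)
  have sp: "space F = space M" using subalg by (simp add: subalgebra_def)
  have int: "integrable M (\<lambda>x. indicat_real G x * X x)" if "G \<in> sets F" for G
    using integrable_mult_indicator[OF FM[OF that] X] by simp
  have eq: "(LINT x|M. indicat_real G x * real_cond_exp M F X x) = (LINT x|M. indicat_real G x * X x)"
    and int': "integrable M (\<lambda>x. indicat_real G x * real_cond_exp M F X x)" if "G \<in> sets F" for G
    using that X int by (auto intro!: real_cond_exp_intg)
  {
    assume le: "AE x in M. real_cond_exp M F X x \<le> 0"
    show "\<forall>G\<in>sets F. (LINT x|M. indicat_real G x * X x) \<le> 0"
    proof
      fix G assume G: "G \<in> sets F"
      have "(LINT x|M. indicat_real G x * real_cond_exp M F X x) \<le> (LINT x|M. 0)"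
        using le int'[OF G] by (intro integral_mono_AE) (auto simp: indicator_def elim!: eventually_mono)
      with eq[OF G] show "(LINT x|M. indicat_real G x * X x) \<le> 0" by simp
    qed
  next
    assume le: "\<forall>G\<in>sets F. (LINT x|M. indicat_real G x * X x) \<le> 0"
    let ?G = "{x \<in> space F. 0 < real_cond_exp M F X x}"
    have G: "?G \<in> sets F" by measurable
    have nn: "AE x in M. 0 \<le> indicat_real ?G x * real_cond_exp M F X x"
      by (auto simp: indicator_def)
    have "(LINT x|M. indicat_real ?G x * real_cond_exp M F X x) = 0"
      using le G eq[OF G] integral_nonneg_AE[OF nn] by (intro antisym) auto
    then have "AE x in M. indicat_real ?G x * real_cond_exp M F X x = 0"
      using integral_nonneg_eq_0_iff_AE[OF int'[OF G] nn] by simp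
    with AE_space show "AE x in M. real_cond_exp M F X x \<le> 0"
      by eventually_elim (auto simp: sp indicator_def split: if_splits)
  }
qed

locale conditional_coherent_risk = coherent_risk +
  fixes F\<^sub>0 :: "'a measure" and v :: "'a \<Rightarrow> real"
  assumes sub: "subalgebra M F\<^sub>0" and v: "v \<in> numeraires M F\<^sub>0 \<rho>"
begin

abbreviation "A0 \<equiv> acceptance_set0 M F\<^sub>0 \<rho>"

lemma numeraire_Linf: "v \<in> Linf M M" and numeraire_nonneg: "AE x in M. 0 \<le> v x"
  using v by (auto simp: numeraires_def)

lemma test_probsD:
  assumes "Q \<in> test_probs M \<rho>"
  shows "prob_space Q" "sets Q = sets M" "absolutely_continuous M Q" "space Q = space M"
    "finite_measure_subalgebra Q F\<^sub>0"
    and AE_test_prob: "\<And>P. AE x in M. P x \<Longrightarrow> AE x in Q. P x"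
    and Linf_test_prob: "\<And>X. X \<in> Linf M M \<Longrightarrow> X \<in> Linf Q Q"
    and integrable_test_prob: "\<And>X. X \<in> Linf M M \<Longrightarrow> integrable Q X"
proof -
  show Q: "prob_space Q" "sets Q = sets M" "absolutely_continuous M Q"
    using assms by (auto simp: test_probs_def)
  interpret Q: prob_space Q by fact
  show sp: "space Q = space M" using Q(2) by (rule sets_eq_imp_space_eq)
  show "finite_measure_subalgebra Q F\<^sub>0"
    using sub Q(2) sp by unfold_locales (simp add: subalgebra_def)
  show AE: "AE x in Q. P x" if "AE x in M. P x" for P
    using Q(2,3) that by (metis absolutely_continuous_AE)
  show L: "X \<in> Linf Q Q" if "X \<in> Linf M M" for X
    using that AE by (auto simp: Linf_def measurable_cong_sets[OF Q(2) refl])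
  show "integrable Q X" if "X \<in> Linf M M" for X
    using L[OF that] by (rule Q.integrable_Linf)
qed

lemma acceptance_set0_iff:
  "X \<in> A0 \<longleftrightarrow> X \<in> Linf M M \<and>
    (\<forall>Q\<in>test_probs M \<rho>. \<forall>G\<in>sets F\<^sub>0. (LINT x|Q. indicat_real G x * X x) \<le> 0)"
  unfolding acceptance_set0_def
  using finite_measure_subalgebra.real_cond_exp_nonpos_iff[OF test_probsD(5) integrable_test_prob]
  by auto

sublocale conditional_acceptance M F\<^sub>0 A0 v
proof
  have FM: "G \<in> sets F\<^sub>0 \<Longrightarrow> G \<in> sets M" for G using sub by (auto simp: subalgebra_def)
  show "subalgebra M F\<^sub>0" by (rule sub)
  show A0L: "X \<in> Linf M M" if "X \<in> A0" for X using that by (simp add: acceptance_set0_def)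
  have ind: "(\<lambda>x. indicat_real G x * X x) \<in> Linf M M" if "G \<in> sets F\<^sub>0" "X \<in> Linf M M" for G X
    using that FM by (intro Linf_mult Linf_indicator)
  show "(\<lambda>x. X x + Y x) \<in> A0" if X: "X \<in> A0" and Y: "Y \<in> A0" for X Y
    unfolding acceptance_set0_iff
  proof (intro conjI ballI)
    fix Q G assume Q: "Q \<in> test_probs M \<rho>" and G: "G \<in> sets F\<^sub>0"
    have "(LINT x|Q. indicat_real G x * (X x + Y x))
        = (LINT x|Q. indicat_real G x * X x) + (LINT x|Q. indicat_real G x * Y x)"
      unfolding distrib_left
      by (intro Bochner_Integration.integral_add integrable_test_prob[OF Q] ind G A0L X Y)
    with X Y Q G show "(LINT x|Q. indicat_real G x * (X x + Y x)) \<le> 0"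
      by (auto simp: acceptance_set0_iff intro: add_nonpos_nonpos)
  qed (use X Y A0L in auto)
  show "(\<lambda>x. a x * X x) \<in> A0" if X: "X \<in> A0" and a: "a \<in> Linf M F\<^sub>0" "AE x in M. 0 \<le> a x" for X a
    unfolding acceptance_set0_def
  proof (intro CollectI conjI ballI)
    have aL: "a \<in> Linf M M" using Linf_subalgebra[OF sub a(1)] .
    show aX: "(\<lambda>x. a x * X x) \<in> Linf M M" using aL A0L[OF X] by auto
    fix Q assume Q: "Q \<in> test_probs M \<rho>"
    interpret Q: finite_measure_subalgebra Q F\<^sub>0 by (rule test_probsD(5)[OF Q])
    have "AE x in Q. real_cond_exp Q F\<^sub>0 (\<lambda>x. a x * X x) x = a x * real_cond_exp Q F\<^sub>0 X x"
      using a(1) integrable_test_prob[OF Q A0L[OF X]] integrable_test_prob[OF Q aX]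
      by (intro Q.real_cond_exp_mult) (auto dest: Linf_measurable)
    moreover have "AE x in Q. real_cond_exp Q F\<^sub>0 X x \<le> 0" using X Q by (auto simp: acceptance_set0_def)
    ultimately show "AE x in Q. real_cond_exp Q F\<^sub>0 (\<lambda>x. a x * X x) x \<le> 0"
      using AE_test_prob[OF Q a(2)] by eventually_elim (simp add: mult_nonneg_nonpos)
  qed
  show "X \<in> A0" if X: "X \<in> Linf M M" "AE x in M. X x \<le> 0" for X
    unfolding acceptance_set0_iff
  proof (intro conjI ballI X(1))
    fix Q G assume Q: "Q \<in> test_probs M \<rho>" and G: "G \<in> sets F\<^sub>0"
    have "(LINT x|Q. indicat_real G x * X x) \<le> (LINT x|Q. 0)"
      using AE_test_prob[OF Q X(2)] integrable_test_prob[OF Q ind[OF G X(1)]]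
      by (intro integral_mono_AE) (auto simp: indicator_def elim!: eventually_mono)
    then show "(LINT x|Q. indicat_real G x * X x) \<le> 0" by simp
  qed
  show "X \<in> A0" if U: "\<And>k::nat. U k \<in> A0" "\<And>k. AE x in M. \<bar>U k x\<bar> \<le> c"
    and X: "X \<in> borel_measurable M" "AE x in M. (\<lambda>k. U k x) \<longlonglongrightarrow> X x" for U c X
    unfolding acceptance_set0_iff
  proof (intro conjI ballI)
    show XL: "X \<in> Linf M M" using X(1) AE_abs_limit_le[OF U(2) X(2)] by (rule LinfI)
    fix Q G assume Q: "Q \<in> test_probs M \<rho>" and G: "G \<in> sets F\<^sub>0"
    interpret Q: prob_space Q by (rule test_probsD(1)[OF Q])
    have "(\<lambda>k. LINT x|Q. indicat_real G x * U k x) \<longlonglongrightarrow> (LINT x|Q. indicat_real G x * X x)"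
    proof (rule Q.integral_tendsto_bounded)
      show "(\<lambda>x. indicat_real G x * U k x) \<in> borel_measurable Q" for k
        by (intro Linf_measurable[of _ Q] Linf_test_prob[OF Q] ind G A0L U)
      show "(\<lambda>x. indicat_real G x * X x) \<in> borel_measurable Q"
        by (intro Linf_measurable[of _ Q] Linf_test_prob[OF Q] ind G XL)
      show "AE x in Q. \<bar>indicat_real G x * U k x\<bar> \<le> \<bar>c\<bar>" for k
        using AE_test_prob[OF Q U(2)[of k]] by eventually_elim (auto simp: indicator_def)
      show "AE x in Q. (\<lambda>k. indicat_real G x * U k x) \<longlonglongrightarrow> indicat_real G x * X x"
        using AE_test_prob[OF Q X(2)] by eventually_elim (intro tendsto_intros)
    qed
    then show "(LINT x|Q. indicat_real G x * X x) \<le> 0"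
      by (rule LIMSEQ_le_const2) (use U(1) Q G in \<open>auto simp: acceptance_set0_iff\<close>)
  qed
  \<comment> \<open>A test probability charging \<open>S\<close> would give its indicator a positive
    integral over the whole space, which also belongs to \<open>F\<^sub>0\<close>.\<close>
  show "measure M S = 0" if S: "S \<in> sets M" "indicat_real S \<in> A0" for S
  proof (rule ccontr)
    assume "measure M S \<noteq> 0"
    then have "0 < measure M S" by (simp add: zero_less_measure_iff)
    then obtain Q where Q: "Q \<in> test_probs M \<rho>" "0 < measure Q S"
      using test_prob_charging[OF S(1)] by blast
    have "(LINT x|Q. indicat_real (space M) x * indicat_real S x) \<le> 0"
      using S(2) Q(1) sub sets.top[of F\<^sub>0] by (auto simp: acceptance_set0_iff subalgebra_def)
    also have "(LINT x|Q. indicat_real (space M) x * indicat_real S x) = measure Q S"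
      using S(1) test_probsD[OF Q(1)] by (simp add: indicator_inter_arith[symmetric] sets.Int_space_eq1)
    finally show False using Q(2) by simp
  qed
  show "v \<in> Linf M M" "AE x in M. 0 \<le> v x" by (fact numeraire_Linf numeraire_nonneg)+
  show "\<exists>m\<in>Linf M F\<^sub>0. (\<lambda>x. X x - m x * v x) \<in> A0" if "X \<in> Linf M M" for X
  proof -
    from that v obtain Y m where "X = (\<lambda>x. Y x + m x * v x)" "Y \<in> A0" "m \<in> Linf M F\<^sub>0"
      unfolding numeraires_def by blast
    then show ?thesis by (intro bexI[of _ m]) simp_all
  qed
qed

section \<open>Almost sure statements under a test probability, and the conditional ratios\<close>

abbreviation "Z0 Q \<equiv> real_cond_exp M F\<^sub>0 (RN_density M Q)"

text \<open>For an event B of \<open>F\<^sub>0\<close>, Q(B) is the integral of \<open>Z0 Q\<close>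
  over B, so B is null under Q exactly when its part in {Z0 > 0} is null under \<open>M\<close>.
  This matches the default value of \<open>cond_ratio\<close> with statements that hold Q-almost
  surely.\<close>

lemma AE_test_prob_iff:
  assumes Q: "Q \<in> test_probs M \<rho>" and B: "{x \<in> space F\<^sub>0. \<not> P x} \<in> sets F\<^sub>0"
  shows "(AE x in Q. P x) \<longleftrightarrow> (AE x in M. 0 < Z0 Q x \<longrightarrow> P x)"
proof -
  interpret fms: finite_measure_subalgebra M F\<^sub>0 using sub by unfold_locales
  note Q' = test_probsD[OF Q]
  interpret Q: prob_space Q by (rule Q'(1))
  let ?B = "{x \<in> space M. \<not> P x}"
  have BF: "?B \<in> sets F\<^sub>0" using B by (simp add: space_F0)
  have BM: "?B \<in> sets M" using BF by (rule sets_F0)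
  have RN_int: "integrable M (RN_density M Q)"
    using RN_deriv_integrable[OF Q.sigma_finite_measure_axioms Q'(3,2), of "\<lambda>x. 1"]
    by (simp add: RN_density_def[abs_def])
  have int: "integrable M (\<lambda>x. indicat_real ?B x * RN_density M Q x)"
    using integrable_mult_indicator[OF BM RN_int] by simp
  note E = fms.real_cond_exp_intg[OF int borel_measurable_indicator[OF BF] borel_measurable_integrable[OF RN_int]]
  have "AE x in M. 0 \<le> Z0 Q x"
    using RN_int by (intro fms.real_cond_exp_pos) (auto simp: RN_density_def)
  then have nn: "AE x in M. 0 \<le> indicat_real ?B x * Z0 Q x" by eventually_elim simp
  have "measure Q ?B = (LINT x|Q. indicat_real ?B x)" using BM Q'(2) by simp
  also have "\<dots> = (LINT x|M. indicat_real ?B x * RN_density M Q x)"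
    using integral_RN_density[OF Q'(1,3,2), of "indicat_real ?B"] BM by (simp add: mult.commute)
  also have "\<dots> = (LINT x|M. indicat_real ?B x * Z0 Q x)" using E(2) by simp
  finally have "measure Q ?B = 0 \<longleftrightarrow> (AE x in M. indicat_real ?B x * Z0 Q x = 0)"
    using integral_nonneg_eq_0_iff_AE[OF E(1) nn] by simp
  also have "\<dots> \<longleftrightarrow> (AE x in M. 0 < Z0 Q x \<longrightarrow> P x)"
    using \<open>AE x in M. 0 \<le> Z0 Q x\<close> AE_space
    by (intro AE_cong_simp[OF refl] iffI; (elim AE_mp)?) (auto simp: indicator_def)
  also have "measure Q ?B = 0 \<longleftrightarrow> (AE x in Q. P x)"
    using BM Q'(2,4) by (subst AE_iff_measurable[of ?B]) (auto simp: Q.emeasure_eq_measure)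
  finally show ?thesis .
qed

text \<open>A hedge n of the constant 1 satisfies 1 \<le> n E_Q(v | \<open>F\<^sub>0\<close>), so
  the conditional expectation of \<open>v\<close> cannot vanish.\<close>

lemma cond_exp_numeraire_pos:
  assumes Q: "Q \<in> test_probs M \<rho>"
  shows "AE x in Q. 0 < real_cond_exp Q F\<^sub>0 v x"
proof -
  interpret Q: finite_measure_subalgebra Q F\<^sub>0 by (rule test_probsD(5)[OF Q])
  obtain n where n: "n \<in> Linf M F\<^sub>0" "(\<lambda>x. 1 - n x * v x) \<in> A0"
    using numeraire[of "\<lambda>x. 1"] by auto
  have vL: "integrable Q v" by (rule integrable_test_prob[OF Q v_Linf])
  have nv: "integrable Q (\<lambda>x. n x * v x)" by (rule integrable_test_prob[OF Q Linf_times_v[OF n(1)]])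
  have "AE x in Q. real_cond_exp Q F\<^sub>0 (\<lambda>x. 1 - n x * v x) x \<le> 0"
    using n(2) Q by (auto simp: acceptance_set0_def)
  moreover have "AE x in Q. real_cond_exp Q F\<^sub>0 (\<lambda>x. 1 - n x * v x) x =
      real_cond_exp Q F\<^sub>0 (\<lambda>x. 1) x - real_cond_exp Q F\<^sub>0 (\<lambda>x. n x * v x) x"
    using nv by (intro Q.real_cond_exp_diff) auto
  moreover have "AE x in Q. real_cond_exp Q F\<^sub>0 (\<lambda>x. 1) x = 1"
    by (intro Q.real_cond_exp_F_meas) auto
  moreover have "AE x in Q. real_cond_exp Q F\<^sub>0 (\<lambda>x. n x * v x) x = n x * real_cond_exp Q F\<^sub>0 v x"
    using n(1) vL nv by (intro Q.real_cond_exp_mult) (auto dest: Linf_measurable)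
  moreover have "AE x in Q. 0 \<le> real_cond_exp Q F\<^sub>0 v x"
    using AE_test_prob[OF Q v_nonneg] vL by (intro Q.real_cond_exp_pos) auto
  ultimately show ?thesis
  proof eventually_elim
    case (elim x)
    then have "real_cond_exp Q F\<^sub>0 v x \<noteq> 0" by auto
    with elim show ?case by simp
  qed
qed

text \<open>The denominator is positive Q-almost surely, so the bound can be multiplied out and
  \<open>m\<close>, being \<open>F\<^sub>0\<close>-measurable, moved into the conditional
  expectation.\<close>

lemma cond_ratio_le_iff:
  assumes Q: "Q \<in> test_probs M \<rho>" and X: "X \<in> Linf M M" and m: "m \<in> Linf M F\<^sub>0"
  shows "(AE x in M. cond_ratio M F\<^sub>0 v Q X x \<le> ereal (m x)) \<longleftrightarrow>
    (AE x in Q. real_cond_exp Q F\<^sub>0 (\<lambda>x. X x - m x * v x) x \<le> 0)"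
proof -
  interpret Q: finite_measure_subalgebra Q F\<^sub>0 by (rule test_probsD(5)[OF Q])
  have [measurable]: "m \<in> borel_measurable F\<^sub>0" using m by (rule Linf_measurable)
  note int = integrable_test_prob[OF Q X] integrable_test_prob[OF Q v_Linf]
    integrable_test_prob[OF Q Linf_times_v[OF m]]
  let ?R = "\<lambda>x. real_cond_exp Q F\<^sub>0 X x / real_cond_exp Q F\<^sub>0 v x"
  have "(AE x in M. cond_ratio M F\<^sub>0 v Q X x \<le> ereal (m x)) \<longleftrightarrow> (AE x in M. 0 < Z0 Q x \<longrightarrow> ?R x \<le> m x)"
    by (intro AE_cong) (simp add: cond_ratio_def)
  also have "\<dots> \<longleftrightarrow> (AE x in Q. ?R x \<le> m x)"
    by (rule AE_test_prob_iff[OF Q, symmetric]) measurable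
  also have "\<dots> \<longleftrightarrow> (AE x in Q. real_cond_exp Q F\<^sub>0 (\<lambda>x. X x - m x * v x) x \<le> 0)"
  proof -
    have "AE x in Q. real_cond_exp Q F\<^sub>0 (\<lambda>x. X x - m x * v x) x =
        real_cond_exp Q F\<^sub>0 X x - real_cond_exp Q F\<^sub>0 (\<lambda>x. m x * v x) x"
      using int by (intro Q.real_cond_exp_diff) auto
    moreover have "AE x in Q. real_cond_exp Q F\<^sub>0 (\<lambda>x. m x * v x) x = m x * real_cond_exp Q F\<^sub>0 v x"
      using int by (intro Q.real_cond_exp_mult) auto
    moreover note cond_exp_numeraire_pos[OF Q]
    ultimately have "AE x in Q. ?R x \<le> m x \<longleftrightarrow> real_cond_exp Q F\<^sub>0 (\<lambda>x. X x - m x * v x) x \<le> 0"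
      by eventually_elim (simp add: pos_divide_le_eq)
    then show ?thesis by (rule eventually_subst)
  qed
  finally show ?thesis .
qed

lemma hedges_iff_cond_ratio:
  assumes X: "X \<in> Linf M M" and m: "m \<in> Linf M F\<^sub>0"
  shows "m \<in> hedges X \<longleftrightarrow> (\<forall>Q\<in>test_probs M \<rho>. AE x in M. cond_ratio M F\<^sub>0 v Q X x \<le> ereal (m x))"
proof -
  have "m \<in> hedges X \<longleftrightarrow> (\<lambda>x. X x - m x * v x) \<in> A0" using m by (simp add: hedges_def)
  then show ?thesis
    using Linf_diff[OF X Linf_times_v[OF m]] cond_ratio_le_iff[OF _ X m]
    by (auto simp: acceptance_set0_def)
qed

text \<open>Some constant c hedges - X, and taking conditional expectations of - X - c v gives a
  bound independent of Q.\<close>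

lemma cond_ratio_ge:
  assumes X: "X \<in> Linf M M"
  obtains c where "0 < c"
    "\<And>Q. Q \<in> test_probs M \<rho> \<Longrightarrow> AE x in M. 0 < Z0 Q x \<longrightarrow> ereal (- c) \<le> cond_ratio M F\<^sub>0 v Q X x"
proof -
  obtain n where n: "n \<in> hedges (\<lambda>x. - X x)"
    using hedges_least[OF Linf_uminus[OF X]] by blast
  obtain c where c: "0 < c" "AE x in M. \<bar>n x\<bar> \<le> c" using hedges_Linf[OF n] by (rule Linf_bound)
  have "AE x in M. n x \<le> c" using c(2) by eventually_elim simp
  then have "(\<lambda>x. c) \<in> hedges (\<lambda>x. - X x)"
    using X by (intro hedges_mono[OF n]) auto
  from hedges_A0[OF this] have A: "(\<lambda>x. - X x - c * v x) \<in> A0" by simp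
  have "AE x in M. 0 < Z0 Q x \<longrightarrow> ereal (- c) \<le> cond_ratio M F\<^sub>0 v Q X x" if Q: "Q \<in> test_probs M \<rho>" for Q
  proof -
    interpret Q: finite_measure_subalgebra Q F\<^sub>0 by (rule test_probsD(5)[OF Q])
    let ?R = "\<lambda>x. real_cond_exp Q F\<^sub>0 X x / real_cond_exp Q F\<^sub>0 v x"
    note int = integrable_test_prob[OF Q X] integrable_test_prob[OF Q v_Linf]
    have "AE x in Q. real_cond_exp Q F\<^sub>0 (\<lambda>x. (-1) * X x - c * v x) x \<le> 0"
      using A Q by (auto simp: acceptance_set0_def)
    moreover have "AE x in Q. real_cond_exp Q F\<^sub>0 (\<lambda>x. (-1) * X x - c * v x) x =
        real_cond_exp Q F\<^sub>0 (\<lambda>x. (-1) * X x) x - real_cond_exp Q F\<^sub>0 (\<lambda>x. c * v x) x"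
      using int by (intro Q.real_cond_exp_diff) auto
    moreover have "AE x in Q. real_cond_exp Q F\<^sub>0 (\<lambda>x. (-1) * X x) x = (-1) * real_cond_exp Q F\<^sub>0 X x"
      "AE x in Q. real_cond_exp Q F\<^sub>0 (\<lambda>x. c * v x) x = c * real_cond_exp Q F\<^sub>0 v x"
      using int by (intro Q.real_cond_exp_cmult; simp)+
    moreover note cond_exp_numeraire_pos[OF Q]
    ultimately have "AE x in Q. - c \<le> ?R x"
      by eventually_elim (simp add: field_simps)
    then have "AE x in M. 0 < Z0 Q x \<longrightarrow> - c \<le> ?R x"
      by (subst (asm) AE_test_prob_iff[OF Q]) measurable
    then show ?thesis by eventually_elim (simp add: cond_ratio_def)
  qed
  with c(1) that show ?thesis by blast
qed

text \<open>A single Q says nothing where its ratio is - \<infinity>. But if {h < - c} had positive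
  probability, some Q would charge it, and the ratio of that Q is at least - c at Q-almost every
  point.\<close>

lemma dominating_cond_ratio_ge:
  assumes h: "h \<in> borel_measurable M"
    and dom: "\<And>Q. Q \<in> test_probs M \<rho> \<Longrightarrow> AE x in M. cond_ratio M F\<^sub>0 v Q X x \<le> h x"
    and c: "\<And>Q. Q \<in> test_probs M \<rho> \<Longrightarrow> AE x in M. 0 < Z0 Q x \<longrightarrow> ereal (- c) \<le> cond_ratio M F\<^sub>0 v Q X x"
  shows "AE x in M. ereal (- c) \<le> h x"
proof (rule ccontr)
  assume neg: "\<not> ?thesis"
  let ?N = "{x \<in> space M. h x < ereal (- c)}"
  have N: "?N \<in> sets M" using h by measurable
  have "measure M ?N \<noteq> 0"
  proof
    assume "measure M ?N = 0"
    then have "AE x in M. x \<notin> ?N" using N by (intro AE_not_in) (auto simp: null_sets_def emeasure_eq_measure)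
    with AE_space have "AE x in M. ereal (- c) \<le> h x" by eventually_elim auto
    with neg show False by simp
  qed
  then have "0 < measure M ?N" by (simp add: zero_less_measure_iff)
  then obtain Q where Q: "Q \<in> test_probs M \<rho>" "0 < measure Q ?N"
    using test_prob_charging[OF N] by blast
  interpret Q: prob_space Q by (rule test_probsD(1)[OF Q(1)])
  have "AE x in M. 0 < Z0 Q x \<longrightarrow> x \<notin> ?N"
    using dom[OF Q(1)] c[OF Q(1)] by eventually_elim (auto simp: not_less intro: order_trans)
  then have "AE x in Q. 0 < Z0 Q x \<longrightarrow> x \<notin> ?N" by (rule AE_test_prob[OF Q(1)])
  \<comment> \<open>With this event in place of \<open>P\<close> the right-hand side of the
    equivalence is a tautology.\<close>
  moreover have "AE x in Q. 0 < Z0 Q x" by (subst AE_test_prob_iff[OF Q(1)]) auto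
  ultimately have "AE x in Q. x \<notin> ?N" by eventually_elim auto
  then have "measure Q ?N = 0"
    using N test_probsD(2)[OF Q(1)] by (intro Q.prob_eq_0[THEN iffD2]) auto
  with Q(2) show False by simp
qed

end

section \<open>The price as an essential supremum of ratios\<close>

locale conditional_coherent_price = conditional_coherent_risk M \<rho> F\<^sub>0 v + conditional_price M F\<^sub>0 "acceptance_set0 M F\<^sub>0 \<rho>" v \<tau>
  for M :: "'a measure" and \<rho> F\<^sub>0 v \<tau>
begin

text \<open>An upper bound \<open>h\<close> of the ratios need not be \<open>F\<^sub>0\<close>-measurable; the largest \<open>F\<^sub>0\<close>-measurable
  function below \<open>h\<close> is still an upper bound, and hence a hedge.\<close>

lemma price_is_ess_sup:
  assumes X: "X \<in> Linf M M"
  shows "is_ess_sup M {cond_ratio M F\<^sub>0 v Q X | Q. Q \<in> test_probs M \<rho>} (\<lambda>x. ereal (\<tau> X x))"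
  unfolding is_ess_sup_def
proof (intro conjI ballI impI)
  have "\<tau> X \<in> borel_measurable M" by (rule Linf_measurable[OF Linf_F0[OF price_Linf[OF X]]])
  then show "(\<lambda>x. ereal (\<tau> X x)) \<in> borel_measurable M" by measurable
  have ub: "AE x in M. cond_ratio M F\<^sub>0 v Q X x \<le> ereal (\<tau> X x)" if "Q \<in> test_probs M \<rho>" for Q
    using that price_hedges[OF X] hedges_iff_cond_ratio[OF X price_Linf[OF X]] by blast
  then show "AE x in M. f x \<le> ereal (\<tau> X x)" if "f \<in> {cond_ratio M F\<^sub>0 v Q X | Q. Q \<in> test_probs M \<rho>}" for f
    using that by auto
  fix h :: "'a \<Rightarrow> ereal"
  assume h: "h \<in> borel_measurable M"
    and "\<forall>f\<in>{cond_ratio M F\<^sub>0 v Q X | Q. Q \<in> test_probs M \<rho>}. AE x in M. f x \<le> h x"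
  then have dom: "AE x in M. cond_ratio M F\<^sub>0 v Q X x \<le> h x" if "Q \<in> test_probs M \<rho>" for Q
    using that by blast
  obtain b where b: "0 < b"
    "\<And>Q. Q \<in> test_probs M \<rho> \<Longrightarrow> AE x in M. 0 < Z0 Q x \<longrightarrow> ereal (- b) \<le> cond_ratio M F\<^sub>0 v Q X x"
    using cond_ratio_ge[OF X] by blast
  obtain d where d: "0 < d" "AE x in M. \<bar>\<tau> X x\<bar> \<le> d" using price_Linf[OF X] by (rule Linf_bound)
  \<comment> \<open>\<open>b\<close> bounds \<open>h\<close> from below, so the constant - c is
    available below \<open>h\<close>; \<open>d\<close> bounds the price, so truncation at c does not
    cut any ratio from above.\<close>
  define c where "c = max b d"
  have c: "0 < c" "b \<le> c" "d \<le> c" using b(1) by (auto simp: c_def)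
  have "AE x in M. ereal (- b) \<le> h x" using dom b(2) by (rule dominating_cond_ratio_ge[OF h])
  then have hc: "AE x in M. ereal (- c) \<le> h x"
  proof eventually_elim
    case (elim x)
    with c(2) show ?case by - (rule order_trans[of "ereal (- c)" "ereal (- b)"], auto)
  qed
  \<comment> \<open>The elements are negatives of bounded \<open>F\<^sub>0\<close>-measurable
    functions below \<open>h\<close>: the largest such function is obtained from a least
    element.\<close>
  define S where "S = {u \<in> Linf M F\<^sub>0. (AE x in M. \<bar>u x\<bar> \<le> c) \<and> (AE x in M. ereal (- u x) \<le> h x)}"
  obtain w where w: "w \<in> S" "\<And>u. u \<in> S \<Longrightarrow> AE x in M. w x \<le> u x"
  proof (rule Linf_least[OF sub, of S "- c"])
    show "S \<subseteq> Linf M F\<^sub>0" by (auto simp: S_def)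
    have "(\<lambda>x. c) \<in> S" using hc c(1) by (simp add: S_def)
    then show "S \<noteq> {}" by blast
    show "AE x in M. - c \<le> m x" if "m \<in> S" for m
      using that unfolding S_def by (auto elim!: eventually_mono)
    show "(\<lambda>x. min (m x) (n x)) \<in> S" if "m \<in> S" "n \<in> S" for m n
    proof -
      have "AE x in M. \<bar>m x\<bar> \<le> c" "AE x in M. \<bar>n x\<bar> \<le> c" "AE x in M. ereal (- m x) \<le> h x" "AE x in M. ereal (- n x) \<le> h x"
        using that by (auto simp: S_def)
      then have "AE x in M. \<bar>min (m x) (n x)\<bar> \<le> c \<and> ereal (- min (m x) (n x)) \<le> h x"
        by eventually_elim (auto simp: min_def)
      with that show ?thesis unfolding S_def by auto
    qed
    show "w \<in> S" if u: "\<And>k::nat. u k \<in> S" and "\<And>k. AE x in M. \<bar>u k x\<bar> \<le> d" and w: "w \<in> borel_measurable F\<^sub>0" "AE x in M. (\<lambda>k. u k x) \<longlonglongrightarrow> w x" for u w d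
    proof -
      have ub: "AE x in M. \<bar>u k x\<bar> \<le> c" for k using u by (auto simp: S_def)
      have wb: "AE x in M. \<bar>w x\<bar> \<le> c" by (rule AE_abs_limit_le[OF ub w(2)])
      have "AE x in M. \<forall>k. ereal (- u k x) \<le> h x" using u by (subst AE_all_countable) (auto simp: S_def)
      with w(2) have "AE x in M. ereal (- w x) \<le> h x"
      proof eventually_elim
        case (elim x)
        then have "(\<lambda>k. ereal (- u k x)) \<longlonglongrightarrow> ereal (- w x)" by (auto intro!: tendsto_intros)
        then show ?case by (rule LIMSEQ_le_const2) (use elim in auto)
      qed
      with wb LinfI[OF w(1) wb] show ?thesis by (simp add: S_def)
    qed
  qed blast
  have wL: "w \<in> Linf M F\<^sub>0" and wh: "AE x in M. ereal (- w x) \<le> h x" using w(1) by (auto simp: S_def)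
  have "AE x in M. cond_ratio M F\<^sub>0 v Q X x \<le> ereal (- w x)" if Q: "Q \<in> test_probs M \<rho>" for Q
  proof -
    let ?R = "\<lambda>x. real_cond_exp Q F\<^sub>0 X x / real_cond_exp Q F\<^sub>0 v x"
    \<comment> \<open>The negative of the truncated ratio of Q. Where Q does not contribute, the
      default - c stays below \<open>h\<close>.\<close>
    let ?u = "\<lambda>x. - (if 0 < Z0 Q x then max (- c) (min c (?R x)) else - c)"
    have uh: "AE x in M. ereal (- ?u x) \<le> h x"
      using dom[OF Q] hc
    proof eventually_elim
      case (elim x)
      have "ereal (max (- c) (min c (?R x))) \<le> h x" if "0 < Z0 Q x"
      proof -
        have "ereal (?R x) \<le> h x" using elim(1) that by (simp add: cond_ratio_def)
        with elim(2) show ?thesis by (cases "h x") (simp_all add: min.coboundedI2)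
      qed
      with elim(2) show ?case by simp
    qed
    have uc: "AE x in M. \<bar>?u x\<bar> \<le> c" using c(1) by (intro AE_I2) auto
    have "?u \<in> borel_measurable F\<^sub>0" by measurable
    from LinfI[OF this uc] uc uh have "?u \<in> S" unfolding S_def by blast
    from w(2)[OF this] ub[OF Q] d(2) show ?thesis
    proof eventually_elim
      case (elim x)
      show ?case
      proof (cases "0 < Z0 Q x")
        case True
        \<comment> \<open>The ratio is at most the price, which is at most d \<le> c, so the upper
          truncation is inactive; the lower one can only raise the value.\<close>
        with elim c(3) have "?R x \<le> c" by (auto simp: cond_ratio_def)
        with elim(1) True show ?thesis by (auto simp: cond_ratio_def)
      qed (simp add: cond_ratio_def)
    qed
  qed
  then have "(\<lambda>x. - w x) \<in> hedges X"
    using hedges_iff_cond_ratio[OF X Linf_uminus[OF wL]] by blast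
  from price_least[OF X this] wh show "AE x in M. ereal (\<tau> X x) \<le> h x"
  proof eventually_elim
    case (elim x)
    then show ?case by - (rule order_trans[of _ "ereal (- w x)"], auto)
  qed
qed

end

section \<open>The essential infimum as a least hedge, and the conclusion\<close>

context conditional_coherent_risk
begin

lemma is_rho0_hedges:
  "is_rho0 M F\<^sub>0 \<rho> v \<tau> \<longleftrightarrow> (\<forall>X\<in>Linf M M. \<tau> X \<in> Linf M F\<^sub>0 \<and>
     is_ess_inf M {\<lambda>x. ereal (m x) | m. m \<in> hedges X} (\<lambda>x. ereal (\<tau> X x)))"
  unfolding is_rho0_def hedges_def by simp

text \<open>The essential infimum is attained: the least hedge is a measurable lower bound of all
  hedges, so it lies below any version of the infimum, which is then a hedge by upward
  closure.\<close>

lemma is_rho0_iff_least_hedge: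
  "is_rho0 M F\<^sub>0 \<rho> v \<tau> \<longleftrightarrow>
    (\<forall>X\<in>Linf M M. \<tau> X \<in> hedges X \<and> (\<forall>m\<in>hedges X. AE x in M. \<tau> X x \<le> m x))"
  unfolding is_rho0_hedges
proof (intro ball_cong refl iffI conjI ballI)
  fix X assume X: "X \<in> Linf M M"
  {
    assume *: "\<tau> X \<in> Linf M F\<^sub>0 \<and> is_ess_inf M {\<lambda>x. ereal (m x) | m. m \<in> hedges X} (\<lambda>x. ereal (\<tau> X x))"
    then show "AE x in M. \<tau> X x \<le> m x" if "m \<in> hedges X" for m
      using that by (fastforce simp: is_ess_inf_def)
    obtain w where w: "w \<in> hedges X" "\<And>m. m \<in> hedges X \<Longrightarrow> AE x in M. w x \<le> m x"
      using hedges_least[OF X] by blast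
    have "w \<in> borel_measurable M" by (rule Linf_measurable[OF Linf_F0[OF hedges_Linf[OF w(1)]]])
    then have "(\<lambda>x. ereal (w x)) \<in> borel_measurable M" by measurable
    then have "AE x in M. ereal (w x) \<le> ereal (\<tau> X x)"
      using * w(2) unfolding is_ess_inf_def by fastforce
    then show "\<tau> X \<in> hedges X"
      using * X by (intro hedges_mono[OF w(1)]) auto
  }
  {
    assume *: "\<tau> X \<in> hedges X \<and> (\<forall>m\<in>hedges X. AE x in M. \<tau> X x \<le> m x)"
    then show L: "\<tau> X \<in> Linf M F\<^sub>0" using hedges_Linf by blast
    have "\<tau> X \<in> borel_measurable M" by (rule Linf_measurable[OF Linf_F0[OF L]])
    then show "is_ess_inf M {\<lambda>x. ereal (m x) | m. m \<in> hedges X} (\<lambda>x. ereal (\<tau> X x))"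
      using * unfolding is_ess_inf_def by auto
  }
qed

end

theorem lemma4p4:
  fixes M F\<^sub>0 :: "'a measure"
    and \<rho> :: "('a \<Rightarrow> real) \<Rightarrow> real"
    and v :: "'a \<Rightarrow> real"
  assumes "prob_space M"
    and "subalgebra M F\<^sub>0"
    and "relevant_coherent_Fatou M \<rho>"
    and "v \<in> numeraires M F\<^sub>0 \<rho>"
  shows "(\<exists>\<tau>. is_rho0 M F\<^sub>0 \<rho> v \<tau>) \<and>
    (\<forall>\<tau>. is_rho0 M F\<^sub>0 \<rho> v \<tau> \<longrightarrow>
       conditional_relevant_coherent_Fatou M F\<^sub>0 v \<tau> \<and>
       acceptance_set0 M F\<^sub>0 \<rho> = {X \<in> Linf M M. AE x in M. \<tau> X x \<le> 0} \<and>
       (\<forall>X \<in> Linf M M.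
          is_ess_sup M {cond_ratio M F\<^sub>0 v Q X | Q. Q \<in> test_probs M \<rho>} (\<lambda>x. ereal (\<tau> X x))))"
proof -
  interpret prob_space M by fact
  interpret conditional_coherent_risk M \<rho> F\<^sub>0 v
    using assms by unfold_locales
  show ?thesis
  proof (intro conjI allI impI)
    \<comment> \<open>A version is chosen for each X separately; since every property of the price
      is almost sure, no compatibility between these choices is required.\<close>
    have "\<forall>X\<in>Linf M M. \<exists>w. w \<in> hedges X \<and> (\<forall>m\<in>hedges X. AE x in M. w x \<le> m x)"
      using hedges_least by metis
    then show "\<exists>\<tau>. is_rho0 M F\<^sub>0 \<rho> v \<tau>"
      unfolding is_rho0_iff_least_hedge by (rule bchoice)
  next
    fix \<tau> assume "is_rho0 M F\<^sub>0 \<rho> v \<tau>"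
    then interpret conditional_coherent_price M \<rho> F\<^sub>0 v \<tau>
      by unfold_locales (auto simp: is_rho0_iff_least_hedge)
    show "conditional_relevant_coherent_Fatou M F\<^sub>0 v \<tau>"
      by (rule price_conditional_relevant_coherent_Fatou)
    show "acceptance_set0 M F\<^sub>0 \<rho> = {X \<in> Linf M M. AE x in M. \<tau> X x \<le> 0}"
      by (rule A0_eq_price_nonpos)
    show "\<forall>X \<in> Linf M M.
        is_ess_sup M {cond_ratio M F\<^sub>0 v Q X | Q. Q \<in> test_probs M \<rho>} (\<lambda>x. ereal (\<tau> X x))"
      using price_is_ess_sup by blast
  qed
qed

end
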